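(* Let $\mu \in X_* \cap cl(\mathcal C)$ be a dominant cocharacter, and let $J \subseteq S_{\rm aff}$ be a subset. Then we have the equalities $$\mathrm{Adm}^{st}(\mu)\, W_J = \mathrm{Perm}^{st,J}(\mu) = \mathrm{Adm}^J(\mu).$$ In particular, taking $J=\emptyset$ and writing $\mathrm{Perm}^{st}(\mu) := \mathrm{Perm}^{st,\emptyset}(\mu)$, one has $\mathrm{Adm}^{st}(\mu) = \mathrm{Perm}^{st}(\mu) = \mathrm{Adm}(\mu)$.
   Context: Let $(X^*,X_*,R,R^\vee,\Pi)$ be a based reduced root system (root datum) with perfect pairing $\langle\,,\rangle: X^*\times X_*\to\mathbb Z$, simple roots $\Pi$, positive roots $R_+$. Put $V=X_*\otimes\mathbb R$. An affine root is $\tilde\alpha=\alpha+k$ with $\alpha\in R$, $k\in\mathbb Z$; its reflection is $s_{\tilde\alpha}(x)=x-(\langle\alpha,x\rangle+k)\alpha^\vee$, with fixed hyperplane $H_{\tilde\alpha}\subset V$. $W$ is the finite Weyl group, $W_{\rm aff}$ the group generated by all $s_{\tilde\alpha}$, and $\widetilde W=X_*\rtimes W$ the extended affine Weyl group acting on $V$; $t_\lambda\in\widetilde W$ denotes translation by $\lambda\in X_*$. Alcoves are the connected components of $V$ minus all affine root hyperplanes. $cl(\cdot)$ denotes closure. The dominant chamber is $\mathcal C=\{x\in V: \langle\alpha,x\rangle>0\ \forall\alpha\in\Pi\}$, and the base alcove is $\bar{\bf a}=\{x\in V: -1<\langle\alpha,x\rangle<0\ \forall \alpha\in R_+\}$.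 $S_{\rm aff}$ is the set of reflections in the walls of $\bar{\bf a}$; $(W_{\rm aff},S_{\rm aff})$ is a Coxeter system. $\Omega$ is the stabilizer of $\bar{\bf a}$ in $\widetilde W$, so $\widetilde W=W_{\rm aff}\rtimes\Omega$. The Bruhat order on $\widetilde W$: for $u,u'\in W_{\rm aff}$, $\tau,\tau'\in\Omega$, $u\tau\le u'\tau'$ iff $\tau=\tau'$ and $u\le u'$ in $W_{\rm aff}$. For $\mu\in X_*$, $\tau_\mu\in\Omega$ is defined by $t_\mu\in W_{\rm aff}\tau_\mu$. For any subset $J\subseteq S_{\rm aff}$, $W_J\subseteq W_{\rm aff}$ is the subgroup generated by $J$. For $\mu$ dominant: $\mathrm{Adm}(\mu)=\{x\in W_{\rm aff}\tau_\mu : x\le t_\lambda \text{ for some }\lambda\in W\mu\}$ and $\mathrm{Adm}^J(\mu)=W_J\,\mathrm{Adm}(\mu)\,W_J$. For $w\in W$ and an affine root hyperplane $H$, $H^{w+}$ is the side of $H$ containing all alcoves sufficiently deep inside the Weyl chamber $w\mathcal C$, and $H^{w-}$ is the opposite side. If ${\bf f}$ is an alcove, a facet or a point not contained in $H_{\tilde\alpha}$, the reflection ${\bf f}\mapsto s_{\tilde\alpha}({\bf f})$ is in the $w$-opposite direction if ${\bf f}$ (its generic point) lies in $H_{\tilde\alpha}^{w+}$ and $s_{\tilde\alpha}({\bf f})$ lies in $H_{\tilde\alpha}^{w-}$. $B(t_{w\mu}(\bar{\bf a}),w)$ is the set of $x\in W_{\rm aff}\tau_\mu$ such that $x(\bar{\bf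 a})$ is obtained from $t_{w\mu}(\bar{\bf a})$ by a finite (possibly empty) sequence of reflections, each in the $w$-opposite direction. Define $\mathrm{Adm}^{st}(\mu)=\bigcap_{w\in W}B(t_{w\mu}(\bar{\bf a}),w)$. $\mathrm{Vert}(\bar{\bf a})$ is the set of vertices (minimal facets) of $\bar{\bf a}$. A vertex $a$ has type not in $J$ if it is fixed by every element of $J$. For a vertex $v$, $B(v,w)$ is the set of all vertices obtained from $v$ by applying a finite (possibly empty) sequence of reflections, each in the $w$-opposite direction. $\mathrm{Perm}^{st,J}(\mu)$ is the set of $x\in W_{\rm aff}\tau_\mu$ such that $x(a)\in B(t_{w\mu}(a),w)$ for every $a\in\mathrm{Vert}(\bar{\bf a})$ of type not in $J$ and every $w\in W$.
   Formalization: The equalities with Perm^{st,J} are stated only if some vertex of the base alcove has type not in J, or J = S_aff; otherwise they fail, e.g. R = A1×A1, μ = 0, J = S_aff of one factor, where Perm^{st,J}(0) = W_aff but Adm^J(0) = W_J. *)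

theory Defs
  imports "HOL-Analysis.Analysis" "HOL-Algebra.Bij" "HOL-Algebra.Generated_Groups"
begin

section \<open>Based reduced root data\<close>

text \<open>
  The two free abelian groups of a root datum are given as full lattices in real vector
  spaces, so that the type \<open>'v\<close> plays the role of the real vector space \<open>V\<close> spanned by the
  cocharacter lattice (its tensor product with the reals).  The pairing is given by its
  bilinear extension to the ambient spaces.  A norm on \<open>'v\<close> is assumed only to provide the
  usual topology; \<open>'v\<close> is finite-dimensional by the lattice axiom, and the rank may be 0.
\<close>

record ('u, 'v) root_datum =
  characters :: "'u set"
  cocharacters :: "'v set"
  pairing :: "'u \<Rightarrow> 'v \<Rightarrow> real"
  roots :: "'u set"
  coroots :: "'v set"
  coroot :: "'u \<Rightarrow> 'v"
  simple_roots :: "'u set"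

definition full_lattice :: "'a::real_vector set \<Rightarrow> bool" where
  "full_lattice L \<longleftrightarrow>
     (\<exists>B. finite B \<and> independent B \<and> span B = UNIV \<and>
          L = {\<Sum>b\<in>B. real_of_int (c b) *\<^sub>R b | c. True})"

definition additive_on :: "'a::ab_group_add set \<Rightarrow> ('a \<Rightarrow> int) \<Rightarrow> bool" where
  "additive_on L f \<longleftrightarrow> (\<forall>x\<in>L. \<forall>y\<in>L. f (x + y) = f x + f y)"

text \<open>Both induced maps to the integral duals are bijective.\<close>

definition perfect_pairing ::
    "'u::real_vector set \<Rightarrow> 'v::real_vector set \<Rightarrow> ('u \<Rightarrow> 'v \<Rightarrow> real) \<Rightarrow> bool" where
  "perfect_pairing X Y p \<longleftrightarrow>
     bilinear p \<and>
     (\<forall>x\<in>X. \<forall>y\<in>Y. p x y \<in> \<int>) \<and>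
     (\<forall>f. additive_on Y f \<longrightarrow> (\<exists>!x. x \<in> X \<and> (\<forall>y\<in>Y. p x y = real_of_int (f y)))) \<and>
     (\<forall>f. additive_on X f \<longrightarrow> (\<exists>!y. y \<in> Y \<and> (\<forall>x\<in>X. p x y = real_of_int (f x))))"

definition positive_roots :: "('u::real_vector, 'v) root_datum \<Rightarrow> 'u set" where
  "positive_roots D =
     {\<alpha> \<in> roots D. \<exists>c :: 'u \<Rightarrow> nat. \<alpha> = (\<Sum>\<beta>\<in>simple_roots D. real (c \<beta>) *\<^sub>R \<beta>)}"

definition based_reduced_root_datum ::
    "('u::real_vector, 'v::real_normed_vector) root_datum \<Rightarrow> bool" where
  "based_reduced_root_datum D \<longleftrightarrow>
     full_lattice (characters D) \<and> full_lattice (cocharacters D) \<and>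
     perfect_pairing (characters D) (cocharacters D) (pairing D) \<and>
     finite (roots D) \<and> roots D \<subseteq> characters D \<and> coroots D \<subseteq> cocharacters D \<and>
     bij_betw (coroot D) (roots D) (coroots D) \<and>
     (\<forall>\<alpha>\<in>roots D. pairing D \<alpha> (coroot D \<alpha>) = 2) \<and>
     (\<forall>\<alpha>\<in>roots D. \<forall>\<beta>\<in>roots D. \<beta> - pairing D \<beta> (coroot D \<alpha>) *\<^sub>R \<alpha> \<in> roots D) \<and>
     (\<forall>\<alpha>\<in>roots D. \<forall>y\<in>coroots D. y - pairing D \<alpha> y *\<^sub>R coroot D \<alpha> \<in> coroots D) \<and>
     (\<forall>\<alpha>\<in>roots D. \<forall>c. c *\<^sub>R \<alpha> \<in> roots D \<longrightarrow> c = 1 \<or> c = - 1) \<and>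
     simple_roots D \<subseteq> roots D \<and> independent (simple_roots D) \<and>
     (\<forall>\<alpha>\<in>roots D. \<alpha> \<in> positive_roots D \<or> - \<alpha> \<in> positive_roots D)"

section \<open>Affine roots, alcoves and facets\<close>

text \<open>An affine root \<open>\<alpha> + k\<close> is represented by the pair of a root \<open>\<alpha>\<close> and an integer \<open>k\<close>.\<close>

definition affine_root ::
    "('u, 'v) root_datum \<Rightarrow> 'u \<Rightarrow> int \<Rightarrow> 'v \<Rightarrow> real" where
  "affine_root D \<alpha> k x = pairing D \<alpha> x + real_of_int k"

definition affine_reflection ::
    "('u, 'v::real_vector) root_datum \<Rightarrow> 'u \<Rightarrow> int \<Rightarrow> 'v \<Rightarrow> 'v" where
  "affine_reflection D \<alpha> k x = x - affine_root D \<alpha> k x *\<^sub>R coroot D \<alpha>"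

definition hyperplane :: "('u, 'v) root_datum \<Rightarrow> 'u \<Rightarrow> int \<Rightarrow> 'v set" where
  "hyperplane D \<alpha> k = {x. affine_root D \<alpha> k x = 0}"

definition sides :: "('u, 'v) root_datum \<Rightarrow> 'u \<Rightarrow> int \<Rightarrow> 'v set set" where
  "sides D \<alpha> k = {{x. affine_root D \<alpha> k x > 0}, {x. affine_root D \<alpha> k x < 0}}"

definition alcoves :: "('u, 'v::topological_space) root_datum \<Rightarrow> 'v set set" where
  "alcoves D = components (- (\<Union>\<alpha>\<in>roots D. \<Union>k. hyperplane D \<alpha> k))"

definition facets :: "('u, 'v) root_datum \<Rightarrow> 'v set set" where
  "facets D =
     {{y. \<forall>\<alpha>\<in>roots D. \<forall>k. sgn (affine_root D \<alpha> k y) = sgn (affine_root D \<alpha> k x)} | x. True}"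

definition dominant_chamber :: "('u, 'v) root_datum \<Rightarrow> 'v set" where
  "dominant_chamber D = {x. \<forall>\<alpha>\<in>simple_roots D. pairing D \<alpha> x > 0}"

definition base_alcove :: "('u::real_vector, 'v) root_datum \<Rightarrow> 'v set" where
  "base_alcove D = {x. \<forall>\<alpha>\<in>positive_roots D. - 1 < pairing D \<alpha> x \<and> pairing D \<alpha> x < 0}"

definition walls :: "('u::real_vector, 'v::real_normed_vector) root_datum \<Rightarrow> 'v set set" where
  "walls D =
     {hyperplane D \<alpha> k | \<alpha> k. \<alpha> \<in> roots D \<and>
        (\<exists>F\<in>facets D. F \<subseteq> closure (base_alcove D) \<and> affine hull F = hyperplane D \<alpha> k)}"

text \<open>
  If the roots do not span, the minimal facets are not points but translates of the common
  kernel of all roots; vertices are therefore sets.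
\<close>

definition vertices :: "('u::real_vector, 'v::real_normed_vector) root_datum \<Rightarrow> 'v set set" where
  "vertices D =
     {F \<in> facets D. F \<subseteq> closure (base_alcove D) \<and> (\<forall>G\<in>facets D. G \<subseteq> closure F \<longrightarrow> G = F)}"

section \<open>Weyl groups\<close>

text \<open>
  All groups act faithfully on \<open>V\<close> and are identified with groups of bijections of \<open>V\<close>.
\<close>

definition generated :: "('v \<Rightarrow> 'v) set \<Rightarrow> ('v \<Rightarrow> 'v) set" where
  "generated S = generate (BijGroup UNIV) S"

definition group_prod :: "('v \<Rightarrow> 'v) set \<Rightarrow> ('v \<Rightarrow> 'v) set \<Rightarrow> ('v \<Rightarrow> 'v) set"
    (infixl "\<cdot>\<^sub>g" 70) where
  "A \<cdot>\<^sub>g B = {a \<circ> b | a b. a \<in> A \<and> b \<in> B}"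

definition transl :: "'v::ab_group_add \<Rightarrow> 'v \<Rightarrow> 'v" where
  "transl l x = l + x"

definition weyl_group :: "('u, 'v::real_vector) root_datum \<Rightarrow> ('v \<Rightarrow> 'v) set" where
  "weyl_group D = generated {affine_reflection D \<alpha> 0 | \<alpha>. \<alpha> \<in> roots D}"

definition affine_weyl_group :: "('u, 'v::real_vector) root_datum \<Rightarrow> ('v \<Rightarrow> 'v) set" where
  "affine_weyl_group D = generated {affine_reflection D \<alpha> k | \<alpha> k. \<alpha> \<in> roots D}"

definition extended_affine_weyl_group ::
    "('u, 'v::real_vector) root_datum \<Rightarrow> ('v \<Rightarrow> 'v) set" where
  "extended_affine_weyl_group D =
     {transl l \<circ> w | l w. l \<in> cocharacters D \<and> w \<in> weyl_group D}"

definition simple_affine_reflections ::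
    "('u::real_vector, 'v::real_normed_vector) root_datum \<Rightarrow> ('v \<Rightarrow> 'v) set" where
  "simple_affine_reflections D =
     {affine_reflection D \<alpha> k | \<alpha> k. \<alpha> \<in> roots D \<and> hyperplane D \<alpha> k \<in> walls D}"

definition alcove_stabilizer ::
    "('u::real_vector, 'v::real_vector) root_datum \<Rightarrow> ('v \<Rightarrow> 'v) set" where
  "alcove_stabilizer D =
     {g \<in> extended_affine_weyl_group D. g ` base_alcove D = base_alcove D}"

definition tau :: "('u::real_vector, 'v::real_vector) root_datum \<Rightarrow> 'v \<Rightarrow> 'v \<Rightarrow> 'v" where
  "tau D \<mu> =
     (THE t. t \<in> alcove_stabilizer D \<and> transl \<mu> \<in> affine_weyl_group D \<cdot>\<^sub>g {t})"

definition affine_coset ::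
    "('u::real_vector, 'v::real_vector) root_datum \<Rightarrow> 'v \<Rightarrow> ('v \<Rightarrow> 'v) set" where
  "affine_coset D \<mu> = affine_weyl_group D \<cdot>\<^sub>g {tau D \<mu>}"

section \<open>Bruhat order\<close>

text \<open>
  The next three notions are meant for a Coxeter system whose generators \<open>S\<close> are involutive
  bijections, so that words in \<open>S\<close> reach the whole generated group.
\<close>

definition coxeter_length :: "('v \<Rightarrow> 'v) set \<Rightarrow> ('v \<Rightarrow> 'v) \<Rightarrow> nat" where
  "coxeter_length S w = (LEAST n. \<exists>ss. set ss \<subseteq> S \<and> length ss = n \<and> w = foldr (\<circ>) ss id)"

definition coxeter_reflections :: "('v \<Rightarrow> 'v) set \<Rightarrow> ('v \<Rightarrow> 'v) set" where
  "coxeter_reflections S = {g \<circ> s \<circ> inv_into UNIV g | g s. g \<in> generated S \<and> s \<in> S}"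

definition bruhat_le :: "('v \<Rightarrow> 'v) set \<Rightarrow> ('v \<Rightarrow> 'v) \<Rightarrow> ('v \<Rightarrow> 'v) \<Rightarrow> bool" where
  "bruhat_le S =
     (\<lambda>u v. (\<exists>t\<in>coxeter_reflections S. v = t \<circ> u) \<and> coxeter_length S u < coxeter_length S v)\<^sup>*\<^sup>*"

definition extended_bruhat_le ::
    "('u::real_vector, 'v::real_normed_vector) root_datum \<Rightarrow> ('v \<Rightarrow> 'v) \<Rightarrow> ('v \<Rightarrow> 'v) \<Rightarrow> bool" where
  "extended_bruhat_le D x y \<longleftrightarrow>
     (\<exists>u\<in>affine_weyl_group D. \<exists>v\<in>affine_weyl_group D. \<exists>t\<in>alcove_stabilizer D.
        x = u \<circ> t \<and> y = v \<circ> t \<and> bruhat_le (simple_affine_reflections D) u v)"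

section \<open>Reflections in the w-opposite direction\<close>

text \<open>
  The set \<open>deep_chamber D w N\<close> consists of the points of depth more than \<open>N\<close> in the Weyl chamber
  \<open>w C\<close>; an alcove is sufficiently deep if it is contained in it for a suitable \<open>N\<close>.
\<close>

definition deep_chamber ::
    "('u, 'v) root_datum \<Rightarrow> ('v \<Rightarrow> 'v) \<Rightarrow> real \<Rightarrow> 'v set" where
  "deep_chamber D w N = w ` {x. \<forall>\<alpha>\<in>simple_roots D. pairing D \<alpha> x > N}"

definition plus_side ::
    "('u, 'v::topological_space) root_datum \<Rightarrow> ('v \<Rightarrow> 'v) \<Rightarrow> 'u \<Rightarrow> int \<Rightarrow> 'v set" where
  "plus_side D w \<alpha> k =
     (THE S. S \<in> sides D \<alpha> k \<and> (\<exists>N. \<forall>A\<in>alcoves D. A \<subseteq> deep_chamber D w N \<longrightarrow> A \<subseteq> S))"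

definition minus_side ::
    "('u, 'v::topological_space) root_datum \<Rightarrow> ('v \<Rightarrow> 'v) \<Rightarrow> 'u \<Rightarrow> int \<Rightarrow> 'v set" where
  "minus_side D w \<alpha> k = (THE S. S \<in> sides D \<alpha> k \<and> S \<noteq> plus_side D w \<alpha> k)"

text \<open>
  An alcove or facet not contained in a hyperplane lies entirely on one side of it, so that
  the position of its generic point is expressed by an inclusion.
\<close>

definition opposite_step ::
    "('u, 'v::real_normed_vector) root_datum \<Rightarrow> ('v \<Rightarrow> 'v) \<Rightarrow> 'v set \<Rightarrow> 'v set \<Rightarrow> bool" where
  "opposite_step D w f g \<longleftrightarrow>
     (\<exists>\<alpha>\<in>roots D. \<exists>k. g = affine_reflection D \<alpha> k ` f \<and>
        f \<subseteq> plus_side D w \<alpha> k \<and> g \<subseteq> minus_side D w \<alpha> k)"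

definition opposite_reach ::
    "('u, 'v::real_normed_vector) root_datum \<Rightarrow> 'v set \<Rightarrow> ('v \<Rightarrow> 'v) \<Rightarrow> 'v set set" where
  "opposite_reach D f w = {g. (opposite_step D w)\<^sup>*\<^sup>* f g}"

section \<open>Admissible and permissible sets\<close>

definition Adm ::
    "('u::real_vector, 'v::real_normed_vector) root_datum \<Rightarrow> 'v \<Rightarrow> ('v \<Rightarrow> 'v) set" where
  "Adm D \<mu> = {x \<in> affine_coset D \<mu>. \<exists>w\<in>weyl_group D. extended_bruhat_le D x (transl (w \<mu>))}"

definition Adm_J ::
    "('u::real_vector, 'v::real_normed_vector) root_datum \<Rightarrow> ('v \<Rightarrow> 'v) set \<Rightarrow> 'v \<Rightarrow>
     ('v \<Rightarrow> 'v) set" where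
  "Adm_J D J \<mu> = generated J \<cdot>\<^sub>g Adm D \<mu> \<cdot>\<^sub>g generated J"

definition alcove_cone ::
    "('u::real_vector, 'v::real_normed_vector) root_datum \<Rightarrow> 'v \<Rightarrow> ('v \<Rightarrow> 'v) \<Rightarrow>
     ('v \<Rightarrow> 'v) set" where
  "alcove_cone D \<mu> w =
     {x \<in> affine_coset D \<mu>.
        x ` base_alcove D \<in> opposite_reach D (transl (w \<mu>) ` base_alcove D) w}"

definition Adm_st ::
    "('u::real_vector, 'v::real_normed_vector) root_datum \<Rightarrow> 'v \<Rightarrow> ('v \<Rightarrow> 'v) set" where
  "Adm_st D \<mu> = (\<Inter>w\<in>weyl_group D. alcove_cone D \<mu> w)"

definition type_not_in :: "'v set \<Rightarrow> ('v \<Rightarrow> 'v) set \<Rightarrow> bool" where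
  "type_not_in a J \<longleftrightarrow> (\<forall>s\<in>J. s ` a = a)"

definition Perm_st_J ::
    "('u::real_vector, 'v::real_normed_vector) root_datum \<Rightarrow> ('v \<Rightarrow> 'v) set \<Rightarrow> 'v \<Rightarrow>
     ('v \<Rightarrow> 'v) set" where
  "Perm_st_J D J \<mu> =
     {x \<in> affine_coset D \<mu>.
        \<forall>a\<in>vertices D. type_not_in a J \<longrightarrow>
          (\<forall>w\<in>weyl_group D. x ` a \<in> opposite_reach D (transl (w \<mu>) ` a) w)}"

definition Perm_st ::
    "('u::real_vector, 'v::real_normed_vector) root_datum \<Rightarrow> 'v \<Rightarrow> ('v \<Rightarrow> 'v) set" where
  "Perm_st D \<mu> = Perm_st_J D {} \<mu>"

text \<open>
  A set \<open>J\<close> of simple affine reflections is called vertexwise if either some vertex of the base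
  alcove has type not in \<open>J\<close> (equivalently, \<open>J\<close> generates a finite group) or \<open>J\<close> is everything.
  For an irreducible root system every \<open>J\<close> is vertexwise.  If the root system is
  reducible and \<open>J\<close> is not vertexwise, that is, \<open>J\<close> contains all simple affine reflections of
  one irreducible component but not those of every component, then no vertex has type not
  in \<open>J\<close>, so \<open>Perm_st_J\<close> is the whole coset while \<open>Adm_J\<close> is a proper subset of it.
\<close>

definition vertexwise ::
    "('u::real_vector, 'v::real_normed_vector) root_datum \<Rightarrow> ('v \<Rightarrow> 'v) set \<Rightarrow> bool" where
  "vertexwise D J \<longleftrightarrow>
     (\<exists>a\<in>vertices D. type_not_in a J) \<or> J = simple_affine_reflections D"

end

theory Submission
  imports Defs
begin

text \<open>
  An alcove is below another one in the Bruhat order if it is obtained by reflections that move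
  it towards the base alcove, and in \<open>B(_, w)\<close> if it is obtained by reflections against the
  direction of the chamber of \<open>w\<close>.  If all hyperplanes that separate the base alcove from a very
  deep alcove of the chamber opposite to \<open>w\<close> leave \<open>x\<close> on the side of the base alcove, then the
  base alcove can be moved to that depth along a gallery, one wall at a time, by the lifting
  property, so that membership of \<open>x\<close> in the cone implies comparability in the Bruhat order.
  Every \<open>x\<close> has this property for the chamber that contains its displacement of a base point,
  which shows that \<open>Adm_st\<close> is contained in \<open>Adm\<close>.  Conversely, \<open>Adm_st\<close> contains the translations
  and is closed under the Bruhat order: if the reflection \<open>s\<close> with linear part \<open>s'\<close> goes in the
  wrong direction for \<open>w\<close>, reflect the chain that is given for \<open>s' w\<close>.  The same reflection of
  chains shows that \<open>W_J Adm\<close> is contained in \<open>Adm W_J\<close>.  The argument with the base point applies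
  to vertices as well as to alcoves, and Deodhar's lemma, proved by the same moves of the base
  point, assembles the comparisons at the vertices into one modulo \<open>W_J\<close>.
\<close>

text \<open>The orders compare subsets of the space rather than group elements, so that one argument
  covers alcoves and vertices, and the base point of the Bruhat order becomes a parameter
  \<open>b\<close>. This is the point of the construction: \<open>seen_from b\<close> is the Bruhat
  order centred at the alcove of \<open>b\<close>, and every chain for \<open>against d\<close> is
  also one for \<open>seen_from b\<close> once \<open>b\<close> is far out in the direction
  \<open>- d\<close>. The two orders are then related by moving \<open>b\<close> across one wall at
  a time, where only the reflection in that wall changes its sense. A chamber enters only through
  the vector \<open>w rho\<close>, whose pairings with the roots carry the signs and are integers,
  so that far base points again lie in alcoves. The obstacle for vertices is that distinct group
  elements can agree on a vertex: the elements that fix all vertices of type not in \<open>J\<close>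
  have to be recognised as the group generated by \<open>J\<close>. That needs such a vertex to
  exist; if there is none and \<open>J\<close> consists of all simple reflections, both sides are
  the whole coset.\<close>

section \<open>Preliminaries\<close>

text \<open>The library provides the continuity of linear functionals only for Euclidean spaces.\<close>

lemma coefficients_bounded:
  fixes B :: "'v::real_normed_vector set"
  assumes "finite B" "independent B"
  shows "\<exists>C\<ge>0. \<forall>c. \<forall>b\<in>B. \<bar>c b\<bar> \<le> C * norm (\<Sum>b\<in>B. c b *\<^sub>R b)"
  using assms
proof (induction B rule: finite_induct)
  case empty
  show ?case by (intro exI[of _ 0]) auto
next
  case (insert a B)
  then have a: "a \<notin> span B" and iB: "independent B"
    by (auto simp: independent_insert)
  obtain C where C: "C \<ge> 0" "\<And>c b. b \<in> B \<Longrightarrow> \<bar>c b\<bar> \<le> C * norm (\<Sum>b\<in>B. c b *\<^sub>R b)"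
    using insert.IH[OF iB] by blast
  \<comment> \<open>\<open>span B\<close> is closed: bounded coordinates turn a convergent sequence
    into convergent coefficient sequences. This puts \<open>a\<close> at a positive distance
    \<open>d\<close> from it.\<close>
  have "a \<notin> closure (span B)"
  proof
    assume "a \<in> closure (span B)"
    then obtain w where w: "\<And>n. w n \<in> span B" and wa: "w \<longlonglongrightarrow> a"
      unfolding closure_sequential by blast
    have "\<exists>c. w n = (\<Sum>b\<in>B. c b *\<^sub>R b)" for n
      using w[of n] span_finite[OF insert.hyps(1)] by auto
    then obtain c where c: "\<And>n. w n = (\<Sum>b\<in>B. c n b *\<^sub>R b)" by metis
    have "Cauchy w" using wa by (rule LIMSEQ_imp_Cauchy)
    have "Cauchy (\<lambda>n. c n b)" if b: "b \<in> B" for b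
    proof (rule metric_CauchyI)
      fix e :: real assume e: "e > 0"
      have "e / (C + 1) > 0" using e C by simp
      then obtain N where N: "\<And>m n. m \<ge> N \<Longrightarrow> n \<ge> N \<Longrightarrow> dist (w m) (w n) < e / (C + 1)"
        using \<open>Cauchy w\<close> unfolding Cauchy_def by blast
      show "\<exists>M. \<forall>m\<ge>M. \<forall>n\<ge>M. dist (c m b) (c n b) < e"
      proof (intro exI allI impI)
        fix m n assume mn: "m \<ge> N" "n \<ge> N"
        have "w m - w n = (\<Sum>b\<in>B. (c m b - c n b) *\<^sub>R b)"
          by (simp add: c scaleR_left_diff_distrib sum_subtractf)
        then have "dist (c m b) (c n b) \<le> C * dist (w m) (w n)"
          using C(2)[OF b, of "\<lambda>b. c m b - c n b"] by (simp add: dist_norm)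
        also have "\<dots> \<le> (C + 1) * dist (w m) (w n)"
          by (simp add: mult_right_mono)
        also have "\<dots> < e"
          using N[OF mn] C(1) by (simp add: field_simps)
        finally show "dist (c m b) (c n b) < e" .
      qed
    qed
    then have "\<forall>b. \<exists>l. b \<in> B \<longrightarrow> (\<lambda>n. c n b) \<longlonglongrightarrow> l"
      using Cauchy_convergent convergent_def by blast
    then obtain l where l: "\<And>b. b \<in> B \<Longrightarrow> (\<lambda>n. c n b) \<longlonglongrightarrow> l b" by metis
    have "w \<longlonglongrightarrow> (\<Sum>b\<in>B. l b *\<^sub>R b)"
      unfolding c by (intro tendsto_sum tendsto_scaleR l tendsto_const)
    then have "a = (\<Sum>b\<in>B. l b *\<^sub>R b)"
      using wa LIMSEQ_unique by blast
    then show False using a by (metis (no_types, lifting) span_base span_scale span_sum)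
  qed
  then obtain d where d: "d > 0" "\<And>w. w \<in> span B \<Longrightarrow> norm (a - w) \<ge> d"
    unfolding closure_approachable by (metis dist_norm norm_minus_commute not_le)
  have bound: "\<bar>t\<bar> * d \<le> norm (t *\<^sub>R a + w)" if "w \<in> span B" for t w
  proof (cases "t = 0")
    case False
    have "- ((1 / t) *\<^sub>R w) \<in> span B" using that by (simp add: span_neg span_scale)
    then have "d \<le> norm (a + (1 / t) *\<^sub>R w)" using d(2) by fastforce
    then have "\<bar>t\<bar> * d \<le> norm (t *\<^sub>R (a + (1 / t) *\<^sub>R w))" by (simp add: mult_left_mono)
    then show ?thesis using False by (simp add: scaleR_right_distrib)
  qed simp
  \<comment> \<open>The coefficient of \<open>a\<close> costs \<open>1 / d\<close>; removing the
    part along \<open>a\<close> leaves a vector of norm at most \<open>1 + norm a / d\<close> times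
    the original one, to which \<open>C\<close> applies.\<close>
  define C' where "C' = 1 / d + C * (1 + norm a / d)"
  have p: "C * (1 + norm a / d) \<ge> 0" "1 / d \<ge> 0" using C(1) d(1) by auto
  have "\<bar>c b\<bar> \<le> C' * norm (\<Sum>b\<in>insert a B. c b *\<^sub>R b)" if b: "b \<in> insert a B" for c b
  proof -
    define w where "w = (\<Sum>b\<in>B. c b *\<^sub>R b)"
    define v where "v = (\<Sum>b\<in>insert a B. c b *\<^sub>R b)"
    have v: "v = c a *\<^sub>R a + w" unfolding v_def w_def using insert.hyps by simp
    have w: "w \<in> span B" unfolding w_def by (intro span_sum span_scale span_base)
    have ca: "\<bar>c a\<bar> \<le> 1 / d * norm v"
      using bound[OF w, of "c a"] d(1) v by (simp add: field_simps)
    have "b \<in> B \<Longrightarrow> \<bar>c b\<bar> \<le> C * (1 + norm a / d) * norm v"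
    proof -
      assume "b \<in> B"
      then have "\<bar>c b\<bar> \<le> C * norm w" using C(2) w_def by simp
      also have "w = v - c a *\<^sub>R a" using v by simp
      then have "norm w \<le> norm v + \<bar>c a\<bar> * norm a"
        using norm_triangle_ineq4[of v "c a *\<^sub>R a"] by simp
      also have "\<dots> \<le> norm v + (1 / d * norm v) * norm a"
        using ca by (intro add_left_mono mult_right_mono) auto
      also have "\<dots> = (1 + norm a / d) * norm v" by (simp add: field_simps)
      finally show ?thesis using C(1) by (simp add: mult_left_mono mult.assoc)
    qed
    moreover have "C' * norm v = 1 / d * norm v + C * (1 + norm a / d) * norm v"
      by (simp add: C'_def algebra_simps)
    moreover have "0 \<le> C * (1 + norm a / d) * norm v" "0 \<le> 1 / d * norm v"
      using p by (simp_all only: mult_nonneg_nonneg norm_ge_zero)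
    ultimately show ?thesis using ca b insert.hyps v_def by (cases "b = a") auto
  qed
  moreover have "C' \<ge> 0" using p by (simp add: C'_def)
  ultimately show ?case by blast
qed

lemma linear_functional_bounded_linear:
  fixes f :: "'v::real_normed_vector \<Rightarrow> real" and B :: "'v set"
  assumes "linear f" "finite B" "independent B" "span B = UNIV"
  shows "bounded_linear f"
proof -
  obtain C where C: "C \<ge> 0" "\<And>c b. b \<in> B \<Longrightarrow> \<bar>c b\<bar> \<le> C * norm (\<Sum>b\<in>B. c b *\<^sub>R b)"
    using coefficients_bounded[OF assms(2,3)] by blast
  have "norm (f x) \<le> norm x * (\<Sum>b\<in>B. C * \<bar>f b\<bar>)" for x
  proof -
    have "x \<in> span B" using assms(4) by simp
    then obtain c where c: "x = (\<Sum>b\<in>B. c b *\<^sub>R b)"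
      using span_finite[OF assms(2)] by auto
    have "f x = (\<Sum>b\<in>B. c b * f b)"
      unfolding c by (simp add: linear_sum[OF assms(1)] linear_cmul[OF assms(1)])
    also have "\<bar>\<dots>\<bar> \<le> (\<Sum>b\<in>B. \<bar>c b\<bar> * \<bar>f b\<bar>)"
      by (rule order_trans[OF sum_abs]) (simp add: abs_mult)
    also have "\<dots> \<le> (\<Sum>b\<in>B. C * norm x * \<bar>f b\<bar>)"
      by (intro sum_mono mult_right_mono) (use C(2) c in auto)
    finally show ?thesis by (simp add: sum_distrib_left mult_ac)
  qed
  then show ?thesis
    using assms(1) by (intro bounded_linear_intro) (auto simp: linear_add linear_cmul)
qed

text \<open>Turns finiteness of the roots and of the coroots into the vanishing of a translation
  vector.\<close>

lemma finite_arithmetic_progression: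
  fixes a t :: "'a::real_vector"
  assumes "finite A" "\<And>n::nat. a + real n *\<^sub>R t \<in> A"
  shows "t = 0"
proof (rule ccontr)
  assume "t \<noteq> 0"
  then have "inj (\<lambda>n::nat. a + real n *\<^sub>R t)" by (simp add: inj_on_def)
  moreover have "range (\<lambda>n::nat. a + real n *\<^sub>R t) \<subseteq> A" using assms(2) by auto
  ultimately show False using assms(1) finite_subset range_inj_infinite by blast
qed

text \<open>Sides are compared throughout by the sign of a product of two values of one affine root,
  which avoids orienting hyperplanes. These rules chain such comparisons through the middle value
  \<open>b\<close>.\<close>

lemma mult_pos_trans:
  fixes a b c :: real
  shows "a * b > 0 \<Longrightarrow> b * c > 0 \<Longrightarrow> a * c > 0"
    and "a * b > 0 \<Longrightarrow> b * c < 0 \<Longrightarrow> a * c < 0"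
    and "a * b < 0 \<Longrightarrow> b * c > 0 \<Longrightarrow> a * c < 0"
    and "a * b < 0 \<Longrightarrow> b * c < 0 \<Longrightarrow> a * c > 0"
    and "a * b > 0 \<Longrightarrow> b * c \<ge> 0 \<Longrightarrow> a * c \<ge> 0"
    and "a * b < 0 \<Longrightarrow> b * c \<ge> 0 \<Longrightarrow> a * c \<le> 0"
  by (auto simp: zero_less_mult_iff mult_less_0_iff zero_le_mult_iff mult_le_0_iff)

lemma eventually_segment:
  fixes a b c :: real
  shows "c < a \<Longrightarrow> eventually (\<lambda>t. c < (1 - t) * a + t * b) (at_right 0)"
    and "a < c \<Longrightarrow> eventually (\<lambda>t. (1 - t) * a + t * b < c) (at_right 0)"
proof -
  have "((\<lambda>t. (1 - t) * a + t * b) \<longlongrightarrow> (1 - 0) * a + 0 * b) (at_right (0::real))"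
    by (intro tendsto_intros)
  then have l: "((\<lambda>t. (1 - t) * a + t * b) \<longlongrightarrow> a) (at_right (0::real))" by simp
  show "c < a \<Longrightarrow> eventually (\<lambda>t. c < (1 - t) * a + t * b) (at_right 0)"
    using order_tendstoD(1)[OF l] .
  show "a < c \<Longrightarrow> eventually (\<lambda>t. (1 - t) * a + t * b < c) (at_right 0)"
    using order_tendstoD(2)[OF l] .
qed

lemma full_lattice_closed:
  assumes "full_lattice L" "x \<in> L" "y \<in> L"
  shows "x + real_of_int n *\<^sub>R y \<in> L"
proof -
  obtain B where L: "L = {\<Sum>b\<in>B. real_of_int (c b) *\<^sub>R b | c. True}"
    using assms(1) unfolding full_lattice_def by blast
  obtain c c' where "x = (\<Sum>b\<in>B. real_of_int (c b) *\<^sub>R b)" "y = (\<Sum>b\<in>B. real_of_int (c' b) *\<^sub>R b)"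
    using assms(2,3) L by blast
  then have "x + real_of_int n *\<^sub>R y = (\<Sum>b\<in>B. real_of_int (c b + n * c' b) *\<^sub>R b)"
    by (simp add: scaleR_sum_right sum.distrib[symmetric] scaleR_left_distrib)
  then show ?thesis unfolding L by (intro CollectI exI conjI TrueI)
qed

lemma group_prod_iff: "x \<in> A \<cdot>\<^sub>g B \<longleftrightarrow> (\<exists>a\<in>A. \<exists>b\<in>B. x = a \<circ> b)"
  unfolding group_prod_def by blast

section \<open>Groups generated by involutions\<close>

lemma foldr_comp_append: "foldr (\<circ>) (xs @ ys) id = foldr (\<circ>) xs id \<circ> foldr (\<circ>) ys id"
  for xs ys :: "('v \<Rightarrow> 'v) list"
  by (induction xs) (metis (no_types) append_Nil comp_id foldr_Nil id_comp id_apply,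
      metis (no_types) append_Cons comp_assoc comp_apply foldr_Cons)

text \<open>Instances are all affine reflections, the linear ones, the simple ones and subsets of
  the simple ones. Generators are their own inverses, so group elements are words and induction over
  them needs no case for inverses.\<close>

locale involutions =
  fixes S :: "('v \<Rightarrow> 'v) set"
  assumes involution: "s \<in> S \<Longrightarrow> s \<circ> s = id"
begin

lemma involution_bij: "s \<in> S \<Longrightarrow> bij s"
  using involution o_bij by blast

lemma word_bij: "set ss \<subseteq> S \<Longrightarrow> bij (foldr (\<circ>) ss id)"
  by (induction ss) (auto intro: bij_comp involution_bij)

lemma generated_words: "generated S = {foldr (\<circ>) ss id | ss. set ss \<subseteq> S}"
proof
  have Bij: "g \<in> carrier (BijGroup UNIV)" if "bij g" for g :: "'v \<Rightarrow> 'v"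
    using that by (simp add: BijGroup_def Bij_def extensional_def)
  have mult: "g \<otimes>\<^bsub>BijGroup UNIV\<^esub> h = g \<circ> h" if "bij g" "bij h" for g h :: "'v \<Rightarrow> 'v"
    using that by (auto simp: BijGroup_def Bij_def extensional_def compose_def)
  have one_eq: "\<one>\<^bsub>BijGroup UNIV\<^esub> = (id :: 'v \<Rightarrow> 'v)"
    unfolding BijGroup_def by (rule ext) simp
  show "generated S \<subseteq> {foldr (\<circ>) ss id | ss. set ss \<subseteq> S}"
  proof
    fix g assume "g \<in> generated S"
    then show "g \<in> {foldr (\<circ>) ss id | ss. set ss \<subseteq> S}"
      unfolding generated_def
    proof (induction rule: generate.induct)
      case one
      show ?case unfolding one_eq by (intro CollectI exI[of _ "[]"]) simp
    next
      case (incl s)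
      then show ?case by (auto intro!: exI[of _ "[s]"])
    next
      case (inv s)
      have "inv\<^bsub>BijGroup UNIV\<^esub> s = s"
        using inv involution
        by (intro group.inv_equality[OF group_BijGroup])
          (auto simp: one_eq mult involution_bij Bij)
      then show ?case using inv by (auto intro!: exI[of _ "[s]"])
    next
      case (eng g h)
      then obtain xs ys where *: "set xs \<subseteq> S" "g = foldr (\<circ>) xs id"
        "set ys \<subseteq> S" "h = foldr (\<circ>) ys id" by blast
      then have "g \<otimes>\<^bsub>BijGroup UNIV\<^esub> h = foldr (\<circ>) (xs @ ys) id"
        using mult[OF word_bij word_bij, of xs ys] foldr_comp_append[of xs ys] by simp
      moreover have "set (xs @ ys) \<subseteq> S" using * by auto
      ultimately show ?case by blast
    qed
  qed
  show "{foldr (\<circ>) ss id | ss. set ss \<subseteq> S} \<subseteq> generated S"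
  proof clarify
    fix ss :: "('v \<Rightarrow> 'v) list"
    assume "set ss \<subseteq> S"
    then show "foldr (\<circ>) ss id \<in> generated S"
    proof (induction ss)
      case Nil
      show ?case unfolding generated_def using generate.one[of "BijGroup UNIV" S] one_eq by (metis foldr_Nil id_apply)
    next
      case (Cons s ss)
      have "s \<otimes>\<^bsub>BijGroup UNIV\<^esub> foldr (\<circ>) ss id \<in> generate (BijGroup UNIV) S"
        using Cons generate.eng[OF generate.incl]
        unfolding generated_def by (metis insert_subset list.set(2))
      then show ?case
        using Cons.prems mult[OF involution_bij word_bij, of s ss]
        by (metis comp_apply foldr_Cons generated_def insert_subset list.set(2))
    qed
  qed
qed

lemma generated_induct [consumes 1, case_names id step]:
  assumes "g \<in> generated S" "P id"
    "\<And>s h. s \<in> S \<Longrightarrow> h \<in> generated S \<Longrightarrow> P h \<Longrightarrow> P (s \<circ> h)"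
  shows "P g"
proof -
  have "set ss \<subseteq> S \<Longrightarrow> P (foldr (\<circ>) ss id)" for ss
    by (induction ss) (use assms(2,3) generated_words in auto)
  then show ?thesis using assms(1) generated_words by auto
qed

lemma generated_id: "id \<in> generated S"
  unfolding generated_words by (intro CollectI exI[of _ "[]"]) simp

lemma generated_base: "s \<in> S \<Longrightarrow> s \<in> generated S"
  unfolding generated_words by (intro CollectI exI[of _ "[s]"]) simp

lemma generated_left: "s \<in> S \<Longrightarrow> g \<in> generated S \<Longrightarrow> s \<circ> g \<in> generated S"
  unfolding generated_words by clarsimp (metis (no_types, lifting) comp_apply foldr_Cons insert_subset list.simps(15))

lemma generated_comp: "g \<in> generated S \<Longrightarrow> h \<in> generated S \<Longrightarrow> g \<circ> h \<in> generated S"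
  by (induction g rule: generated_induct) (auto simp: comp_assoc generated_left)

lemma generated_bij: "g \<in> generated S \<Longrightarrow> bij g"
  unfolding generated_words using word_bij by auto

lemma generated_inv: "g \<in> generated S \<Longrightarrow> inv_into UNIV g \<in> generated S"
proof (induction g rule: generated_induct)
  case id
  show ?case unfolding inv_id by (rule generated_id)
next
  case (step s h)
  have "inv_into UNIV s = s" using involution step by (metis inv_unique_comp)
  then have "inv_into UNIV (s \<circ> h) = inv_into UNIV h \<circ> s"
    using step by (simp add: o_inv_distrib generated_bij involution_bij)
  then show ?case using step generated_comp generated_base by metis
qed

end

section \<open>Roots and affine roots\<close>

locale based_root_datum =
  fixes D :: "('u::real_vector, 'v::real_normed_vector) root_datum"
  assumes based: "based_reduced_root_datum D"
begin

abbreviation "R \<equiv> roots D"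
abbreviation "pr \<equiv> pairing D"
abbreviation "cr \<equiv> coroot D"
abbreviation "aroot \<equiv> affine_root D"
abbreviation "rfl \<equiv> affine_reflection D"

lemma bilinear_pairing: "bilinear pr"
  using based by (simp add: based_reduced_root_datum_def perfect_pairing_def)

lemma pairing_simps:
  "pr a (x + y) = pr a x + pr a y" "pr a (x - y) = pr a x - pr a y"
  "pr a (c *\<^sub>R x) = c * pr a x" "pr a (- x) = - pr a x" "pr a 0 = 0"
  "pr (a + b) x = pr a x + pr b x" "pr (a - b) x = pr a x - pr b x"
  "pr (c *\<^sub>R a) x = c * pr a x" "pr (- a) x = - pr a x" "pr 0 x = 0"
  using bilinear_pairing
  by (simp_all add: bilinear_radd bilinear_rsub bilinear_rmul bilinear_rneg bilinear_rzero
      bilinear_ladd bilinear_lsub bilinear_lmul bilinear_lneg bilinear_lzero)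

lemma linear_pairing: "linear (pr a)" "linear (\<lambda>a. pr a x)"
  using bilinear_pairing by (auto simp: bilinear_def)

lemma finite_roots: "finite R"
  and coroot_two: "\<alpha> \<in> R \<Longrightarrow> pr \<alpha> (cr \<alpha>) = 2"
  and root_refl_in: "\<alpha> \<in> R \<Longrightarrow> \<beta> \<in> R \<Longrightarrow> \<beta> - pr \<beta> (cr \<alpha>) *\<^sub>R \<alpha> \<in> R"
  and reduced: "\<alpha> \<in> R \<Longrightarrow> c *\<^sub>R \<alpha> \<in> R \<Longrightarrow> c = 1 \<or> c = - 1"
  using based by (auto simp: based_reduced_root_datum_def)

lemma pairing_int: "\<xi> \<in> characters D \<Longrightarrow> x \<in> cocharacters D \<Longrightarrow> pr \<xi> x \<in> \<int>"
  using based by (auto simp: based_reduced_root_datum_def perfect_pairing_def)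

lemma roots_characters: "\<alpha> \<in> R \<Longrightarrow> \<alpha> \<in> characters D"
  and coroot_cocharacters: "\<alpha> \<in> R \<Longrightarrow> cr \<alpha> \<in> cocharacters D"
  using based by (auto simp: based_reduced_root_datum_def dest: bij_betwE)

lemma coroot_int: "\<alpha> \<in> R \<Longrightarrow> \<beta> \<in> R \<Longrightarrow> pr \<beta> (cr \<alpha>) \<in> \<int>"
  by (simp add: pairing_int roots_characters coroot_cocharacters)

lemma minus_root: "\<alpha> \<in> R \<Longrightarrow> - \<alpha> \<in> R"
  using root_refl_in[of \<alpha> \<alpha>] coroot_two[of \<alpha>] by (simp add: scaleR_2)

text \<open>The axioms make the roots and the coroots stable under reflections separately;
  compatibility of \<open>coroot\<close> with them has to be derived. The difference
  \<open>d\<close> of both sides is first shown to be killed by all roots, and then to be zero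
  because there are only finitely many coroots.\<close>

lemma coroot_root_refl:
  assumes "\<alpha> \<in> R" "\<beta> \<in> R"
  shows "cr (\<beta> - pr \<beta> (cr \<alpha>) *\<^sub>R \<alpha>) = cr \<beta> - pr \<alpha> (cr \<beta>) *\<^sub>R cr \<alpha>"
proof -
  define \<gamma> e where "\<gamma> = \<beta> - pr \<beta> (cr \<alpha>) *\<^sub>R \<alpha>" and "e = cr \<beta> - pr \<alpha> (cr \<beta>) *\<^sub>R cr \<alpha>"
  have \<gamma>: "\<gamma> \<in> R" unfolding \<gamma>_def using assms by (rule root_refl_in)
  have bij: "bij_betw cr R (coroots D)"
    and co: "\<And>\<alpha> y. \<alpha> \<in> R \<Longrightarrow> y \<in> coroots D \<Longrightarrow> y - pr \<alpha> y *\<^sub>R cr \<alpha> \<in> coroots D"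
    using based by (auto simp: based_reduced_root_datum_def)
  have crin: "\<And>\<alpha>. \<alpha> \<in> R \<Longrightarrow> cr \<alpha> \<in> coroots D" using bij by (auto dest: bij_betwE)
  have "e \<in> coroots D" unfolding e_def using assms by (intro co crin)
  then obtain \<delta> where \<delta>: "\<delta> \<in> R" "e = cr \<delta>"
    using bij by (auto simp: bij_betw_def)
  define d where "d = cr \<gamma> - e"
  have \<gamma>e: "pr \<gamma> e = 2"
    unfolding \<gamma>_def e_def using coroot_two[OF assms(1)] coroot_two[OF assms(2)]
    by (simp add: pairing_simps algebra_simps)
  have \<gamma>d: "pr \<gamma> d = 0"
    unfolding d_def using coroot_two[OF \<gamma>] \<gamma>e by (simp add: pairing_simps)
  have 0: "pr \<epsilon> d = 0" if \<epsilon>: "\<epsilon> \<in> R" for \<epsilon>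
  proof -
    text \<open>The transvection by \<open>d\<close> along \<open>\<gamma>\<close> preserves the finite set of roots, as it is a
      product of reflections.\<close>
    have tr: "\<eta> - pr \<eta> d *\<^sub>R \<gamma> \<in> R" if \<eta>: "\<eta> \<in> R" for \<eta>
    proof -
      let ?s = "\<lambda>\<alpha> \<beta>. \<beta> - pr \<beta> (cr \<alpha>) *\<^sub>R \<alpha>"
      have "?s \<alpha> (?s \<beta> (?s \<alpha> \<eta>)) = \<eta> - pr \<eta> e *\<^sub>R \<gamma>"
        using coroot_two[OF assms(1)]
        by (simp add: \<gamma>_def e_def pairing_simps algebra_simps)
      moreover have "?s \<alpha> (?s \<beta> (?s \<alpha> \<eta>)) \<in> R"
        using assms \<eta> by (intro root_refl_in)
      ultimately have "?s \<gamma> (\<eta> - pr \<eta> e *\<^sub>R \<gamma>) \<in> R"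
        using root_refl_in[OF \<gamma>] by metis
      moreover have "?s \<gamma> (\<eta> - pr \<eta> e *\<^sub>R \<gamma>) = \<eta> - pr \<eta> d *\<^sub>R \<gamma>"
        using coroot_two[OF \<gamma>] by (simp add: d_def pairing_simps algebra_simps flip: scaleR_add_left)
      ultimately show ?thesis by metis
    qed
    have "\<epsilon> + real n *\<^sub>R (- pr \<epsilon> d *\<^sub>R \<gamma>) \<in> R" for n
    proof (induction n)
      case (Suc n)
      show ?case using tr[OF Suc] \<gamma>d by (simp add: pairing_simps algebra_simps)
    qed (simp add: \<epsilon>)
    then have "- pr \<epsilon> d *\<^sub>R \<gamma> = 0" by (rule finite_arithmetic_progression[OF finite_roots])
    moreover have "\<gamma> \<noteq> 0" using coroot_two[OF \<gamma>] by (auto simp: pairing_simps)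
    ultimately show ?thesis by simp
  qed
  \<comment> \<open>\<open>e\<close> is the coroot of \<open>\<delta>\<close>, so reflecting in
    \<open>\<delta>\<close> and then in \<open>\<gamma>\<close> subtracts twice \<open>e\<close> and
    adds twice \<open>cr \<gamma>\<close>, a translation by twice \<open>d\<close>.\<close>
  have "cr \<gamma> + real n *\<^sub>R (2 *\<^sub>R d) \<in> coroots D" for n
  proof (induction n)
    case (Suc n)
    define y where "y = cr \<gamma> + real n *\<^sub>R (2 *\<^sub>R d)"
    have e: "e = cr \<gamma> - d" by (simp add: d_def)
    have "cr \<gamma> = cr \<delta> + d" using \<delta>(2) by (simp add: d_def)
    then have "pr \<delta> y = 2"
      using coroot_two[OF \<delta>(1)] 0[OF \<delta>(1)] by (simp add: y_def pairing_simps)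
    then have 1: "y - 2 *\<^sub>R e \<in> coroots D"
      using co[OF \<delta>(1) Suc[folded y_def]] \<delta>(2) by simp
    have "pr \<gamma> (y - 2 *\<^sub>R e) = - 2"
      using coroot_two[OF \<gamma>] \<gamma>d \<gamma>e by (simp add: y_def pairing_simps)
    then have "y - 2 *\<^sub>R e + 2 *\<^sub>R cr \<gamma> \<in> coroots D" using co[OF \<gamma> 1] by simp
    then show ?case by (simp add: y_def e algebra_simps scaleR_2)
  qed (simp add: crin \<gamma>)
  moreover have "finite (coroots D)" using bij finite_roots by (simp add: bij_betw_finite)
  ultimately have "2 *\<^sub>R d = 0" by (metis finite_arithmetic_progression)
  then show ?thesis by (simp add: d_def \<gamma>_def e_def)
qed

lemma coroot_minus: "\<alpha> \<in> R \<Longrightarrow> cr (- \<alpha>) = - cr \<alpha>"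
  using coroot_root_refl[of \<alpha> \<alpha>] coroot_two[of \<alpha>] by (simp add: scaleR_2)

lemma refl_eq: "rfl \<alpha> k x = x - aroot \<alpha> k x *\<^sub>R cr \<alpha>"
  by (simp add: affine_reflection_def)

lemma aroot_refl: "\<alpha> \<in> R \<Longrightarrow> aroot \<alpha> k (rfl \<alpha> k x) = - aroot \<alpha> k x"
  by (simp add: affine_root_def affine_reflection_def pairing_simps coroot_two)

lemma refl_refl [simp]: "\<alpha> \<in> R \<Longrightarrow> rfl \<alpha> k (rfl \<alpha> k x) = x"
  by (simp add: refl_eq[of \<alpha> k "rfl \<alpha> k x"] aroot_refl) (simp add: refl_eq)

lemma refl_involution: "\<alpha> \<in> R \<Longrightarrow> rfl \<alpha> k \<circ> rfl \<alpha> k = id"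
  by (rule ext) simp

lemma refl_image_image [simp]: "\<alpha> \<in> R \<Longrightarrow> rfl \<alpha> k ` rfl \<alpha> k ` X = X"
  by (simp add: image_image)

lemma aroot_minus: "aroot (- \<alpha>) (- k) x = - aroot \<alpha> k x"
  by (simp add: affine_root_def pairing_simps)

lemma refl_minus: "\<alpha> \<in> R \<Longrightarrow> rfl (- \<alpha>) (- k) = rfl \<alpha> k"
  by (rule ext) (simp add: refl_eq aroot_minus coroot_minus)

lemma refl_fixed: "aroot \<alpha> k x = 0 \<Longrightarrow> rfl \<alpha> k x = x"
  by (simp add: refl_eq)

lemma aroot_affine: "aroot \<alpha> k ((1 - t) *\<^sub>R x + t *\<^sub>R y) = (1 - t) * aroot \<alpha> k x + t * aroot \<alpha> k y"
  by (simp add: affine_root_def pairing_simps algebra_simps)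

section \<open>Points with prescribed values of the roots\<close>

text \<open>Perfectness concerns integral functionals only. Applied to the coordinates of a lattice
  basis it yields dual vectors \<open>y b\<close>, and real combinations of these represent every
  linear functional.\<close>

lemma functional_represented:
  fixes g :: "'u \<Rightarrow> real"
  assumes "linear g"
  shows "\<exists>y. \<forall>\<xi>. pr \<xi> y = g \<xi>"
proof -
  have "full_lattice (characters D)" using based by (simp add: based_reduced_root_datum_def)
  then obtain B where B: "finite B" "independent B" "span B = UNIV"
    and X: "characters D = {\<Sum>b\<in>B. real_of_int (c b) *\<^sub>R b | c. True}"
    unfolding full_lattice_def by auto
  have "\<exists>y. \<forall>b'\<in>B. pr b' y = (if b' = b then 1 else 0)" if b: "b \<in> B" for b
  proof -
    obtain \<phi> :: "'u \<Rightarrow> real" where \<phi>: "linear \<phi>" "\<And>b'. b' \<in> B \<Longrightarrow> \<phi> b' = (if b' = b then 1 else 0)"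
      using linear_independent_extend[OF B(2), of "\<lambda>b'. if b' = b then 1 else 0"] by auto
    have \<phi>X: "\<phi> x \<in> \<int>" if "x \<in> characters D" for x
    proof -
      obtain c :: "'u \<Rightarrow> int" where "x = (\<Sum>b\<in>B. real_of_int (c b) *\<^sub>R b)" using \<open>x \<in> characters D\<close> X by auto
      then have "\<phi> x = (\<Sum>b'\<in>B. real_of_int (c b') * (if b' = b then 1 else 0))"
        by (simp add: linear_sum[OF \<phi>(1)] linear_cmul[OF \<phi>(1)] \<phi>(2))
      then show ?thesis by (simp only:) (intro Ints_sum, auto)
    qed
    \<comment> \<open>The coordinate takes integral values on the lattice; the floor only changes
      their type to \<open>int\<close>.\<close>
    have "additive_on (characters D) (\<lambda>x. \<lfloor>\<phi> x\<rfloor>)"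
      unfolding additive_on_def
    proof (intro ballI)
      fix x y assume "x \<in> characters D" "y \<in> characters D"
      then have "\<phi> x \<in> \<int>" "\<phi> y \<in> \<int>" using \<phi>X by auto
      then show "\<lfloor>\<phi> (x + y)\<rfloor> = \<lfloor>\<phi> x\<rfloor> + \<lfloor>\<phi> y\<rfloor>"
        by (auto simp: linear_add[OF \<phi>(1)] elim!: Ints_cases)
    qed
    moreover have "perfect_pairing (characters D) (cocharacters D) pr"
      using based by (simp add: based_reduced_root_datum_def)
    ultimately have "\<exists>!y. y \<in> cocharacters D \<and> (\<forall>x\<in>characters D. pr x y = real_of_int \<lfloor>\<phi> x\<rfloor>)"
      unfolding perfect_pairing_def by blast
    then obtain y where y: "\<And>x. x \<in> characters D \<Longrightarrow> pr x y = real_of_int \<lfloor>\<phi> x\<rfloor>"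
      by blast
    have "b' \<in> characters D" if "b' \<in> B" for b'
    proof -
      have "(\<Sum>b\<in>B. real_of_int (if b = b' then 1 else 0) *\<^sub>R b) = (\<Sum>b\<in>B. if b = b' then b else 0)"
        by (intro sum.cong) auto
      also have "\<dots> = b'" using that B(1) by simp
      finally show ?thesis unfolding X by (intro CollectI exI[of _ "\<lambda>b. if b = b' then 1 else 0"]) simp
    qed
    then show ?thesis using y \<phi> by (intro exI[of _ y]) auto
  qed
  then obtain y where y: "\<And>b b'. b \<in> B \<Longrightarrow> b' \<in> B \<Longrightarrow> pr b' (y b) = (if b' = b then 1 else 0)"
    by metis
  define z where "z = (\<Sum>b\<in>B. g b *\<^sub>R y b)"
  have *: "pr b z = g b" if b: "b \<in> B" for b
  proof -
    have "pr b z = (\<Sum>b'\<in>B. g b' * pr b (y b'))"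
      by (simp add: z_def linear_sum[OF linear_pairing(1)] pairing_simps)
    also have "\<dots> = (\<Sum>b'\<in>B. if b' = b then g b' else 0)"
      using b y by (intro sum.cong) auto
    finally show ?thesis using b B(1) by simp
  qed
  have "pr \<xi> z = g \<xi>" for \<xi>
    using linear_eq_on_span[OF linear_pairing(2)[of z] assms *] B(3) by auto
  then show ?thesis by blast
qed

lemma pairing_nondegenerate:
  assumes "\<And>x. pr \<xi> x = 0"
  shows "\<xi> = 0"
proof (rule ccontr)
  assume "\<xi> \<noteq> 0"
  then have "independent {\<xi>}" by (simp add: dependent_single)
  then obtain \<phi> :: "'u \<Rightarrow> real" where "linear \<phi>" "\<phi> \<xi> = 1"
    using linear_independent_extend[of "{\<xi>}" "\<lambda>_. 1"] by auto
  moreover obtain y where "\<forall>\<xi>. pr \<xi> y = \<phi> \<xi>" using functional_represented[OF \<open>linear \<phi>\<close>] by blast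
  ultimately show False using assms[of y] by simp
qed

text \<open>A substitute for half the sum of the positive coroots, determined up to vectors
  orthogonal to all roots. The signs of the roots at \<open>w rho\<close> describe the chamber of
  \<open>w\<close>, and integrality makes translations by integral multiples of \<open>rho\<close>
  symmetries of the arrangement.\<close>

definition rho :: 'v where
  "rho = (SOME y. \<forall>\<alpha>\<in>simple_roots D. pr \<alpha> y = 1)"

lemma rho_simple: "\<alpha> \<in> simple_roots D \<Longrightarrow> pr \<alpha> rho = 1"
proof -
  have "independent (simple_roots D)" using based by (simp add: based_reduced_root_datum_def)
  then obtain \<phi> :: "'u \<Rightarrow> real" where "linear \<phi>" "\<And>\<alpha>. \<alpha> \<in> simple_roots D \<Longrightarrow> \<phi> \<alpha> = 1"
    using linear_independent_extend[of "simple_roots D" "\<lambda>_. 1"] by auto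
  then have "\<exists>y. \<forall>\<alpha>\<in>simple_roots D. pr \<alpha> y = 1"
    using functional_represented[of \<phi>] by metis
  then have "\<forall>\<alpha>\<in>simple_roots D. pr \<alpha> rho = 1" unfolding rho_def by (rule someI_ex)
  then show "\<alpha> \<in> simple_roots D \<Longrightarrow> pr \<alpha> rho = 1" by blast
qed

lemma simple_roots_sub: "simple_roots D \<subseteq> R"
  using based by (simp add: based_reduced_root_datum_def)

lemma finite_simple: "finite (simple_roots D)"
  using simple_roots_sub finite_roots finite_subset by blast

lemma root_nonzero: "\<alpha> \<in> R \<Longrightarrow> \<alpha> \<noteq> 0"
  using coroot_two[of \<alpha>] pairing_simps(10)[of "cr \<alpha>"] by auto

lemma positive_combination:
  assumes "\<alpha> \<in> positive_roots D"
  obtains c :: "'u \<Rightarrow> nat" where "\<And>x. pr \<alpha> x = (\<Sum>\<beta>\<in>simple_roots D. real (c \<beta>) * pr \<beta> x)"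
proof -
  obtain c :: "'u \<Rightarrow> nat" where c: "\<alpha> = (\<Sum>\<beta>\<in>simple_roots D. real (c \<beta>) *\<^sub>R \<beta>)"
    using assms by (auto simp: positive_roots_def)
  have "pr \<alpha> x = (\<Sum>\<beta>\<in>simple_roots D. real (c \<beta>) * pr \<beta> x)" for x
    unfolding c by (simp add: linear_sum[OF linear_pairing(2)] pairing_simps)
  then show ?thesis by (rule that)
qed

lemma positive_rho:
  assumes "\<alpha> \<in> positive_roots D"
  shows "pr \<alpha> rho \<in> \<int>" "pr \<alpha> rho > 0"
proof -
  obtain c :: "'u \<Rightarrow> nat" where c: "\<And>x. pr \<alpha> x = (\<Sum>\<beta>\<in>simple_roots D. real (c \<beta>) * pr \<beta> x)"
    using assms positive_combination by blast
  then have h: "pr \<alpha> rho = (\<Sum>\<beta>\<in>simple_roots D. real (c \<beta>))" by (simp add: rho_simple)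
  then show "pr \<alpha> rho \<in> \<int>" by (simp only:) (intro Ints_sum, auto)
  have "pr \<alpha> rho \<noteq> 0"
  proof
    assume "pr \<alpha> rho = 0"
    then have "\<forall>\<beta>\<in>simple_roots D. c \<beta> = 0"
      using h finite_simple by (simp add: sum_nonneg_eq_0_iff)
    then have "\<alpha> = 0" using c by (intro pairing_nondegenerate) simp
    then show False using assms root_nonzero by (auto simp: positive_roots_def)
  qed
  moreover have "pr \<alpha> rho \<ge> 0" using h by (simp add: sum_nonneg)
  ultimately show "pr \<alpha> rho > 0" by simp
qed

lemma positive_or_negative: "\<alpha> \<in> R \<Longrightarrow> \<alpha> \<in> positive_roots D \<or> - \<alpha> \<in> positive_roots D"
  using based by (simp add: based_reduced_root_datum_def)

lemma rho_nonzero: "\<alpha> \<in> R \<Longrightarrow> pr \<alpha> rho \<noteq> 0"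
  using positive_or_negative[of \<alpha>] positive_rho(2)[of \<alpha>] positive_rho(2)[of "- \<alpha>"]
  by (auto simp: pairing_simps)

lemma rho_int: "\<alpha> \<in> R \<Longrightarrow> pr \<alpha> rho \<in> \<int>"
  using positive_or_negative[of \<alpha>] positive_rho(1)[of \<alpha>] positive_rho(1)[of "- \<alpha>"]
  by (auto simp: pairing_simps minus_in_Ints_iff)

text \<open>Replaces coefficients with respect to the simple roots by a single sign.\<close>

lemma positive_iff: "\<alpha> \<in> positive_roots D \<longleftrightarrow> \<alpha> \<in> R \<and> pr \<alpha> rho > 0"
  using positive_or_negative[of \<alpha>] positive_rho(2)[of \<alpha>] positive_rho(2)[of "- \<alpha>"]
  by (auto simp: pairing_simps) (simp add: positive_roots_def)

lemma continuous_aroot: "continuous_on UNIV (aroot \<alpha> k)"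
proof -
  have "full_lattice (cocharacters D)" using based by (simp add: based_reduced_root_datum_def)
  then obtain B :: "'v set" where B: "finite B" "independent B" "span B = UNIV"
    unfolding full_lattice_def by auto
  have "bounded_linear (pr \<alpha>)" using linear_functional_bounded_linear[OF linear_pairing(1) B] .
  then have "continuous_on UNIV (\<lambda>x. pr \<alpha> x + real_of_int k)"
    by (intro continuous_intros linear_continuous_on)
  then show ?thesis by (simp add: affine_root_def[abs_def])
qed

lemma closed_aroot: "closed {x. aroot \<alpha> k x \<ge> 0}" "closed {x. aroot \<alpha> k x \<le> 0}"
  by (intro closed_Collect_le continuous_aroot continuous_on_const)+

section \<open>The base alcove\<close>

lemma base_alcove_iff:
  "x \<in> base_alcove D \<longleftrightarrow> (\<forall>\<alpha>\<in>R. pr \<alpha> rho > 0 \<longrightarrow> - 1 < pr \<alpha> x \<and> pr \<alpha> x < 0)"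
  by (auto simp: base_alcove_def positive_iff)

text \<open>The base alcove lies in the antidominant chamber, hence the negative multiple of
  \<open>rho\<close>. The denominator exceeds every \<open>\<bar>pr \<alpha> rho\<bar>\<close> and
  is positive even if there are no roots.\<close>

definition base_point :: 'v where
  "base_point = - (1 / (1 + (\<Sum>\<alpha>\<in>R. \<bar>pr \<alpha> rho\<bar>))) *\<^sub>R rho"

lemma base_point_in: "base_point \<in> base_alcove D"
  unfolding base_alcove_iff
proof (intro ballI impI)
  fix \<alpha> assume \<alpha>: "\<alpha> \<in> R" "pr \<alpha> rho > 0"
  let ?M = "\<Sum>\<alpha>\<in>R. \<bar>pr \<alpha> rho\<bar>"
  have "\<bar>pr \<alpha> rho\<bar> \<le> ?M" using \<alpha> finite_roots by (intro member_le_sum) auto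
  then have "pr \<alpha> rho < 1 + ?M" using \<alpha>(2) by simp
  then show "- 1 < pr \<alpha> base_point \<and> pr \<alpha> base_point < 0"
    using \<alpha> by (simp add: base_point_def pairing_simps divide_simps)
qed

text \<open>For a positive root both values lie strictly between \<open>- 1\<close> and
  \<open>0\<close>, so \<open>\<alpha> + k\<close> is positive for \<open>k \<ge> 1\<close> and
  negative otherwise. Negative roots follow by changing both signs.\<close>

lemma aroot_same_sign:
  assumes "x \<in> base_alcove D" "y \<in> base_alcove D" "\<alpha> \<in> R"
  shows "aroot \<alpha> k x * aroot \<alpha> k y > 0"
proof -
  have *: "aroot \<alpha> k x * aroot \<alpha> k y > 0" if "\<alpha> \<in> R" "pr \<alpha> rho > 0" for \<alpha> k
  proof -
    have "- 1 < pr \<alpha> x" "pr \<alpha> x < 0" "- 1 < pr \<alpha> y" "pr \<alpha> y < 0"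
      using assms that by (auto simp: base_alcove_iff)
    then show ?thesis
      by (cases "k \<ge> 1") (auto simp: affine_root_def intro!: mult_pos_pos mult_neg_neg)
  qed
  show ?thesis
    using *[of \<alpha> k] *[of "- \<alpha>" "- k"] assms(3) rho_nonzero[of \<alpha>] minus_root[of \<alpha>]
    by (cases "pr \<alpha> rho > 0") (auto simp: aroot_minus pairing_simps)
qed

text \<open>Written with all hyperplanes instead of the two for each positive root, because this
  form is carried along by symmetries of the arrangement. It is the topological closure by
  \<open>closure_base_alcove\<close>.\<close>

definition closed_alcove :: "'v set" where
  "closed_alcove = {x. \<forall>\<alpha>\<in>R. \<forall>k. aroot \<alpha> k x * aroot \<alpha> k base_point \<ge> 0}"

lemma closed_alcove_iff:
  "x \<in> closed_alcove \<longleftrightarrow> (\<forall>\<alpha>\<in>R. pr \<alpha> rho > 0 \<longrightarrow> - 1 \<le> pr \<alpha> x \<and> pr \<alpha> x \<le> 0)"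
proof
  assume x: "x \<in> closed_alcove"
  show "\<forall>\<alpha>\<in>R. pr \<alpha> rho > 0 \<longrightarrow> - 1 \<le> pr \<alpha> x \<and> pr \<alpha> x \<le> 0"
  proof (intro ballI impI)
    fix \<alpha> assume \<alpha>: "\<alpha> \<in> R" "pr \<alpha> rho > 0"
    then have p: "- 1 < pr \<alpha> base_point" "pr \<alpha> base_point < 0"
      using base_point_in by (auto simp: base_alcove_iff)
    have "aroot \<alpha> 1 x * aroot \<alpha> 1 base_point \<ge> 0" "aroot \<alpha> 0 x * aroot \<alpha> 0 base_point \<ge> 0"
      using x \<alpha>(1) unfolding closed_alcove_def by blast+
    then have "(pr \<alpha> x + 1) * (pr \<alpha> base_point + 1) \<ge> 0" "pr \<alpha> x * pr \<alpha> base_point \<ge> 0"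
      by (simp_all add: affine_root_def)
    then show "- 1 \<le> pr \<alpha> x \<and> pr \<alpha> x \<le> 0"
      using p by (auto simp: zero_le_mult_iff)
  qed
next
  assume x: "\<forall>\<alpha>\<in>R. pr \<alpha> rho > 0 \<longrightarrow> - 1 \<le> pr \<alpha> x \<and> pr \<alpha> x \<le> 0"
  have *: "aroot \<alpha> k x * aroot \<alpha> k base_point \<ge> 0" if "\<alpha> \<in> R" "pr \<alpha> rho > 0" for \<alpha> k
  proof -
    have "- 1 \<le> pr \<alpha> x" "pr \<alpha> x \<le> 0" "- 1 < pr \<alpha> base_point" "pr \<alpha> base_point < 0"
      using x base_point_in that by (auto simp: base_alcove_iff)
    then show ?thesis
      by (cases "k \<ge> 1") (auto simp: affine_root_def intro!: mult_nonneg_nonneg mult_nonpos_nonpos)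
  qed
  show "x \<in> closed_alcove"
    unfolding closed_alcove_def
  proof (intro CollectI ballI allI)
    fix \<alpha> k assume \<alpha>: "\<alpha> \<in> R"
    then show "aroot \<alpha> k x * aroot \<alpha> k base_point \<ge> 0"
      using *[of \<alpha> k] *[of "- \<alpha>" "- k"] rho_nonzero[of \<alpha>] minus_root[of \<alpha>]
      by (cases "pr \<alpha> rho > 0") (auto simp: aroot_minus pairing_simps)
  qed
qed

lemma closure_base_alcove: "closure (base_alcove D) = closed_alcove"
proof
  have "closed_alcove = (\<Inter>\<alpha>\<in>{\<alpha>\<in>R. pr \<alpha> rho > 0}. {x. aroot \<alpha> 1 x \<ge> 0} \<inter> {x. aroot \<alpha> 0 x \<le> 0})"
  proof -
    have "aroot \<alpha> 1 x \<ge> 0 \<longleftrightarrow> - 1 \<le> pr \<alpha> x" "aroot \<alpha> 0 x \<le> 0 \<longleftrightarrow> pr \<alpha> x \<le> 0" for \<alpha> x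
      unfolding affine_root_def by linarith+
    then show ?thesis by (auto simp: closed_alcove_iff)
  qed
  then have "closed closed_alcove" by (auto intro!: closed_INT closed_Int closed_aroot)
  moreover have "base_alcove D \<subseteq> closed_alcove"
    by (force simp: base_alcove_iff closed_alcove_iff)
  ultimately show "closure (base_alcove D) \<subseteq> closed_alcove" by (simp add: closure_minimal)
  show "closed_alcove \<subseteq> closure (base_alcove D)"
  proof
    fix x assume x: "x \<in> closed_alcove"
    define y where "y n = (1 - inverse (real (Suc n))) *\<^sub>R x + inverse (real (Suc n)) *\<^sub>R base_point" for n
    have "y n \<in> base_alcove D" for n
      unfolding base_alcove_iff
    proof (intro ballI impI)
      fix \<alpha> assume \<alpha>: "\<alpha> \<in> R" "pr \<alpha> rho > 0"
      define t where "t = inverse (real (Suc n))"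
      have t: "0 < t" "t \<le> 1" by (auto simp: t_def inverse_eq_divide)
      have x': "- 1 \<le> pr \<alpha> x" "pr \<alpha> x \<le> 0" using x \<alpha> by (auto simp: closed_alcove_iff)
      have p: "- 1 < pr \<alpha> base_point" "pr \<alpha> base_point < 0"
        using base_point_in \<alpha> by (auto simp: base_alcove_iff)
      have "pr \<alpha> (y n) = (1 - t) * pr \<alpha> x + t * pr \<alpha> base_point"
        by (simp add: y_def t_def pairing_simps)
      moreover have "(1 - t) * pr \<alpha> x \<le> 0" "t * pr \<alpha> base_point < 0"
        using t x' p by (auto simp: mult_le_0_iff mult_less_0_iff)
      moreover have "(1 - t) * pr \<alpha> x \<ge> - (1 - t)" "t * pr \<alpha> base_point > - t"
        using t x' p mult_left_mono[of "- 1" "pr \<alpha> x" "1 - t"]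
          mult_strict_left_mono[of "- 1" "pr \<alpha> base_point" t] by auto
      ultimately show "- 1 < pr \<alpha> (y n) \<and> pr \<alpha> (y n) < 0" by linarith
    qed
    moreover have "y \<longlonglongrightarrow> (1 - 0) *\<^sub>R x + 0 *\<^sub>R base_point"
      unfolding y_def by (intro tendsto_intros LIMSEQ_inverse_real_of_nat)
    ultimately show "x \<in> closure (base_alcove D)"
      unfolding closure_sequential by auto
  qed
qed

lemma aroot_base_point_nonzero: "\<alpha> \<in> R \<Longrightarrow> aroot \<alpha> k base_point \<noteq> 0"
  using aroot_same_sign[OF base_point_in base_point_in, of \<alpha> k] by auto

lemma base_alcove_iff_sign:
  "x \<in> base_alcove D \<longleftrightarrow> (\<forall>\<alpha>\<in>R. \<forall>k. aroot \<alpha> k x * aroot \<alpha> k base_point > 0)"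
proof
  assume *: "\<forall>\<alpha>\<in>R. \<forall>k. aroot \<alpha> k x * aroot \<alpha> k base_point > 0"
  then have "x \<in> closed_alcove" unfolding closed_alcove_def by (simp add: order_less_imp_le)
  moreover have "pr \<alpha> x \<noteq> 0" "pr \<alpha> x \<noteq> - 1" if "\<alpha> \<in> R" for \<alpha>
  proof -
    have "aroot \<alpha> 1 x * aroot \<alpha> 1 base_point > 0" "aroot \<alpha> 0 x * aroot \<alpha> 0 base_point > 0"
      using * that by blast+
    then show "pr \<alpha> x \<noteq> 0" "pr \<alpha> x \<noteq> - 1" by (auto simp: affine_root_def)
  qed
  ultimately show "x \<in> base_alcove D"
    unfolding base_alcove_iff closed_alcove_iff by (metis order_le_less)
qed (use aroot_same_sign base_point_in in blast)

section \<open>Walls\<close>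

text \<open>Projection along the coroot to the zero set of \<open>\<alpha> + k\<close> shows that
  \<open>\<beta> + l\<close> is a multiple of \<open>\<alpha> + k\<close>. By nondegeneracy
  \<open>\<beta>\<close> is the same multiple of \<open>\<alpha>\<close>, and reducedness leaves
  only the factors \<open>1\<close> and \<open>- 1\<close>.\<close>

lemma aroot_determined:
  assumes "\<alpha> \<in> R" "\<beta> \<in> R" "\<And>x. aroot \<alpha> k x = 0 \<Longrightarrow> aroot \<beta> l x = 0"
  shows "\<beta> = \<alpha> \<and> l = k \<or> \<beta> = - \<alpha> \<and> l = - k"
proof -
  define c where "c = pr \<beta> (cr \<alpha>) / 2"
  have *: "aroot \<beta> l x = c * aroot \<alpha> k x" for x
  proof -
    have "aroot \<alpha> k (x - (aroot \<alpha> k x / 2) *\<^sub>R cr \<alpha>) = 0"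
      using coroot_two[OF assms(1)] by (simp add: affine_root_def pairing_simps add_divide_distrib)
    then have "aroot \<beta> l (x - (aroot \<alpha> k x / 2) *\<^sub>R cr \<alpha>) = 0" by (rule assms(3))
    then show ?thesis by (simp add: affine_root_def pairing_simps c_def algebra_simps)
  qed
  have l: "real_of_int l = c * real_of_int k"
    using *[of 0] by (simp add: affine_root_def pairing_simps)
  have "pr (\<beta> - c *\<^sub>R \<alpha>) x = 0" for x
    using *[of x] l by (simp add: affine_root_def pairing_simps algebra_simps)
  then have "\<beta> = c *\<^sub>R \<alpha>" using pairing_nondegenerate[of "\<beta> - c *\<^sub>R \<alpha>"] by simp
  moreover from this have "c = 1 \<or> c = - 1" using reduced assms(1,2) by blast
  ultimately show ?thesis using l by auto
qed

lemma aroot_eqD: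
  assumes "\<alpha> \<in> R" "\<beta> \<in> R" "\<And>x. aroot \<alpha> k x = aroot \<beta> l x"
  shows "\<beta> = \<alpha>" "l = k"
  using aroot_determined[OF assms(1,2), of k l] assms(3) aroot_minus[of \<alpha> k base_point]
    aroot_base_point_nonzero[OF assms(1), of k] by auto

text \<open>A sign change between \<open>x\<close> and \<open>y\<close> bounds \<open>k\<close> by
  the values of the root at both points.\<close>

lemma finite_separating: "finite {(\<alpha>, k). \<alpha> \<in> R \<and> aroot \<alpha> k x * aroot \<alpha> k y < 0}"
proof -
  have "{(\<alpha>, k). \<alpha> \<in> R \<and> aroot \<alpha> k x * aroot \<alpha> k y < 0} \<subseteq>
    (SIGMA \<alpha>:R. {- \<lceil>\<bar>pr \<alpha> x\<bar> + \<bar>pr \<alpha> y\<bar>\<rceil> .. \<lceil>\<bar>pr \<alpha> x\<bar> + \<bar>pr \<alpha> y\<bar>\<rceil>})"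
  proof clarsimp
    fix \<alpha> and k :: int
    assume "aroot \<alpha> k x * aroot \<alpha> k y < 0"
    then have "\<bar>real_of_int k\<bar> \<le> \<bar>pr \<alpha> x\<bar> + \<bar>pr \<alpha> y\<bar>"
      by (auto simp: affine_root_def mult_less_0_iff)
    then have "\<bar>k\<bar> \<le> \<lceil>\<bar>pr \<alpha> x\<bar> + \<bar>pr \<alpha> y\<bar>\<rceil>" by linarith
    then show "- \<lceil>\<bar>pr \<alpha> x\<bar> + \<bar>pr \<alpha> y\<bar>\<rceil> \<le> k \<and> k \<le> \<lceil>\<bar>pr \<alpha> x\<bar> + \<bar>pr \<alpha> y\<bar>\<rceil>" by linarith
  qed
  then show ?thesis by (rule finite_subset) (simp add: finite_roots)
qed

text \<open>The witness \<open>y\<close> is a point in the relative interior of a face of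
  codimension one. This pointwise form replaces affine hulls of facets, see
  \<open>is_wall_iff\<close>.\<close>

definition is_wall :: "'u \<Rightarrow> int \<Rightarrow> bool" where
  "is_wall \<alpha> k \<longleftrightarrow> \<alpha> \<in> R \<and> (\<exists>y\<in>closed_alcove. aroot \<alpha> k y = 0 \<and>
     (\<forall>\<beta>\<in>R. \<forall>l. aroot \<beta> l y = 0 \<longrightarrow> \<beta> = \<alpha> \<and> l = k \<or> \<beta> = - \<alpha> \<and> l = - k))"

text \<open>Supplies generic starting points for segments: a sufficiently small move towards a point
  where the new function is nonzero preserves the strict inequalities of the alcove and the values
  already made nonzero.\<close>

lemma avoid_affine_functions:
  fixes H :: "('v \<Rightarrow> real) set"
  assumes "finite H"
    and "\<And>h t x y. h \<in> H \<Longrightarrow> h ((1 - t) *\<^sub>R x + t *\<^sub>R y) = (1 - t) * h x + t * h y"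
    and "\<And>h. h \<in> H \<Longrightarrow> \<exists>z. h z \<noteq> 0"
  shows "\<exists>q\<in>base_alcove D. \<forall>h\<in>H. h q \<noteq> 0"
  using assms
proof (induction H rule: finite_induct)
  case empty
  then show ?case using base_point_in by blast
next
  case (insert h H)
  then obtain q where q: "q \<in> base_alcove D" "\<forall>h\<in>H. h q \<noteq> 0" by auto
  obtain z where z: "h z \<noteq> 0" using insert.prems(2) by blast
  show ?case
  proof (cases "h q = 0")
    case True
    let ?\<phi> = "\<lambda>t. (1 - t) *\<^sub>R q + t *\<^sub>R z"
    have "\<forall>\<^sub>F t in at_right 0. \<forall>\<alpha>\<in>{\<alpha>\<in>R. pr \<alpha> rho > 0}. - 1 < pr \<alpha> (?\<phi> t) \<and> pr \<alpha> (?\<phi> t) < 0"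
    proof (intro eventually_ball_finite ballI eventually_conj)
      fix \<alpha> assume "\<alpha> \<in> {\<alpha>\<in>R. pr \<alpha> rho > 0}"
      then have "- 1 < pr \<alpha> q" "pr \<alpha> q < 0" using q by (auto simp: base_alcove_iff)
      then show "\<forall>\<^sub>F t in at_right 0. - 1 < pr \<alpha> (?\<phi> t)" "\<forall>\<^sub>F t in at_right 0. pr \<alpha> (?\<phi> t) < 0"
        by (simp_all add: pairing_simps eventually_segment)
    qed (simp add: finite_roots)
    moreover have "\<forall>\<^sub>F t in at_right 0. \<forall>h\<in>H. h (?\<phi> t) \<noteq> 0"
    proof (intro eventually_ball_finite ballI)
      fix g assume g: "g \<in> H"
      then have "g q \<noteq> 0" using q by blast
      then have "\<forall>\<^sub>F t in at_right 0. (1 - t) * g q + t * g z \<noteq> 0"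
        using eventually_segment(1)[of 0 "g q" "g z"] eventually_segment(2)[of "g q" 0 "g z"]
        by (cases "g q > 0") (auto elim: eventually_mono)
      then show "\<forall>\<^sub>F t in at_right 0. g (?\<phi> t) \<noteq> 0"
        using insert.prems(1)[of g] g by simp
    qed (rule insert.hyps)
    moreover have "\<forall>\<^sub>F t in at_right 0. (0::real) < t" by (rule eventually_at_right_less)
    ultimately have "\<forall>\<^sub>F t in at_right 0. ?\<phi> t \<in> base_alcove D \<and> (\<forall>g\<in>insert h H. g (?\<phi> t) \<noteq> 0)"
    proof eventually_elim
      case (elim t)
      have "h (?\<phi> t) \<noteq> 0" using insert.prems(1)[of h] True z elim by simp
      then show ?case using elim by (auto simp: base_alcove_iff)
    qed
    then show ?thesis using eventually_happens'[OF trivial_limit_at_right_real] by blast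
  qed (use q in auto)
qed

text \<open>A segment from a generic point of the base alcove meets the hyperplanes that it crosses
  at pairwise distinct times, and the first one it crosses is a wall.\<close>

lemma separating_wall:
  assumes "\<alpha>\<^sub>0 \<in> R" "aroot \<alpha>\<^sub>0 k\<^sub>0 base_point * aroot \<alpha>\<^sub>0 k\<^sub>0 x < 0"
  obtains \<alpha> k where "is_wall \<alpha> k" "aroot \<alpha> k base_point * aroot \<alpha> k x < 0"
proof -
  define F where "F i = (case i of (\<alpha>, k) \<Rightarrow> aroot \<alpha> k)" for i
  have Fminus: "F (- fst i, - snd i) z = - F i z" for i z
    by (cases i) (simp add: F_def aroot_minus)
  have Faff: "F i ((1 - t) *\<^sub>R y + t *\<^sub>R z) = (1 - t) * F i y + t * F i z" for i t y z
    by (cases i) (simp add: F_def aroot_affine)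
  \<comment> \<open>Only the sign with a positive value at the base point is kept, so each
    hyperplane that separates the base point from \<open>x\<close> occurs once.\<close>
  define T where "T = {i. fst i \<in> R \<and> F i base_point > 0 \<and> F i x < 0}"
  have "T \<subseteq> {(\<alpha>, k). \<alpha> \<in> R \<and> aroot \<alpha> k base_point * aroot \<alpha> k x < 0}"
    by (auto simp: T_def F_def mult_pos_neg)
  then have fin: "finite T" using finite_separating finite_subset by blast
  have "(\<alpha>\<^sub>0, k\<^sub>0) \<in> T \<or> (- \<alpha>\<^sub>0, - k\<^sub>0) \<in> T"
    using assms minus_root by (auto simp: T_def F_def aroot_minus mult_less_0_iff)
  then have ne: "T \<noteq> {}" by blast
  \<comment> \<open>For \<open>i\<close> and \<open>j\<close> in \<open>T\<close> this vanishes
    exactly if the segment from \<open>q\<close> to \<open>x\<close> meets both hyperplanes at the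
    same time, that is, if their times \<open>\<tau>\<close> below coincide.\<close>
  define h where "h i j q = F i x * F j q - F j x * F i q" for i j q
  define H where "H = (\<lambda>(i, j). h i j) ` {(i, j). i \<in> T \<and> j \<in> T \<and> i \<noteq> j}"
  have "finite H"
    unfolding H_def using fin
    by (intro finite_imageI finite_subset[of "{(i, j). i \<in> T \<and> j \<in> T \<and> i \<noteq> j}" "T \<times> T"]) auto
  moreover have "g ((1 - t) *\<^sub>R y + t *\<^sub>R z) = (1 - t) * g y + t * g z" if "g \<in> H" for g t y z
  proof -
    obtain i j where "g = h i j" using \<open>g \<in> H\<close> by (auto simp: H_def)
    then show ?thesis by (simp add: h_def Faff) (simp add: algebra_simps)
  qed
  moreover have "\<exists>z. g z \<noteq> 0" if gH: "g \<in> H" for g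
  proof (rule ccontr)
    assume 0: "\<not> (\<exists>z. g z \<noteq> 0)"
    obtain i j where ij: "i \<in> T" "j \<in> T" "i \<noteq> j" "g = h i j" using gH by (auto simp: H_def)
    have "F j z = 0" if "F i z = 0" for z
    proof -
      have "h i j z = 0" using 0 ij by blast
      then show ?thesis using ij(1) that by (simp add: h_def T_def)
    qed
    then have "j = i \<or> j = (- fst i, - snd i)"
      using aroot_determined[of "fst i" "fst j" "snd i" "snd j"] ij
      by (cases i; cases j) (auto simp: F_def T_def)
    then show False using ij Fminus[of i base_point] by (auto simp: T_def)
  qed
  ultimately obtain q where q: "q \<in> base_alcove D" "\<And>g. g \<in> H \<Longrightarrow> g q \<noteq> 0"
    using avoid_affine_functions[of H] by blast
  have Fq: "F i q > 0" if "fst i \<in> R" "F i base_point > 0" for i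
    using aroot_same_sign[OF q(1) base_point_in, of "fst i" "snd i"] that
    by (cases i) (auto simp: F_def zero_less_mult_iff)
  define \<tau> where "\<tau> i = F i q / (F i q - F i x)" for i
  have "Min (\<tau> ` T) \<in> \<tau> ` T" using fin ne by simp
  then obtain i where i: "i \<in> T" "\<tau> i = Min (\<tau> ` T)" by auto
  have min: "\<tau> i \<le> \<tau> j" if "j \<in> T" for j using i(2) fin that by simp
  have pos: "F j q > 0" "F j x < 0" if "j \<in> T" for j using that Fq by (auto simp: T_def)
  have strict: "\<tau> i < \<tau> j" if j: "j \<in> T" "j \<noteq> i" for j
  proof -
    have "h i j \<in> H" unfolding H_def using i(1) j by (auto intro!: image_eqI[of _ _ "(i, j)"])
    then have "F i x * F j q \<noteq> F j x * F i q" using q(2) by (fastforce simp: h_def)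
    then have "\<tau> i \<noteq> \<tau> j"
      using pos[OF i(1)] pos[OF j(1)] by (auto simp: \<tau>_def frac_eq_eq algebra_simps)
    then show ?thesis using min[OF j(1)] by simp
  qed
  define t where "t = \<tau> i"
  have t: "0 < t" "t < 1" using pos[OF i(1)] by (auto simp: t_def \<tau>_def divide_simps)
  define y where "y = (1 - t) *\<^sub>R q + t *\<^sub>R x"
  have Fy: "F j y = F j q - t * (F j q - F j x)" for j
    by (simp add: y_def Faff) (simp add: algebra_simps)
  have Fi: "F i y = 0" using pos[OF i(1)] by (simp add: Fy t_def \<tau>_def)
  have Fj: "F j y > 0" if j: "fst j \<in> R" "F j base_point > 0" "j \<noteq> i" for j
  proof (cases "F j x < 0")
    case True
    then have "t < F j q / (F j q - F j x)" using strict[of j] j by (auto simp: T_def t_def \<tau>_def)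
    then show ?thesis using True Fq[OF j(1,2)] by (simp add: Fy pos_less_divide_eq)
  next
    case False
    have "F j y = (1 - t) * F j q + t * F j x" by (simp add: y_def Faff)
    then show ?thesis using False t Fq[OF j(1,2)] by (simp add: add_pos_nonneg)
  qed
  have cases: "F j y > 0 \<and> F j base_point > 0 \<or> F j y < 0 \<and> F j base_point < 0
      \<or> F j y = 0 \<and> (j = i \<or> j = (- fst i, - snd i))" if j: "fst j \<in> R" for j
  proof (cases "F j base_point > 0")
    case True
    then show ?thesis using Fj[OF j] Fi by blast
  next
    case False
    have "F j base_point \<noteq> 0"
      using aroot_base_point_nonzero[OF j, of "snd j"] by (cases j) (simp add: F_def)
    then have b: "F j base_point < 0" using False by simp
    then have "F (- fst j, - snd j) base_point > 0" by (simp add: Fminus)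
    then show ?thesis
      using Fj[of "(- fst j, - snd j)"] Fi j minus_root[OF j] b Fminus[of j y]
      by (cases "(- fst j, - snd j) = i") auto
  qed
  obtain \<alpha> k where ik: "i = (\<alpha>, k)" by fastforce
  have "aroot \<beta> l y * aroot \<beta> l base_point \<ge> 0" if "\<beta> \<in> R" for \<beta> l
    using cases[of "(\<beta>, l)"] that by (auto simp: F_def mult_nonpos_nonpos)
  then have "y \<in> closed_alcove" by (simp add: closed_alcove_def)
  moreover have "aroot \<alpha> k y = 0" using Fi by (simp add: ik F_def)
  moreover have "\<beta> = \<alpha> \<and> l = k \<or> \<beta> = - \<alpha> \<and> l = - k" if "\<beta> \<in> R" "aroot \<beta> l y = 0" for \<beta> l
    using cases[of "(\<beta>, l)"] that by (auto simp: F_def ik)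
  moreover have "\<alpha> \<in> R" "aroot \<alpha> k base_point * aroot \<alpha> k x < 0"
    using i(1) by (auto simp: T_def ik F_def mult_pos_neg)
  ultimately show ?thesis using that[of \<alpha> k] by (auto simp: is_wall_def)
qed

lemma affine_hyperplane: "affine (hyperplane D \<alpha> k)"
  unfolding affine_def hyperplane_def
proof clarify
  fix x y and u v :: real
  assume "aroot \<alpha> k x = 0" "aroot \<alpha> k y = 0" "u + v = 1"
  then have "aroot \<alpha> k (u *\<^sub>R x + v *\<^sub>R y) = u * aroot \<alpha> k x + v * aroot \<alpha> k y"
    using aroot_affine[of \<alpha> k v x y] by (metis add_diff_cancel_right')
  then show "aroot \<alpha> k (u *\<^sub>R x + v *\<^sub>R y) = 0" using \<open>aroot \<alpha> k x = 0\<close> \<open>aroot \<alpha> k y = 0\<close> by simp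
qed

lemma facet_in_closed_alcove:
  assumes "y \<in> closed_alcove" "\<forall>\<alpha>\<in>R. \<forall>k. sgn (aroot \<alpha> k z) = sgn (aroot \<alpha> k y)"
  shows "z \<in> closed_alcove"
  unfolding closed_alcove_def
proof (intro CollectI ballI allI)
  fix \<alpha> k assume "\<alpha> \<in> R"
  then have "sgn (aroot \<alpha> k z) = sgn (aroot \<alpha> k y)" "aroot \<alpha> k y * aroot \<alpha> k base_point \<ge> 0"
    using assms by (auto simp: closed_alcove_def)
  then show "aroot \<alpha> k z * aroot \<alpha> k base_point \<ge> 0"
    by (auto simp: zero_le_mult_iff sgn_if split: if_splits)
qed

text \<open>A small move from the witness within its hyperplane stays in the facet, so the facet
  spans the hyperplane. Conversely, a second hyperplane through a point of a spanning facet would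
  contain its whole affine hull.\<close>

lemma is_wall_iff:
  assumes "\<alpha> \<in> R"
  shows "is_wall \<alpha> k \<longleftrightarrow> hyperplane D \<alpha> k \<in> walls D"
proof
  assume "is_wall \<alpha> k"
  then obtain y where y: "y \<in> closed_alcove" "aroot \<alpha> k y = 0"
    "\<And>\<beta> l. \<beta> \<in> R \<Longrightarrow> aroot \<beta> l y = 0 \<Longrightarrow> \<beta> = \<alpha> \<and> l = k \<or> \<beta> = - \<alpha> \<and> l = - k"
    by (auto simp: is_wall_def)
  define F where "F = {z. \<forall>\<alpha>\<in>R. \<forall>k. sgn (aroot \<alpha> k z) = sgn (aroot \<alpha> k y)}"
  have F: "F \<in> facets D" unfolding facets_def F_def by blast
  have "F \<subseteq> closure (base_alcove D)"
    unfolding closure_base_alcove F_def using facet_in_closed_alcove[OF y(1)] by blast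
  moreover have "affine hull F = hyperplane D \<alpha> k"
  proof
    show "affine hull F \<subseteq> hyperplane D \<alpha> k"
    proof (rule hull_minimal)
      show "F \<subseteq> hyperplane D \<alpha> k"
        proof
        fix z assume "z \<in> F"
        then have "sgn (aroot \<alpha> k z) = sgn (aroot \<alpha> k y)" using assms unfolding F_def by blast
        then show "z \<in> hyperplane D \<alpha> k" using y(2) by (simp add: hyperplane_def sgn_0_0)
      qed
    qed (rule affine_hyperplane)
    show "hyperplane D \<alpha> k \<subseteq> affine hull F"
    proof
      fix z assume z: "z \<in> hyperplane D \<alpha> k"
      let ?\<phi> = "\<lambda>t. (1 - t) *\<^sub>R y + t *\<^sub>R z"
      have "\<forall>\<^sub>F t in at_right 0. \<forall>\<beta>\<in>R. \<forall>l. sgn (aroot \<beta> l (?\<phi> t)) = sgn (aroot \<beta> l y)"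
      proof (intro eventually_ball_finite ballI finite_roots)
        fix \<beta> assume \<beta>: "\<beta> \<in> R"
        show "\<forall>\<^sub>F t in at_right 0. \<forall>l. sgn (aroot \<beta> l (?\<phi> t)) = sgn (aroot \<beta> l y)"
        \<comment> \<open>One bound on \<open>t\<close> must serve all \<open>l\<close>. If the
          value of \<open>\<beta>\<close> at \<open>y\<close> is integral, \<open>\<beta>\<close> is
          constant on the segment; otherwise it stays between two consecutive integers, which fixes
          the sign for every \<open>l\<close>.\<close>
        proof (cases "pr \<beta> y \<in> \<int>")
          case True
          then obtain m where m: "pr \<beta> y = real_of_int m" by (rule Ints_cases)
          then have "aroot \<beta> (- m) y = 0" by (simp add: affine_root_def)
          then have "\<beta> = \<alpha> \<and> - m = k \<or> \<beta> = - \<alpha> \<and> - m = - k" using y(3) \<beta> by blast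
          then have "pr \<beta> z = pr \<beta> y"
            using y(2) z by (auto simp: hyperplane_def affine_root_def pairing_simps)
          then have "aroot \<beta> l (?\<phi> t) = aroot \<beta> l y" for l t
            by (simp add: aroot_affine) (simp add: affine_root_def algebra_simps)
          then show ?thesis by simp
        next
          case False
          define m where "m = \<lfloor>pr \<beta> y\<rfloor>"
          have m: "real_of_int m < pr \<beta> y" "pr \<beta> y < real_of_int m + 1"
            using False Ints_of_int[of m] of_int_floor_le[of "pr \<beta> y"] floor_correct[of "pr \<beta> y"]
            unfolding m_def by (metis order_le_less, linarith)
          have "\<forall>\<^sub>F t in at_right 0. real_of_int m < (1 - t) * pr \<beta> y + t * pr \<beta> z"
            "\<forall>\<^sub>F t in at_right 0. (1 - t) * pr \<beta> y + t * pr \<beta> z < real_of_int m + 1"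
            using m by (auto intro: eventually_segment)
          then show ?thesis
          proof eventually_elim
            case (elim t)
            show ?case
            proof
              fix l :: int
              have "l \<le> - m - 1 \<or> l \<ge> - m" by linarith
              then have "real_of_int l \<le> - real_of_int m - 1 \<or> real_of_int l \<ge> - real_of_int m"
                by linarith
              then show "sgn (aroot \<beta> l (?\<phi> t)) = sgn (aroot \<beta> l y)"
                using elim m by (auto simp: affine_root_def pairing_simps sgn_if)
            qed
          qed
        qed
      qed
      moreover have "\<forall>\<^sub>F t in at_right 0. (0::real) < t" by (rule eventually_at_right_less)
      ultimately have "\<forall>\<^sub>F t in at_right 0. ?\<phi> t \<in> F \<and> 0 < t"
        by eventually_elim (simp add: F_def)
      then obtain t where t: "?\<phi> t \<in> F" "t > 0"
        using eventually_happens'[OF trivial_limit_at_right_real] by blast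
      have "y \<in> F" by (simp add: F_def)
      \<comment> \<open>Extrapolating the short segment back to parameter \<open>1\<close> recovers
        \<open>z\<close>.\<close>
      then have "(1 - 1 / t) *\<^sub>R y + (1 / t) *\<^sub>R ?\<phi> t \<in> affine hull F"
        using t(1) by (intro mem_affine[OF affine_affine_hull hull_inc hull_inc]) simp_all
      moreover have "(1 - 1 / t) *\<^sub>R y + (1 / t) *\<^sub>R ?\<phi> t = z"
      proof -
        have "(1 - 1 / t) + (1 / t) * (1 - t) = 0" "(1 / t) * t = 1"
          using t(2) by (simp_all add: field_simps)
        then show ?thesis
          unfolding scaleR_right_distrib scaleR_scaleR add.assoc[symmetric] scaleR_left_distrib[symmetric]
          by simp
      qed
      ultimately show "z \<in> affine hull F" by simp
    qed
  qed
  ultimately show "hyperplane D \<alpha> k \<in> walls D"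
    unfolding walls_def using F assms by blast
next
  assume "hyperplane D \<alpha> k \<in> walls D"
  then obtain F where F: "F \<in> facets D" "F \<subseteq> closed_alcove" "affine hull F = hyperplane D \<alpha> k"
    unfolding walls_def closure_base_alcove by auto
  then obtain y where y: "F = {z. \<forall>\<alpha>\<in>R. \<forall>k. sgn (aroot \<alpha> k z) = sgn (aroot \<alpha> k y)}"
    by (auto simp: facets_def)
  then have yF: "y \<in> F" by simp
  have "\<beta> = \<alpha> \<and> l = k \<or> \<beta> = - \<alpha> \<and> l = - k" if \<beta>: "\<beta> \<in> R" "aroot \<beta> l y = 0" for \<beta> l
  proof -
    have "F \<subseteq> hyperplane D \<beta> l"
    proof
      fix z assume "z \<in> F"
      then have "sgn (aroot \<beta> l z) = sgn (aroot \<beta> l y)" using \<beta>(1) unfolding y by blast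
      then show "z \<in> hyperplane D \<beta> l" using \<beta>(2) by (simp add: hyperplane_def sgn_0_0)
    qed
    then have "hyperplane D \<alpha> k \<subseteq> hyperplane D \<beta> l"
      using F(3) affine_hyperplane hull_minimal by metis
    then have "aroot \<beta> l x = 0" if "aroot \<alpha> k x = 0" for x using that by (auto simp: hyperplane_def)
    then show ?thesis by (rule aroot_determined[OF assms \<beta>(1)])
  qed
  moreover have "y \<in> hyperplane D \<alpha> k" using yF F(3) hull_inc[of y F affine] by simp
  then have "aroot \<alpha> k y = 0" by (simp add: hyperplane_def)
  moreover have "y \<in> closed_alcove" using yF F(2) by (rule rev_subsetD)
  ultimately show "is_wall \<alpha> k" using assms unfolding is_wall_def by blast
qed

abbreviation "S \<equiv> simple_affine_reflections D"

lemma simple_iff: "s \<in> S \<longleftrightarrow> (\<exists>\<alpha> k. is_wall \<alpha> k \<and> s = rfl \<alpha> k)"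
proof
  assume "s \<in> S"
  then show "\<exists>\<alpha> k. is_wall \<alpha> k \<and> s = rfl \<alpha> k"
    unfolding simple_affine_reflections_def using is_wall_iff by blast
next
  assume "\<exists>\<alpha> k. is_wall \<alpha> k \<and> s = rfl \<alpha> k"
  then obtain \<alpha> k where *: "is_wall \<alpha> k" "s = rfl \<alpha> k" by blast
  then have "\<alpha> \<in> R" by (simp add: is_wall_def)
  then show "s \<in> S" unfolding simple_affine_reflections_def using * is_wall_iff by blast
qed

section \<open>Symmetries of the arrangement\<close>

text \<open>The map \<open>g\<close> permutes the affine root hyperplanes and its linear part sends the
  direction \<open>d\<close> to \<open>d'\<close>, up to vectors that are orthogonal to all roots.\<close>

definition equivariant :: "('v \<Rightarrow> 'v) \<Rightarrow> 'v \<Rightarrow> 'v \<Rightarrow> bool" where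
  "equivariant g d d' \<longleftrightarrow> (\<forall>\<beta>\<in>R. \<forall>l. \<exists>\<alpha>\<in>R. \<exists>k. (\<forall>x. aroot \<alpha> k (g x) = aroot \<beta> l x)
     \<and> (\<forall>x. rfl \<alpha> k (g x) = g (rfl \<beta> l x)) \<and> pr \<alpha> d' = pr \<beta> d)"

lemma equivariant_id: "equivariant id d d"
  unfolding equivariant_def by auto

lemma equivariant_comp:
  assumes "equivariant g d d'" "equivariant h d' d''"
  shows "equivariant (h \<circ> g) d d''"
  unfolding equivariant_def
proof (intro ballI allI)
  fix \<beta> l assume "\<beta> \<in> R"
  then obtain \<alpha> k where 1: "\<alpha> \<in> R" "\<forall>x. aroot \<alpha> k (g x) = aroot \<beta> l x"
    "\<forall>x. rfl \<alpha> k (g x) = g (rfl \<beta> l x)" "pr \<alpha> d' = pr \<beta> d"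
    using assms(1) unfolding equivariant_def by meson
  then obtain \<gamma> m where 2: "\<gamma> \<in> R" "\<forall>x. aroot \<gamma> m (h x) = aroot \<alpha> k x"
    "\<forall>x. rfl \<gamma> m (h x) = h (rfl \<alpha> k x)" "pr \<gamma> d'' = pr \<alpha> d'"
    using assms(2) unfolding equivariant_def by meson
  show "\<exists>\<alpha>\<in>R. \<exists>k. (\<forall>x. aroot \<alpha> k ((h \<circ> g) x) = aroot \<beta> l x)
     \<and> (\<forall>x. rfl \<alpha> k ((h \<circ> g) x) = (h \<circ> g) (rfl \<beta> l x)) \<and> pr \<alpha> d'' = pr \<beta> d"
    using 1 2 by (intro bexI[of _ \<gamma>] exI[of _ m]) auto
qed

lemma equivariant_refl:
  assumes \<gamma>: "\<gamma> \<in> R"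
  shows "equivariant (rfl \<gamma> m) d (rfl \<gamma> 0 d)"
  unfolding equivariant_def
proof (intro ballI allI)
  fix \<beta> and l :: int assume \<beta>: "\<beta> \<in> R"
  obtain n :: int where n: "pr \<beta> (cr \<gamma>) = real_of_int n"
    using coroot_int[OF \<gamma> \<beta>] by (rule Ints_cases)
  let ?\<alpha> = "\<beta> - pr \<beta> (cr \<gamma>) *\<^sub>R \<gamma>" and ?k = "l - m * n"
  have a: "aroot ?\<alpha> ?k (rfl \<gamma> m x) = aroot \<beta> l x" for x
    using coroot_two[OF \<gamma>]
    by (simp add: affine_root_def affine_reflection_def pairing_simps n algebra_simps)
  moreover have "rfl ?\<alpha> ?k (rfl \<gamma> m x) = rfl \<gamma> m (rfl \<beta> l x)" for x
  proof -
    have "rfl \<gamma> m (rfl \<beta> l x) = rfl \<gamma> m x - aroot \<beta> l x *\<^sub>R (cr \<beta> - pr \<gamma> (cr \<beta>) *\<^sub>R cr \<gamma>)"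
      by (simp add: affine_reflection_def[of D \<gamma>] affine_reflection_def[of D \<beta>]
          affine_root_def[of D \<gamma>] pairing_simps algebra_simps)
    then show ?thesis
      unfolding refl_eq[of ?\<alpha>] a coroot_root_refl[OF \<gamma> \<beta>] by simp
  qed
  moreover have "pr ?\<alpha> (rfl \<gamma> 0 d) = pr \<beta> d"
    using coroot_two[OF \<gamma>] by (simp add: affine_root_def affine_reflection_def pairing_simps n)
  ultimately show "\<exists>\<alpha>\<in>R. \<exists>k. (\<forall>x. aroot \<alpha> k (rfl \<gamma> m x) = aroot \<beta> l x)
     \<and> (\<forall>x. rfl \<alpha> k (rfl \<gamma> m x) = rfl \<gamma> m (rfl \<beta> l x)) \<and> pr \<alpha> (rfl \<gamma> 0 d) = pr \<beta> d"
    using root_refl_in[OF \<gamma> \<beta>] by blast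
qed

lemma equivariant_transl:
  assumes "\<And>\<alpha>. \<alpha> \<in> R \<Longrightarrow> pr \<alpha> y \<in> \<int>"
  shows "equivariant (transl y) d d"
  unfolding equivariant_def
proof (intro ballI allI)
  fix \<beta> and l :: int assume \<beta>: "\<beta> \<in> R"
  then obtain n :: int where n: "pr \<beta> y = real_of_int n"
    using assms by (meson Ints_cases)
  have "aroot \<beta> (l - n) (transl y x) = aroot \<beta> l x" for x
    by (simp add: affine_root_def transl_def pairing_simps n)
  moreover from this have "rfl \<beta> (l - n) (transl y x) = transl y (rfl \<beta> l x)" for x
    by (simp add: refl_eq) (simp add: transl_def algebra_simps)
  ultimately show "\<exists>\<alpha>\<in>R. \<exists>k. (\<forall>x. aroot \<alpha> k (transl y x) = aroot \<beta> l x)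
     \<and> (\<forall>x. rfl \<alpha> k (transl y x) = transl y (rfl \<beta> l x)) \<and> pr \<alpha> d = pr \<beta> d"
    using \<beta> by blast
qed

text \<open>The direction \<open>0\<close> makes the clause on directions trivial, so that only the
  action on affine roots and reflections remains. The inverse is included so that affine roots can
  be pulled back as well as pushed forward.\<close>

definition symmetries :: "('v \<Rightarrow> 'v) set" where
  "symmetries = {g. bij g \<and> equivariant g 0 0 \<and> equivariant (inv_into UNIV g) 0 0}"

lemma symmetries_bij: "g \<in> symmetries \<Longrightarrow> bij g"
  by (simp add: symmetries_def)

lemma symmetries_inv: "g \<in> symmetries \<Longrightarrow> inv_into UNIV g \<in> symmetries"
  by (simp add: symmetries_def bij_imp_bij_inv inv_inv_eq)

lemma symmetries_comp: "g \<in> symmetries \<Longrightarrow> h \<in> symmetries \<Longrightarrow> g \<circ> h \<in> symmetries"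
  by (auto simp: symmetries_def o_inv_distrib bij_comp intro: equivariant_comp)

lemma push_root:
  assumes "g \<in> symmetries" "\<beta> \<in> R"
  obtains \<alpha> k where "\<alpha> \<in> R" "\<And>x. aroot \<alpha> k (g x) = aroot \<beta> l x" "rfl \<alpha> k \<circ> g = g \<circ> rfl \<beta> l"
proof -
  obtain \<alpha> k where "\<alpha> \<in> R" "\<forall>x. aroot \<alpha> k (g x) = aroot \<beta> l x" "\<forall>x. rfl \<alpha> k (g x) = g (rfl \<beta> l x)"
    using assms unfolding symmetries_def equivariant_def by blast
  then show ?thesis using that by fastforce
qed

lemma pull_root:
  assumes "g \<in> symmetries" "\<alpha> \<in> R"
  obtains \<beta> l where "\<beta> \<in> R" "\<And>x. aroot \<alpha> k (g x) = aroot \<beta> l x" "rfl \<alpha> k \<circ> g = g \<circ> rfl \<beta> l"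
proof -
  obtain \<beta> l where *: "\<beta> \<in> R" "\<And>x. aroot \<beta> l (inv_into UNIV g x) = aroot \<alpha> k x"
    "rfl \<beta> l \<circ> inv_into UNIV g = inv_into UNIV g \<circ> rfl \<alpha> k"
    using push_root[OF symmetries_inv[OF assms(1)] assms(2)] by metis
  have g: "inv_into UNIV g (g x) = x" "g (inv_into UNIV g x) = x" for x
    using symmetries_bij[OF assms(1)] by (simp_all add: bij_is_inj bij_is_surj surj_f_inv_f)
  have "aroot \<alpha> k (g x) = aroot \<beta> l x" for x
    using *(2)[of "g x"] by (simp add: g)
  moreover have "rfl \<alpha> k (g x) = g (rfl \<beta> l x)" for x
    using fun_cong[OF *(3), of "g x"] g by (metis comp_apply)
  ultimately show ?thesis using that[OF *(1)] by fastforce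
qed

sublocale affine: involutions "{rfl \<alpha> k | \<alpha> k. \<alpha> \<in> R}"
  by unfold_locales (auto simp: refl_involution)

sublocale linear: involutions "{rfl \<alpha> 0 | \<alpha>. \<alpha> \<in> R}"
  by unfold_locales (auto simp: refl_involution)

lemma wall_root: "is_wall \<alpha> k \<Longrightarrow> \<alpha> \<in> R"
  by (simp add: is_wall_def)

sublocale simple: involutions S
  by unfold_locales (auto simp: simple_iff wall_root refl_involution)

lemma simple_subset: "S \<subseteq> {rfl \<alpha> k | \<alpha> k. \<alpha> \<in> R}"
  unfolding simple_affine_reflections_def by blast

abbreviation "Wa \<equiv> affine_weyl_group D"
abbreviation "W \<equiv> weyl_group D"

lemma refl_symmetry: "\<alpha> \<in> R \<Longrightarrow> rfl \<alpha> k \<in> symmetries"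
proof -
  assume \<alpha>: "\<alpha> \<in> R"
  have "inv_into UNIV (rfl \<alpha> k) = rfl \<alpha> k" using refl_involution[OF \<alpha>] inv_unique_comp by blast
  moreover have "rfl \<alpha> 0 0 = 0" by (simp add: affine_reflection_def affine_root_def pairing_simps)
  then have "equivariant (rfl \<alpha> k) 0 0" using equivariant_refl[OF \<alpha>, of k 0] by simp
  moreover have "bij (rfl \<alpha> k)" using affine.involution_bij \<alpha> by blast
  ultimately show ?thesis by (simp add: symmetries_def)
qed

lemma id_symmetry: "id \<in> symmetries"
  by (simp only: symmetries_def mem_Collect_eq inv_id bij_id equivariant_id simp_thms)

lemma Wa_symmetries: "g \<in> Wa \<Longrightarrow> g \<in> symmetries"
  unfolding affine_weyl_group_def
proof (induction g rule: affine.generated_induct)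
  case (step s h)
  then show ?case using symmetries_comp refl_symmetry by blast
qed (rule id_symmetry)

lemma transl_inv: "inv_into UNIV (transl y) = transl (- y)"
  by (rule inv_unique_comp) (auto simp: transl_def)

lemma transl_bij: "bij (transl y)"
  by (rule o_bij[of "transl (- y)"]) (auto simp: transl_def)

lemma transl_symmetry: "(\<And>\<alpha>. \<alpha> \<in> R \<Longrightarrow> pr \<alpha> y \<in> \<int>) \<Longrightarrow> transl y \<in> symmetries"
  by (simp add: symmetries_def transl_bij transl_inv equivariant_transl pairing_simps)

lemma aroot_base_point_sym: "g \<in> symmetries \<Longrightarrow> \<alpha> \<in> R \<Longrightarrow> aroot \<alpha> k (g base_point) \<noteq> 0"
  using pull_root[of g \<alpha> k] aroot_base_point_nonzero by metis

text \<open>The witness of the wall is fixed by its reflection and lies off every other hyperplane,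
  so the base point and its mirror image are both on the side of this witness.\<close>

lemma wall_separates_only:
  assumes "is_wall \<alpha> k" "\<beta> \<in> R" "aroot \<beta> l base_point * aroot \<beta> l (rfl \<alpha> k base_point) \<le> 0"
  shows "\<beta> = \<alpha> \<and> l = k \<or> \<beta> = - \<alpha> \<and> l = - k"
proof (rule ccontr)
  assume neg: "\<not> ?thesis"
  obtain y where y: "y \<in> closed_alcove" "aroot \<alpha> k y = 0" "aroot \<beta> l y \<noteq> 0"
    using assms(1,2) neg unfolding is_wall_def by metis
  obtain \<gamma> m where \<gamma>: "\<gamma> \<in> R" "\<And>x. aroot \<beta> l (rfl \<alpha> k x) = aroot \<gamma> m x"
    using pull_root[OF refl_symmetry[OF wall_root[OF assms(1)]] assms(2)] by metis
  have "aroot \<gamma> m y = aroot \<beta> l y" using \<gamma>(2)[of y] refl_fixed[OF y(2)] by simp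
  moreover have "aroot \<gamma> m y * aroot \<gamma> m base_point \<ge> 0" "aroot \<beta> l y * aroot \<beta> l base_point \<ge> 0"
    using y(1) \<gamma>(1) assms(2) by (auto simp: closed_alcove_def)
  ultimately have "aroot \<beta> l base_point * aroot \<gamma> m base_point > 0"
    using y(3) aroot_base_point_nonzero[OF \<gamma>(1), of m] aroot_base_point_nonzero[OF assms(2), of l]
    by (auto simp: zero_le_mult_iff zero_less_mult_iff)
  then show False using assms(3) \<gamma>(2) by simp
qed

section \<open>Neighbouring alcoves and walks across walls\<close>

text \<open>Alcoves sharing a wall, each represented by a point. The nonstrict inequality also
  forces both points off all hyperplanes other than that of \<open>\<alpha> + k\<close>.\<close>

definition adjacent :: "'v \<Rightarrow> 'v \<Rightarrow> 'u \<Rightarrow> int \<Rightarrow> bool" where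
  "adjacent b b' \<alpha> k \<longleftrightarrow> \<alpha> \<in> R \<and> b' = rfl \<alpha> k b \<and> aroot \<alpha> k b \<noteq> 0 \<and>
     (\<forall>\<beta>\<in>R. \<forall>l. aroot \<beta> l b * aroot \<beta> l b' \<le> 0 \<longrightarrow> \<beta> = \<alpha> \<and> l = k \<or> \<beta> = - \<alpha> \<and> l = - k)"

lemma adjacent_sym: "adjacent b b' \<alpha> k \<Longrightarrow> adjacent b' b \<alpha> k"
  by (auto simp: adjacent_def aroot_refl mult.commute)

lemma adjacent_image:
  assumes "g \<in> symmetries" "is_wall \<alpha> k" "\<gamma> \<in> R"
    "\<And>x. aroot \<gamma> m (g x) = aroot \<alpha> k x" "rfl \<gamma> m \<circ> g = g \<circ> rfl \<alpha> k"
  shows "adjacent (g base_point) (g (rfl \<alpha> k base_point)) \<gamma> m"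
  unfolding adjacent_def
proof (intro conjI ballI allI impI)
  show "g (rfl \<alpha> k base_point) = rfl \<gamma> m (g base_point)" using fun_cong[OF assms(5)] by simp
  show "aroot \<gamma> m (g base_point) \<noteq> 0"
    using assms(1,3) by (intro aroot_base_point_sym) auto
  fix \<beta> l assume \<beta>: "\<beta> \<in> R" and sep: "aroot \<beta> l (g base_point) * aroot \<beta> l (g (rfl \<alpha> k base_point)) \<le> 0"
  obtain \<delta> n where \<delta>: "\<delta> \<in> R" "\<And>x. aroot \<beta> l (g x) = aroot \<delta> n x"
    using pull_root[OF assms(1) \<beta>] by metis
  then have "\<delta> = \<alpha> \<and> n = k \<or> \<delta> = - \<alpha> \<and> n = - k"
    using wall_separates_only[OF assms(2) \<delta>(1)] sep by simp
  then have *: "(\<forall>x. aroot \<gamma> m (g x) = aroot \<beta> l (g x)) \<or> (\<forall>x. aroot (- \<gamma>) (- m) (g x) = aroot \<beta> l (g x))"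
    using \<delta>(2) assms(4) by (auto simp: aroot_minus)
  have "g (inv_into UNIV g x) = x" for x
    using symmetries_bij[OF assms(1)] by (simp add: bij_is_surj surj_f_inv_f)
  then have "(\<forall>x. aroot \<gamma> m x = aroot \<beta> l x) \<or> (\<forall>x. aroot (- \<gamma>) (- m) x = aroot \<beta> l x)"
    using * by metis
  then show "\<beta> = \<gamma> \<and> l = m \<or> \<beta> = - \<gamma> \<and> l = - m"
  proof
    assume *: "\<forall>x. aroot \<gamma> m x = aroot \<beta> l x"
    show ?thesis using aroot_eqD[OF assms(3) \<beta> *[rule_format]] by simp
  next
    assume *: "\<forall>x. aroot (- \<gamma>) (- m) x = aroot \<beta> l x"
    show ?thesis using aroot_eqD[OF minus_root[OF assms(3)] \<beta> *[rule_format]] by simp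
  qed
qed (rule assms(3))

text \<open>\<open>separating_wall\<close> is applied to the preimage of \<open>x\<close> and the
  result carried forward by \<open>g\<close>. A wall of the alcove of \<open>g\<close> is crossed by
  right multiplication with a simple reflection, which equals left multiplication with the
  reflection in that wall.\<close>

lemma separating_adjacent:
  assumes "g \<in> symmetries" "\<alpha>\<^sub>0 \<in> R" "aroot \<alpha>\<^sub>0 k\<^sub>0 (g base_point) * aroot \<alpha>\<^sub>0 k\<^sub>0 x < 0"
  obtains s \<alpha> k where "s \<in> S" "adjacent (g base_point) (g (s base_point)) \<alpha> k"
    "rfl \<alpha> k \<circ> g = g \<circ> s" "aroot \<alpha> k (g base_point) * aroot \<alpha> k x < 0"
proof -
  let ?x = "inv_into UNIV g x"
  have x: "g ?x = x" using symmetries_bij[OF assms(1)] by (simp add: bij_is_surj surj_f_inv_f)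
  obtain \<beta> l where "\<beta> \<in> R" "\<And>x. aroot \<alpha>\<^sub>0 k\<^sub>0 (g x) = aroot \<beta> l x"
    using pull_root[OF assms(1,2)] by metis
  then have "aroot \<beta> l base_point * aroot \<beta> l ?x < 0" using assms(3) x by metis
  then obtain \<gamma> m where w: "is_wall \<gamma> m" "aroot \<gamma> m base_point * aroot \<gamma> m ?x < 0"
    using separating_wall[OF \<open>\<beta> \<in> R\<close>] by metis
  then obtain \<alpha> k where *: "\<alpha> \<in> R" "\<And>x. aroot \<alpha> k (g x) = aroot \<gamma> m x" "rfl \<alpha> k \<circ> g = g \<circ> rfl \<gamma> m"
    using push_root[OF assms(1) wall_root] by metis
  have "aroot \<alpha> k (g base_point) * aroot \<alpha> k x < 0" using w(2) *(2)[of ?x] *(2)[of base_point] x by simp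
  then show ?thesis
    using that[of "rfl \<gamma> m" \<alpha> k] * w(1) adjacent_image[OF assms(1) w(1) *] simple_iff by blast
qed

text \<open>A measure for inductions over walks; each separating hyperplane counts twice, once for
  each sign.\<close>

definition separation :: "'v \<Rightarrow> 'v \<Rightarrow> nat" where
  "separation x y = card {(\<alpha>, k). \<alpha> \<in> R \<and> aroot \<alpha> k x * aroot \<alpha> k y < 0}"

text \<open>Crossing the wall changes no other side, and with respect to the wall itself
  \<open>b'\<close> is already on the side of \<open>x\<close>.\<close>

lemma adjacent_closer:
  assumes "adjacent b b' \<alpha> k" "aroot \<alpha> k b * aroot \<alpha> k x < 0"
    "\<beta> \<in> R" "aroot \<beta> l b' * aroot \<beta> l x < 0"
  shows "aroot \<beta> l b * aroot \<beta> l x < 0"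
proof -
  have "aroot \<alpha> k b' * aroot \<alpha> k x > 0"
    using assms(1,2) aroot_refl[of \<alpha> k b] by (simp add: adjacent_def)
  then have "\<not> (\<beta> = \<alpha> \<and> l = k \<or> \<beta> = - \<alpha> \<and> l = - k)" using assms(4) by (auto simp: aroot_minus)
  then have "aroot \<beta> l b * aroot \<beta> l b' > 0"
    using assms(1,3) unfolding adjacent_def by (meson not_le)
  then show ?thesis using assms(4) mult_pos_trans(2) by blast
qed

lemma separation_adjacent:
  assumes "adjacent b b' \<alpha> k" "aroot \<alpha> k b * aroot \<alpha> k x < 0"
  shows "separation b' x < separation b x"
  unfolding separation_def
proof (rule psubset_card_mono[OF finite_separating])
  have \<alpha>: "\<alpha> \<in> R" "b' = rfl \<alpha> k b" using assms(1) by (auto simp: adjacent_def)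
  then have "\<not> aroot \<alpha> k b' * aroot \<alpha> k x < 0" using assms(2) by (simp add: aroot_refl)
  then show "{(\<alpha>, k). \<alpha> \<in> R \<and> aroot \<alpha> k b' * aroot \<alpha> k x < 0}
      \<subset> {(\<alpha>, k). \<alpha> \<in> R \<and> aroot \<alpha> k b * aroot \<alpha> k x < 0}"
    using \<alpha>(1) assms adjacent_closer[OF assms] by blast
qed

lemma simple_generated_symmetries: "g \<in> generated S \<Longrightarrow> g \<in> symmetries"
proof (induction g rule: simple.generated_induct)
  case (step s h)
  then obtain \<alpha> k where "is_wall \<alpha> k" "s = rfl \<alpha> k" unfolding simple_iff by blast
  then show ?case using symmetries_comp refl_symmetry wall_root step by blast
qed (rule id_symmetry)

text \<open>Walls that separate the current alcove from \<open>x\<close> are crossed until none is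
  left; \<open>x\<close> itself may lie on hyperplanes.\<close>

lemma generated_transitive:
  "u \<in> generated S \<Longrightarrow>
    \<exists>v\<in>generated S. \<forall>\<alpha>\<in>R. \<forall>k. \<not> aroot \<alpha> k (v base_point) * aroot \<alpha> k x < 0"
proof (induction "separation (u base_point) x" arbitrary: u rule: less_induct)
  case less
  show ?case
  proof (cases "\<exists>\<alpha>\<in>R. \<exists>k. aroot \<alpha> k (u base_point) * aroot \<alpha> k x < 0")
    case True
    then obtain \<alpha>\<^sub>0 k\<^sub>0 where *: "\<alpha>\<^sub>0 \<in> R" "aroot \<alpha>\<^sub>0 k\<^sub>0 (u base_point) * aroot \<alpha>\<^sub>0 k\<^sub>0 x < 0" by blast
    from separating_adjacent[OF simple_generated_symmetries[OF less.prems] *]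
    obtain s \<alpha> k where s: "s \<in> S" "adjacent (u base_point) (u (s base_point)) \<alpha> k"
      "aroot \<alpha> k (u base_point) * aroot \<alpha> k x < 0" by metis
    have "u \<circ> s \<in> generated S"
      using less.prems s(1) simple.generated_comp simple.generated_base by blast
    then show ?thesis using less.hyps[of "u \<circ> s"] separation_adjacent[OF s(2,3)] by simp
  qed (use less.prems in blast)
qed

section \<open>Exchange condition and generation by simple reflections\<close>

text \<open>Geometric exchange condition: the prefixes of the word form a gallery from the base
  alcove, and at the letter \<open>s\<close> where it crosses the hyperplane of
  \<open>\<alpha> + k\<close>, the reflection is the conjugate of \<open>s\<close> by the prefix
  \<open>us\<close>.\<close>

lemma word_crosses:
  assumes "set ss \<subseteq> S" "\<alpha> \<in> R"
    "aroot \<alpha> k base_point * aroot \<alpha> k (foldr (\<circ>) ss id base_point) < 0"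
  shows "\<exists>us s vs. ss = us @ s # vs \<and> rfl \<alpha> k \<circ> foldr (\<circ>) us id = foldr (\<circ>) us id \<circ> s"
  using assms
proof (induction ss arbitrary: \<alpha> k)
  case Nil
  then show ?case by (simp add: mult_less_0_iff)
next
  case (Cons s ss)
  let ?g = "foldr (\<circ>) ss id"
  have g: "foldr (\<circ>) (s # ss) id = s \<circ> ?g" by simp
  obtain \<gamma> m where w: "is_wall \<gamma> m" "s = rfl \<gamma> m" using Cons.prems simple_iff by auto
  show ?case
  proof (cases "aroot \<alpha> k base_point * aroot \<alpha> k (s base_point) \<le> 0")
    case True
    then have "\<alpha> = \<gamma> \<and> k = m \<or> \<alpha> = - \<gamma> \<and> k = - m"
      using wall_separates_only[OF w(1) Cons.prems(2)] w(2) by simp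
    then have "rfl \<alpha> k = s" using w refl_minus[OF wall_root[OF w(1)]] by auto
    then show ?thesis by (intro exI[of _ "[]"] exI[of _ s] exI[of _ ss]) simp
  next
    case False
    have s: "s \<in> symmetries" using w refl_symmetry wall_root by auto
    obtain \<beta> l where \<beta>: "\<beta> \<in> R" "\<And>x. aroot \<alpha> k (s x) = aroot \<beta> l x" "rfl \<alpha> k \<circ> s = s \<circ> rfl \<beta> l"
      using pull_root[OF s Cons.prems(2)] by metis
    have "aroot \<alpha> k (s base_point) * aroot \<alpha> k base_point > 0" using False by (simp only: mult.commute not_le)
    moreover have "aroot \<alpha> k base_point * aroot \<alpha> k (s (?g base_point)) < 0"
      using Cons.prems(3) by (metis comp_apply g)
    ultimately have "aroot \<alpha> k (s base_point) * aroot \<alpha> k (s (?g base_point)) < 0"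
      by (rule mult_pos_trans(2))
    then have "aroot \<beta> l base_point * aroot \<beta> l (?g base_point) < 0" by (simp add: \<beta>(2))
    moreover have "set ss \<subseteq> S" using Cons.prems by simp
    ultimately obtain us t vs where us: "ss = us @ t # vs"
      "rfl \<beta> l \<circ> foldr (\<circ>) us id = foldr (\<circ>) us id \<circ> t"
      using Cons.IH[OF _ \<beta>(1)] by blast
    have "rfl \<alpha> k \<circ> (s \<circ> foldr (\<circ>) us id) = s \<circ> (rfl \<beta> l \<circ> foldr (\<circ>) us id)"
      using \<beta>(3) by (metis comp_assoc)
    then have "rfl \<alpha> k \<circ> foldr (\<circ>) (s # us) id = foldr (\<circ>) (s # us) id \<circ> t"
      using us(2) by (simp add: comp_assoc)
    moreover have "s # ss = (s # us) @ t # vs" using us(1) by simp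
    ultimately show ?thesis by blast
  qed
qed

lemma subset_involutions: "J \<subseteq> S \<Longrightarrow> involutions J"
  by unfold_locales (use simple.involution in blast)

lemma generated_subset: "J \<subseteq> S \<Longrightarrow> g \<in> generated J \<Longrightarrow> g \<in> generated S"
  using involutions.generated_words[OF subset_involutions] simple.generated_words by fastforce

text \<open>The first letter of a shortest word in \<open>J\<close> provides the wall: otherwise the
  rest of the word crosses that wall, and exchange removes two letters without leaving
  \<open>J\<close>.\<close>

lemma generated_descent:
  assumes "J \<subseteq> S" "g \<in> generated J" "g \<noteq> id"
  shows "\<exists>\<alpha> k. is_wall \<alpha> k \<and> rfl \<alpha> k \<in> J \<and> aroot \<alpha> k base_point * aroot \<alpha> k (g base_point) < 0"
proof -
  have "\<exists>ss. set ss \<subseteq> J \<and> g = foldr (\<circ>) ss id"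
    using assms(2) involutions.generated_words[OF subset_involutions[OF assms(1)]] by blast
  then obtain ss where ss: "set ss \<subseteq> J" "g = foldr (\<circ>) ss id"
    and min: "\<And>ts. set ts \<subseteq> J \<and> g = foldr (\<circ>) ts id \<Longrightarrow> length ss \<le> length ts"
    using ex_has_least_nat[of "\<lambda>ss. set ss \<subseteq> J \<and> g = foldr (\<circ>) ss id" _ length] by blast
  obtain s ss' where ss': "ss = s # ss'" using ss(2) assms(3) by (cases ss) auto
  let ?h = "foldr (\<circ>) ss' id"
  have g: "g = s \<circ> ?h" using ss(2) ss' by simp
  obtain \<alpha> k where w: "is_wall \<alpha> k" "s = rfl \<alpha> k"
  proof -
    have "s \<in> S" using ss(1) ss' assms(1) by auto
    then show ?thesis using that unfolding simple_iff by blast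
  qed
  have \<alpha>: "\<alpha> \<in> R" using w wall_root by blast
  have gsym: "g \<in> symmetries"
    using generated_subset[OF assms(1,2)] simple_generated_symmetries by blast
  have "aroot \<alpha> k base_point * aroot \<alpha> k (g base_point) < 0"
  proof (rule ccontr)
    assume neg: "\<not> ?thesis"
    have "aroot \<alpha> k (g base_point) = - aroot \<alpha> k (?h base_point)"
      by (simp add: g w(2) aroot_refl[OF \<alpha>])
    then have "aroot \<alpha> k base_point * aroot \<alpha> k (?h base_point) < 0"
      using neg aroot_base_point_sym[OF gsym \<alpha>, of k] aroot_base_point_nonzero[OF \<alpha>, of k]
      by (auto simp: not_less zero_le_mult_iff mult_le_0_iff mult_less_0_iff)
    moreover have "set ss' \<subseteq> S" using ss(1) ss' assms(1) by auto
    ultimately obtain us t vs where us: "ss' = us @ t # vs"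
      "rfl \<alpha> k \<circ> foldr (\<circ>) us id = foldr (\<circ>) us id \<circ> t"
      using word_crosses[OF _ \<alpha>] by metis
    have t: "t \<circ> t = id" using us(1) ss' ss(1) assms(1) simple.involution by auto
    have "g = rfl \<alpha> k \<circ> (foldr (\<circ>) us id \<circ> (t \<circ> foldr (\<circ>) vs id))"
      using g us(1) w(2) foldr_comp_append[of us "t # vs"] by simp
    also have "\<dots> = foldr (\<circ>) us id \<circ> (t \<circ> t) \<circ> foldr (\<circ>) vs id"
      using us(2) by (metis comp_assoc)
    also have "\<dots> = foldr (\<circ>) (us @ vs) id"
      unfolding t foldr_comp_append by simp
    finally have "g = foldr (\<circ>) (us @ vs) id" .
    moreover have "set (us @ vs) \<subseteq> J" using us(1) ss' ss(1) by auto
    ultimately have "length ss \<le> length (us @ vs)" using min by blast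
    then show False using us(1) ss' by simp
  qed
  then show ?thesis using w ss(1) ss' by auto
qed

text \<open>A gallery from the base alcove to its mirror image crosses the hyperplane of the
  reflection, which is therefore conjugate to a simple reflection by a prefix of the
  gallery.\<close>

lemma Wa_generated_simple: "Wa = generated S"
proof
  show "generated S \<subseteq> Wa"
    unfolding affine_weyl_group_def affine.generated_words simple.generated_words
    using simple_subset by blast
  have gen: "rfl \<alpha> k \<in> generated S" if \<alpha>: "\<alpha> \<in> R" for \<alpha> k
  proof -
    obtain u where u: "u \<in> generated S"
      "\<And>\<beta> l. \<beta> \<in> R \<Longrightarrow> \<not> aroot \<beta> l (u base_point) * aroot \<beta> l (rfl \<alpha> k base_point) < 0"
      using generated_transitive[OF simple.generated_id] by blast
    then obtain ss where ss: "set ss \<subseteq> S" "u = foldr (\<circ>) ss id"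
      using simple.generated_words by auto
    have "aroot \<alpha> k base_point * aroot \<alpha> k (u base_point) < 0"
      using u(2)[OF \<alpha>, of k] aroot_base_point_nonzero[OF \<alpha>, of k] aroot_refl[OF \<alpha>, of k base_point]
        aroot_base_point_sym[OF simple_generated_symmetries[OF u(1)] \<alpha>, of k]
      by (auto simp: not_less zero_le_mult_iff mult_le_0_iff mult_less_0_iff)
    then obtain us s vs where us: "ss = us @ s # vs"
      "rfl \<alpha> k \<circ> foldr (\<circ>) us id = foldr (\<circ>) us id \<circ> s"
      using word_crosses[OF ss(1) \<alpha>] ss(2) by metis
    let ?g = "foldr (\<circ>) us id"
    have g: "?g \<in> generated S" using us(1) ss(1) simple.generated_words by auto
    have "rfl \<alpha> k = ?g \<circ> s \<circ> inv_into UNIV ?g"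
      using us(2) simple.generated_bij[OF g]
      by (metis bij_is_surj comp_assoc comp_id surj_iff)
    moreover have "s \<in> S" using us(1) ss(1) by auto
    ultimately show ?thesis
      using g simple.generated_comp simple.generated_inv simple.generated_base by simp
  qed
  have "g \<in> generated S" if "g \<in> Wa" for g
    using that unfolding affine_weyl_group_def
  proof (induction g rule: affine.generated_induct)
    case (step s h)
    then show ?case using gen simple.generated_comp by blast
  qed (rule simple.generated_id)
  then show "Wa \<subseteq> generated S" by blast
qed

text \<open>Freeness of the action on alcoves: a nontrivial element has a simple descent, whose wall
  separates.\<close>

lemma Wa_free:
  assumes "g \<in> Wa" "\<And>\<alpha> k. \<alpha> \<in> R \<Longrightarrow> \<not> aroot \<alpha> k base_point * aroot \<alpha> k (g base_point) < 0"
  shows "g = id"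
  using generated_descent[of S g] assms Wa_generated_simple wall_root by blast

lemma Wa_comp: "g \<in> Wa \<Longrightarrow> h \<in> Wa \<Longrightarrow> g \<circ> h \<in> Wa"
  and Wa_inv: "g \<in> Wa \<Longrightarrow> inv_into UNIV g \<in> Wa"
  and Wa_id: "id \<in> Wa"
  and Wa_refl: "\<alpha> \<in> R \<Longrightarrow> rfl \<alpha> k \<in> Wa"
  and Wa_bij: "g \<in> Wa \<Longrightarrow> bij g"
  unfolding affine_weyl_group_def
  using affine.generated_comp affine.generated_inv affine.generated_id affine.generated_bij
    affine.generated_base by blast+

lemma Wa_simple: "s \<in> S \<Longrightarrow> s \<in> Wa"
  using Wa_refl simple_subset by blast

section \<open>Orders generated by reflections\<close>

text \<open>A step replaces a set, lying strictly on one side of a hyperplane, by its reflection.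
  Which side is the lower one is prescribed by \<open>\<sigma>\<close>: the side of a base point, which gives the
  Bruhat order, or the side opposite to a direction, which gives its semi-infinite analogue.\<close>

definition step :: "('u \<Rightarrow> int \<Rightarrow> real) \<Rightarrow> 'v set \<Rightarrow> 'v set \<Rightarrow> bool" where
  "step \<sigma> Y X \<longleftrightarrow> (\<exists>\<alpha>\<in>R. \<exists>k. X = rfl \<alpha> k ` Y \<and> (\<forall>y\<in>Y. aroot \<alpha> k y * \<sigma> \<alpha> k > 0))"

abbreviation "below \<sigma> \<equiv> (step \<sigma>)\<^sup>*\<^sup>*"

definition seen_from :: "'v \<Rightarrow> 'u \<Rightarrow> int \<Rightarrow> real" where
  "seen_from b \<alpha> k = aroot \<alpha> k b"

definition against :: "'v \<Rightarrow> 'u \<Rightarrow> int \<Rightarrow> real" where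
  "against d \<alpha> k = - pr \<alpha> d"

lemma step_image:
  assumes "\<alpha> \<in> R" "\<And>x. aroot \<alpha> k (g x) = aroot \<beta> l x" "rfl \<alpha> k \<circ> g = g \<circ> rfl \<beta> l"
    "X = rfl \<beta> l ` Y" "\<forall>y\<in>Y. aroot \<beta> l y * c > 0" "\<sigma> \<alpha> k = c"
  shows "step \<sigma> (g ` Y) (g ` X)"
proof -
  have "g ` X = rfl \<alpha> k ` g ` Y"
    using assms(3,4) by (metis image_comp)
  then show ?thesis unfolding step_def using assms by (intro bexI[of _ \<alpha>] exI[of _ k]) auto
qed

text \<open>Applied to a reflection, this transforms a whole chain for one chamber into a chain for
  another one.\<close>

lemma below_against_image:
  assumes "equivariant g d d'" "below (against d) Y X"
  shows "below (against d') (g ` Y) (g ` X)"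
  using assms(2)
proof (induction rule: rtranclp_induct)
  case (step X Z)
  then obtain \<beta> l where \<beta>: "\<beta> \<in> R" "Z = rfl \<beta> l ` X" "\<forall>y\<in>X. aroot \<beta> l y * - pr \<beta> d > 0"
    unfolding step_def against_def by auto
  then obtain \<alpha> k where "\<alpha> \<in> R" "\<forall>x. aroot \<alpha> k (g x) = aroot \<beta> l x"
    "\<forall>x. rfl \<alpha> k (g x) = g (rfl \<beta> l x)" "pr \<alpha> d' = pr \<beta> d"
    using assms(1) unfolding equivariant_def by blast
  then have "step (against d') (g ` X) (g ` Z)"
    using \<beta> by (intro step_image[of \<alpha> k g \<beta> l Z X "- pr \<beta> d"]) (auto simp: against_def)
  then show ?case using step.IH by simp
qed simp

text \<open>The hyperplane of \<open>\<alpha> + k\<close> is the only one on which \<open>b\<close>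
  and \<open>b'\<close> disagree. Any other step stays a step as seen from \<open>b'\<close>, and
  its mirror image is one because \<open>b'\<close> is the mirror image of \<open>b\<close>.\<close>

lemma adjacent_step:
  assumes "adjacent b b' \<alpha> k" "step (seen_from b) Z Z'"
  shows "Z' = rfl \<alpha> k ` Z \<or> step (seen_from b') Z Z' \<and>
    step (seen_from b') (rfl \<alpha> k ` Z) (rfl \<alpha> k ` Z')"
proof (rule disjCI)
  assume neg: "\<not> (step (seen_from b') Z Z' \<and> step (seen_from b') (rfl \<alpha> k ` Z) (rfl \<alpha> k ` Z'))"
  obtain \<beta> l where \<beta>: "\<beta> \<in> R" "Z' = rfl \<beta> l ` Z" "\<forall>y\<in>Z. aroot \<beta> l y * aroot \<beta> l b > 0"
    using assms(2) unfolding step_def seen_from_def by auto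
  have \<alpha>: "\<alpha> \<in> R" "b' = rfl \<alpha> k b" using assms(1) by (auto simp: adjacent_def)
  show "Z' = rfl \<alpha> k ` Z"
  proof (cases "\<beta> = \<alpha> \<and> l = k \<or> \<beta> = - \<alpha> \<and> l = - k")
    case True
    then show ?thesis using \<beta>(2) refl_minus[OF \<alpha>(1)] by auto
  next
    case False
    then have bb: "aroot \<beta> l b * aroot \<beta> l b' > 0"
      using assms(1) \<beta>(1) unfolding adjacent_def by (meson not_le)
    then have "step (seen_from b') Z Z'"
      unfolding step_def seen_from_def using \<beta> mult_pos_trans(1) by blast
    moreover obtain \<gamma> m where \<gamma>: "\<gamma> \<in> R" "\<And>x. aroot \<gamma> m (rfl \<alpha> k x) = aroot \<beta> l x"
      "rfl \<gamma> m \<circ> rfl \<alpha> k = rfl \<alpha> k \<circ> rfl \<beta> l"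
      using push_root[OF refl_symmetry[OF \<alpha>(1)] \<beta>(1)] by metis
    have "step (seen_from b') (rfl \<alpha> k ` Z) (rfl \<alpha> k ` Z')"
      using \<gamma> \<beta> by (intro step_image[of \<gamma> m "rfl \<alpha> k" \<beta> l Z' Z "aroot \<beta> l b"])
        (auto simp: seen_from_def \<alpha>(2))
    ultimately show ?thesis using neg by blast
  qed
qed

text \<open>The two halves of the lifting property, when the base point is moved across a wall.\<close>

lemma base_change_up:
  assumes "adjacent b b' \<alpha> k" "below (seen_from b) Z Z'"
    and "below (seen_from b') C Z" "below (seen_from b') C (rfl \<alpha> k ` Z)"
  shows "below (seen_from b') C Z' \<and> below (seen_from b') C (rfl \<alpha> k ` Z')"
  using assms(2)
proof (induction rule: rtranclp_induct)
  case (step Z' Z'')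
  have \<alpha>: "\<alpha> \<in> R" using assms(1) by (auto simp: adjacent_def)
  show ?case using adjacent_step[OF assms(1) step.hyps(2)] step.IH refl_image_image[OF \<alpha>]
    by (metis rtranclp.rtrancl_into_rtrancl)
qed (use assms in simp)

lemma base_change_down:
  assumes "adjacent b b' \<alpha> k" "below (seen_from b) Z' Z"
    and "below (seen_from b') Z Y" "below (seen_from b') (rfl \<alpha> k ` Z) Y"
  shows "below (seen_from b') Z' Y \<and> below (seen_from b') (rfl \<alpha> k ` Z') Y"
  using assms(2)
proof (induction rule: converse_rtranclp_induct)
  case (step Z'' Z')
  have \<alpha>: "\<alpha> \<in> R" using assms(1) by (auto simp: adjacent_def)
  show ?case using adjacent_step[OF assms(1) step.hyps(1)] step.IH refl_image_image[OF \<alpha>]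
    by (metis converse_rtranclp_into_rtranclp)
qed (use assms in simp)

section \<open>Faces, and the passage from the semi-infinite order to the Bruhat order\<close>

text \<open>Covers the base alcove and its vertices alike, so that comparisons are proved once for
  both.\<close>

definition is_face :: "'v set \<Rightarrow> bool" where
  "is_face F \<longleftrightarrow> F \<subseteq> closed_alcove \<and>
     (\<forall>\<alpha>\<in>R. \<forall>k. (\<forall>y\<in>F. aroot \<alpha> k y = 0) \<or> (\<forall>y\<in>F. aroot \<alpha> k y \<noteq> 0))"

lemma base_alcove_sub: "base_alcove D \<subseteq> closed_alcove"
  using closure_base_alcove closure_subset by metis

lemma base_alcove_face: "is_face (base_alcove D)"
  unfolding is_face_def using base_alcove_sub
  by (metis aroot_same_sign base_point_in less_numeral_extra(3) mult_zero_left)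

lemma face_sides:
  assumes "is_face F" "g \<in> symmetries" "\<alpha> \<in> R"
  shows "(\<forall>y\<in>g ` F. aroot \<alpha> k y = 0) \<or> (\<forall>y\<in>g ` F. aroot \<alpha> k y * aroot \<alpha> k (g base_point) > 0)"
proof -
  obtain \<beta> l where \<beta>: "\<beta> \<in> R" "\<And>x. aroot \<alpha> k (g x) = aroot \<beta> l x"
    using pull_root[OF assms(2,3)] by metis
  show ?thesis
  proof (cases "\<forall>y\<in>F. aroot \<beta> l y = 0")
    case False
    then have "\<forall>y\<in>F. aroot \<beta> l y \<noteq> 0" using assms(1) \<beta>(1) unfolding is_face_def by blast
    moreover have "\<forall>y\<in>F. aroot \<beta> l y * aroot \<beta> l base_point \<ge> 0"
      using assms(1) \<beta>(1) unfolding is_face_def closed_alcove_def by blast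
    ultimately have "\<forall>y\<in>F. aroot \<beta> l y * aroot \<beta> l base_point > 0"
      using aroot_base_point_nonzero[OF \<beta>(1), of l] by (simp add: order_le_less)
    then show ?thesis by (simp add: \<beta>(2))
  qed (simp add: \<beta>(2))
qed

lemma alcove_side:
  assumes "g \<in> symmetries" "\<alpha> \<in> R" "y \<in> g ` base_alcove D"
  shows "aroot \<alpha> k y * aroot \<alpha> k (g base_point) > 0"
  using face_sides[OF base_alcove_face assms(1,2), of k] aroot_base_point_sym[OF assms(1,2), of k]
    assms(3) base_point_in by blast

text \<open>Provides the second premise of \<open>base_change_up\<close>. A face inside the wall is
  fixed by the reflection, and then the empty chain suffices.\<close>

lemma face_near_side:
  assumes "is_face F" "g \<in> symmetries" "adjacent b b' \<alpha> k"
    "aroot \<alpha> k (g base_point) * aroot \<alpha> k b > 0"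
  shows "below (seen_from b) (g ` F) (rfl \<alpha> k ` g ` F)"
proof -
  have \<alpha>: "\<alpha> \<in> R" using assms(3) by (simp add: adjacent_def)
  from face_sides[OF assms(1,2) \<alpha>] show ?thesis
  proof
    assume "\<forall>y\<in>g ` F. aroot \<alpha> k y = 0"
    then have "rfl \<alpha> k ` g ` F = g ` F" using refl_fixed by (auto simp: image_iff)
    then show ?thesis by simp
  next
    assume "\<forall>y\<in>g ` F. aroot \<alpha> k y * aroot \<alpha> k (g base_point) > 0"
    then have "step (seen_from b) (g ` F) (rfl \<alpha> k ` g ` F)"
      unfolding step_def seen_from_def using \<alpha> assms(4) mult_pos_trans(1) by blast
    then show ?thesis by blast
  qed
qed

text \<open>The side condition on \<open>g\<close> is what \<open>face_near_side\<close> needs at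
  each wall, and it persists because the separating hyperplanes of the next base point are among the
  old ones.\<close>

lemma gallery:
  assumes "u \<in> Wa" "is_face F" "g \<in> symmetries"
    "\<And>\<alpha> k. \<alpha> \<in> R \<Longrightarrow> aroot \<alpha> k (u base_point) * aroot \<alpha> k base_point < 0 \<Longrightarrow>
      aroot \<alpha> k (g base_point) * aroot \<alpha> k base_point > 0"
    "below (seen_from (u base_point)) (g ` F) Y"
  shows "below (seen_from base_point) (g ` F) Y"
  using assms(1,4,5)
proof (induction "separation (u base_point) base_point" arbitrary: u rule: less_induct)
  case less
  show ?case
  proof (cases "u = id")
    case True
    then show ?thesis using less.prems(3) by simp
  next
    case False
    then obtain \<alpha>\<^sub>0 k\<^sub>0 where "\<alpha>\<^sub>0 \<in> R" "aroot \<alpha>\<^sub>0 k\<^sub>0 (u base_point) * aroot \<alpha>\<^sub>0 k\<^sub>0 base_point < 0"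
      using Wa_free[OF less.prems(1)] by (metis mult.commute)
    from separating_adjacent[OF Wa_symmetries[OF less.prems(1)] this]
    obtain s \<alpha> k where s: "s \<in> S" "adjacent (u base_point) (u (s base_point)) \<alpha> k"
      "aroot \<alpha> k (u base_point) * aroot \<alpha> k base_point < 0" by metis
    have \<alpha>: "\<alpha> \<in> R" using s(2) by (simp add: adjacent_def)
    have "aroot \<alpha> k (g base_point) * aroot \<alpha> k base_point > 0" using less.prems(2) \<alpha> s(3) by blast
    moreover have "aroot \<alpha> k (u (s base_point)) = - aroot \<alpha> k (u base_point)"
      using s(2) aroot_refl[OF \<alpha>] by (simp add: adjacent_def)
    then have "aroot \<alpha> k base_point * aroot \<alpha> k (u (s base_point)) > 0"
      using s(3) by (simp add: mult.commute)
    ultimately have "aroot \<alpha> k (g base_point) * aroot \<alpha> k (u (s base_point)) > 0"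
      by (rule mult_pos_trans(1))
    then have "below (seen_from (u (s base_point))) (g ` F) (rfl \<alpha> k ` g ` F)"
      using face_near_side[OF assms(2,3) adjacent_sym[OF s(2)]] by blast
    then have "below (seen_from (u (s base_point))) (g ` F) Y"
      using base_change_up[OF s(2) less.prems(3) rtranclp.rtrancl_refl] by blast
    moreover have "u \<circ> s \<in> Wa" using less.prems(1) s(1) Wa_comp Wa_simple by blast
    moreover have "aroot \<beta> l (g base_point) * aroot \<beta> l base_point > 0"
      if "\<beta> \<in> R" "aroot \<beta> l (u (s base_point)) * aroot \<beta> l base_point < 0" for \<beta> l
      using adjacent_closer[OF s(2,3)] less.prems(2) that by blast
    ultimately show ?thesis
      using less.hyps[of "u \<circ> s"] separation_adjacent[OF s(2,3)] by simp
  qed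
qed

lemma seen_from_cong:
  assumes "\<And>\<alpha> k. \<alpha> \<in> R \<Longrightarrow> aroot \<alpha> k b * aroot \<alpha> k b' > 0"
  shows "below (seen_from b) Y X \<Longrightarrow> below (seen_from b') Y X"
proof (induction rule: rtranclp_induct)
  case (step X Z)
  have "step (seen_from b') X Z"
    using step.hyps(2) assms mult_pos_trans(1) unfolding step_def seen_from_def by blast
  then show ?case using step.IH by simp
qed simp

text \<open>A chain has finitely many steps, and for each of them the base point eventually passes
  to the side prescribed by \<open>- pr \<alpha> d\<close>.\<close>

lemma against_imp_seen_from:
  assumes "below (against d) Y X"
  shows "\<forall>\<^sub>F n in sequentially. below (seen_from (base_point - real n *\<^sub>R d)) Y X"
  using assms
proof (induction rule: rtranclp_induct)
  case (step X Z)
  then obtain \<alpha> k where \<alpha>: "\<alpha> \<in> R" "Z = rfl \<alpha> k ` X" "\<forall>y\<in>X. aroot \<alpha> k y * - pr \<alpha> d > 0"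
    unfolding step_def against_def by auto
  have "\<forall>\<^sub>F n in sequentially. step (seen_from (base_point - real n *\<^sub>R d)) X Z"
  \<comment> \<open>A step must be strict at every point, so a vanishing pairing with
    \<open>d\<close> leaves only the empty set.\<close>
  proof (cases "pr \<alpha> d = 0")
    case True
    then have "X = {}" using \<alpha>(3) by auto
    then have "step \<sigma> X Z" for \<sigma> unfolding step_def using \<alpha> by blast
    then show ?thesis by simp
  next
    case False
    define N where "N = nat \<lceil>\<bar>aroot \<alpha> k base_point\<bar> / \<bar>pr \<alpha> d\<bar>\<rceil> + 1"
    have "step (seen_from (base_point - real n *\<^sub>R d)) X Z" if "n \<ge> N" for n
    proof -
      have "real n > \<bar>aroot \<alpha> k base_point\<bar> / \<bar>pr \<alpha> d\<bar>" using that unfolding N_def by linarith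
      then have n: "\<bar>aroot \<alpha> k base_point\<bar> < real n * \<bar>pr \<alpha> d\<bar>"
        using False by (simp add: pos_divide_less_eq)
      have "aroot \<alpha> k (base_point - real n *\<^sub>R d) = aroot \<alpha> k base_point - real n * pr \<alpha> d"
        by (simp add: affine_root_def pairing_simps)
      then have "- pr \<alpha> d * aroot \<alpha> k (base_point - real n *\<^sub>R d) > 0"
        using n False by (cases "pr \<alpha> d > 0") (auto simp: zero_less_mult_iff mult_less_0_iff)
      then show ?thesis
        unfolding step_def seen_from_def using \<alpha> mult_pos_trans(1) by blast
    qed
    then show ?thesis unfolding eventually_sequentially by blast
  qed
  then show ?case using step.IH
    by eventually_elim (rule rtranclp.rtrancl_into_rtrancl)
qed simp

text \<open>Integrality of \<open>d\<close> places the far base point in the alcove of some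
  \<open>u\<close>. A hyperplane between it and the base point is crossed in the direction
  \<open>- d\<close>, and by \<open>pos\<close> the displacement under \<open>g\<close> never goes
  that way, so \<open>gallery\<close> applies.\<close>

lemma against_imp_bruhat:
  assumes "below (against d) (g ` F) Y" "is_face F" "g \<in> symmetries"
    and d: "\<And>\<alpha>. \<alpha> \<in> R \<Longrightarrow> pr \<alpha> d \<in> \<int>"
    and pos: "\<And>\<alpha>. \<alpha> \<in> R \<Longrightarrow> pr \<alpha> d > 0 \<Longrightarrow> pr \<alpha> (g base_point - base_point) \<ge> 0"
  shows "below (seen_from base_point) (g ` F) Y"
proof -
  obtain n :: nat where n: "below (seen_from (base_point - real n *\<^sub>R d)) (g ` F) Y"
    using against_imp_seen_from[OF assms(1)] unfolding eventually_sequentially by blast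
  let ?b = "base_point - real n *\<^sub>R d"
  have "transl (- (real n *\<^sub>R d)) \<in> symmetries"
    using d by (intro transl_symmetry) (auto simp: pairing_simps)
  then have b: "aroot \<alpha> k ?b \<noteq> 0" if "\<alpha> \<in> R" for \<alpha> k
    using aroot_base_point_sym[of "transl (- (real n *\<^sub>R d))" \<alpha> k] that by (simp add: transl_def)
  obtain u where u: "u \<in> Wa" "\<And>\<alpha> k. \<alpha> \<in> R \<Longrightarrow> \<not> aroot \<alpha> k (u base_point) * aroot \<alpha> k ?b < 0"
    using generated_transitive[OF simple.generated_id] Wa_generated_simple by blast
  have sgn: "aroot \<alpha> k ?b * aroot \<alpha> k (u base_point) > 0" if "\<alpha> \<in> R" for \<alpha> k
    using u(2)[OF that, of k] b[OF that, of k] aroot_base_point_sym[OF Wa_symmetries[OF u(1)] that, of k]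
    by (simp add: mult.commute not_less order_le_less)
  have "aroot \<alpha> k (g base_point) * aroot \<alpha> k base_point > 0"
    if \<alpha>: "\<alpha> \<in> R" "aroot \<alpha> k (u base_point) * aroot \<alpha> k base_point < 0" for \<alpha> k
  proof -
    have sep: "aroot \<alpha> k ?b * aroot \<alpha> k base_point < 0"
      using mult_pos_trans(2)[OF sgn[OF \<alpha>(1)] \<alpha>(2)] .
    have bb: "aroot \<alpha> k ?b = aroot \<alpha> k base_point - real n * pr \<alpha> d"
      and gg: "aroot \<alpha> k (g base_point) = aroot \<alpha> k base_point + pr \<alpha> (g base_point - base_point)"
      by (simp_all add: affine_root_def pairing_simps)
    consider "pr \<alpha> d > 0" | "pr \<alpha> d < 0" | "pr \<alpha> d = 0" by linarith
    then show ?thesis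
    proof cases
      case 1
      then have "real n * pr \<alpha> d \<ge> 0" by simp
      then have "aroot \<alpha> k base_point > 0" using sep bb by (auto simp: mult_less_0_iff)
      then show ?thesis using pos[OF \<alpha>(1) 1] gg by simp
    next
      case 2
      then have "real n * pr \<alpha> d \<le> 0" by (simp add: mult_le_0_iff)
      then have "aroot \<alpha> k base_point < 0" using sep bb by (auto simp: mult_less_0_iff)
      moreover have "pr \<alpha> (g base_point - base_point) \<le> 0"
        using pos[OF minus_root[OF \<alpha>(1)]] 2 by (simp add: pairing_simps)
      ultimately show ?thesis using gg by (simp add: mult_neg_neg)
    next
      case 3
      then show ?thesis using sep bb by (auto simp: mult_less_0_iff)
    qed
  qed
  then show ?thesis
    using gallery[OF u(1) assms(2,3) _ seen_from_cong[OF sgn n]] by blast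
qed

text \<open>Two reflections compose to a translation by a multiple of the coroot.\<close>

lemma below_against_translate:
  fixes m :: int
  assumes "\<alpha> \<in> R" "pr \<alpha> d > 0" "\<And>y. y \<in> X \<Longrightarrow> real_of_int m < pr \<alpha> y \<and> pr \<alpha> y < real_of_int m + 1"
  shows "below (against d) X (transl (real n *\<^sub>R cr \<alpha>) ` X)"
proof (cases "n = 0")
  case True
  have "transl (0 :: 'v) = id" by (rule ext) (simp add: transl_def)
  then show ?thesis using True by simp
next
  case False
  \<comment> \<open>The first mirror is the upper edge of the strip, where \<open>\<alpha>\<close>
    takes the value \<open>m + 1\<close>; the second one is \<open>n\<close> units higher. For
    \<open>n \<ge> 1\<close> the reflected set still lies below the second mirror.\<close>
  let ?X = "rfl \<alpha> (- (m + 1)) ` X"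
  have *: "step (against d) Y (rfl \<alpha> k ` Y)" if "\<forall>y\<in>Y. aroot \<alpha> k y < 0" for Y k
    unfolding step_def against_def using assms(1,2) that
    by (intro bexI[of _ \<alpha>] exI[of _ k]) (auto simp: mult_neg_pos)
  have "step (against d) X ?X"
    using assms(3) by (intro *) (fastforce simp: affine_root_def)
  moreover have "step (against d) ?X (rfl \<alpha> (- (m + 1 + int n)) ` ?X)"
  proof (rule *, clarify)
    fix y assume "y \<in> X"
    then have "real_of_int m < pr \<alpha> y" using assms(3) by blast
    then show "aroot \<alpha> (- (m + 1 + int n)) (rfl \<alpha> (- (m + 1)) y) < 0"
      using False coroot_two[OF assms(1)]
      by (simp add: affine_root_def affine_reflection_def pairing_simps)
  qed
  moreover have "rfl \<alpha> (- (m + 1 + int n)) (rfl \<alpha> (- (m + 1)) y) = transl (real n *\<^sub>R cr \<alpha>) y" for y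
    using coroot_two[OF assms(1)]
    by (simp add: affine_root_def affine_reflection_def pairing_simps transl_def algebra_simps)
  then have "rfl \<alpha> (- (m + 1 + int n)) ` ?X = transl (real n *\<^sub>R cr \<alpha>) ` X"
    by (simp add: image_image)
  ultimately show ?thesis by (metis converse_rtranclp_into_rtranclp r_into_rtranclp)
qed

section \<open>The finite Weyl group\<close>

lemma cocharacters_closed:
  "x \<in> cocharacters D \<Longrightarrow> y \<in> cocharacters D \<Longrightarrow> x + real_of_int n *\<^sub>R y \<in> cocharacters D"
  using full_lattice_closed[of "cocharacters D"] based by (simp only: based_reduced_root_datum_def)

lemma refl_linear: "rfl \<alpha> 0 (x + y) = rfl \<alpha> 0 x + rfl \<alpha> 0 y"
  by (simp add: affine_reflection_def affine_root_def pairing_simps algebra_simps)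

lemma refl_cocharacters: "\<alpha> \<in> R \<Longrightarrow> y \<in> cocharacters D \<Longrightarrow> rfl \<alpha> 0 y \<in> cocharacters D"
proof -
  assume *: "\<alpha> \<in> R" "y \<in> cocharacters D"
  then obtain n :: int where "pr \<alpha> y = real_of_int n"
    using pairing_int roots_characters by (meson Ints_cases)
  then show ?thesis
    using cocharacters_closed[OF *(2) coroot_cocharacters[OF *(1)], of "- n"]
    by (simp add: affine_reflection_def affine_root_def)
qed

lemma W_properties:
  assumes "w \<in> W"
  shows W_Wa: "w \<in> Wa"
    and W_add: "w (x + y) = w x + w y"
    and W_pull: "\<alpha> \<in> R \<Longrightarrow> \<exists>\<beta>\<in>R. \<forall>x. pr \<alpha> (w x) = pr \<beta> x"
    and W_equivariant: "equivariant w d (w d)"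
    and W_cocharacters: "y \<in> cocharacters D \<Longrightarrow> w y \<in> cocharacters D"
proof -
  have "w \<in> Wa \<and> (\<forall>x y. w (x + y) = w x + w y) \<and> (\<forall>\<alpha>\<in>R. \<exists>\<beta>\<in>R. \<forall>x. pr \<alpha> (w x) = pr \<beta> x) \<and>
    (\<forall>d. equivariant w d (w d)) \<and> (\<forall>y\<in>cocharacters D. w y \<in> cocharacters D)"
    using assms unfolding weyl_group_def
  proof (induction w rule: linear.generated_induct)
    case id
    show ?case using Wa_id equivariant_id by (auto simp: id_def)
  next
    case (step s h)
    then obtain \<gamma> where \<gamma>: "\<gamma> \<in> R" "s = rfl \<gamma> 0" by blast
    have pull: "\<exists>\<beta>\<in>R. \<forall>x. pr \<alpha> (s (h x)) = pr \<beta> x" if \<alpha>: "\<alpha> \<in> R" for \<alpha>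
    proof -
      have s: "pr \<alpha> (s x) = pr (\<alpha> - pr \<alpha> (cr \<gamma>) *\<^sub>R \<gamma>) x" for x
        by (simp add: \<gamma>(2) affine_reflection_def affine_root_def pairing_simps)
      show ?thesis using step.IH root_refl_in[OF \<gamma>(1) \<alpha>] by (simp only: s)
    qed
    have eq: "equivariant (s \<circ> h) d ((s \<circ> h) d)" for d
      using equivariant_comp[of h d "h d" s "s (h d)"] equivariant_refl[OF \<gamma>(1)] step.IH \<gamma>(2)
      by (simp only: comp_apply)
    have "s \<circ> h \<in> Wa" using step.IH Wa_comp Wa_refl \<gamma> by blast
    moreover have "\<forall>x y. (s \<circ> h) (x + y) = (s \<circ> h) x + (s \<circ> h) y"
      using step.IH by (simp add: \<gamma>(2) refl_linear)
    moreover have "\<forall>\<alpha>\<in>R. \<exists>\<beta>\<in>R. \<forall>x. pr \<alpha> ((s \<circ> h) x) = pr \<beta> x"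
      using pull unfolding comp_apply by blast
    moreover have "\<forall>d. equivariant (s \<circ> h) d ((s \<circ> h) d)" using eq by (rule allI)
    moreover have "\<forall>y\<in>cocharacters D. (s \<circ> h) y \<in> cocharacters D"
      using step.IH refl_cocharacters[OF \<gamma>(1)] by (simp add: \<gamma>(2))
    ultimately show ?case by (intro conjI)
  qed
  then show "w \<in> Wa" "w (x + y) = w x + w y" "\<alpha> \<in> R \<Longrightarrow> \<exists>\<beta>\<in>R. \<forall>x. pr \<alpha> (w x) = pr \<beta> x"
    "equivariant w d (w d)" "y \<in> cocharacters D \<Longrightarrow> w y \<in> cocharacters D"
    by blast+
qed

lemma W_comp: "g \<in> W \<Longrightarrow> h \<in> W \<Longrightarrow> g \<circ> h \<in> W"
  and W_inv: "g \<in> W \<Longrightarrow> inv_into UNIV g \<in> W"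
  and W_id: "id \<in> W"
  and W_refl: "\<alpha> \<in> R \<Longrightarrow> rfl \<alpha> 0 \<in> W"
  unfolding weyl_group_def
  using linear.generated_comp linear.generated_inv linear.generated_id
    linear.generated_base by blast+

lemma W_rho:
  assumes "w \<in> W" "\<alpha> \<in> R"
  shows "pr \<alpha> (w rho) \<in> \<int>" "pr \<alpha> (w rho) \<noteq> 0"
  using W_pull[OF assms] rho_int rho_nonzero by force+

section \<open>An invariant form and the choice of a chamber\<close>

text \<open>Invariant because reflections permute the roots; only semidefinite, with the vectors
  orthogonal to all roots as radical.\<close>

definition root_form :: "'v \<Rightarrow> 'v \<Rightarrow> real" where
  "root_form x y = (\<Sum>\<beta>\<in>R. pr \<beta> x * pr \<beta> y)"

lemma root_form_refl:
  assumes \<alpha>: "\<alpha> \<in> R"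
  shows "root_form (rfl \<alpha> 0 x) (rfl \<alpha> 0 y) = root_form x y"
proof -
  let ?s = "\<lambda>\<beta>. \<beta> - pr \<beta> (cr \<alpha>) *\<^sub>R \<alpha>"
  have ss: "?s (?s \<beta>) = \<beta>" for \<beta>
    using coroot_two[OF \<alpha>] by (simp add: pairing_simps algebra_simps flip: scaleR_add_left)
  have p: "pr \<beta> (rfl \<alpha> 0 x) = pr (?s \<beta>) x" for \<beta> x
    by (simp add: affine_reflection_def affine_root_def pairing_simps)
  show ?thesis
    unfolding root_form_def p
    by (rule sum.reindex_bij_witness[of _ ?s ?s]) (use root_refl_in[OF \<alpha>] ss in auto)
qed

text \<open>Invariance under the reflection that negates \<open>cr \<alpha>\<close>. It lets the
  sign of a root at \<open>y\<close> be read from the form.\<close>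

lemma root_form_coroot:
  assumes \<alpha>: "\<alpha> \<in> R"
  shows "2 * root_form (cr \<alpha>) y = pr \<alpha> y * root_form (cr \<alpha>) (cr \<alpha>)"
proof -
  have "root_form (cr \<alpha>) y = root_form (rfl \<alpha> 0 (cr \<alpha>)) (rfl \<alpha> 0 y)"
    using root_form_refl[OF \<alpha>] by simp
  also have "\<dots> = - (root_form (cr \<alpha>) y - pr \<alpha> y * root_form (cr \<alpha>) (cr \<alpha>))"
    using coroot_two[OF \<alpha>]
    by (simp add: root_form_def affine_reflection_def affine_root_def pairing_simps
        sum_distrib_left sum_subtractf[symmetric] sum_negf[symmetric] algebra_simps)
  finally show ?thesis by simp
qed

text \<open>The chamber of \<open>w\<close> contains \<open>e\<close> as soon as \<open>w\<close> maximizes the value of the invariant form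
  at \<open>w rho\<close> and \<open>e\<close>.\<close>

lemma chamber_exists: "\<exists>w\<in>W. \<forall>\<alpha>\<in>R. pr \<alpha> (w rho) > 0 \<longrightarrow> pr \<alpha> e \<ge> 0"
proof -
  define v where "v w = root_form (w rho) e" for w
  \<comment> \<open>A maximum exists without knowing that \<open>W\<close> is finite: the roots take
    at \<open>w rho\<close> only values that some root takes at \<open>rho\<close>.\<close>
  have "v ` W \<subseteq> (\<lambda>h. \<Sum>\<beta>\<in>R. h \<beta> * pr \<beta> e) ` (R \<rightarrow>\<^sub>E (\<lambda>\<gamma>. pr \<gamma> rho) ` R)"
  proof
    fix x assume "x \<in> v ` W"
    then obtain w where w: "w \<in> W" "x = v w" by blast
    have "(\<lambda>\<beta>\<in>R. pr \<beta> (w rho)) \<in> R \<rightarrow>\<^sub>E (\<lambda>\<gamma>. pr \<gamma> rho) ` R"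
      using W_pull[OF w(1)] by fastforce
    moreover have "x = (\<Sum>\<beta>\<in>R. (\<lambda>\<beta>\<in>R. pr \<beta> (w rho)) \<beta> * pr \<beta> e)"
      by (simp add: w(2) v_def root_form_def)
    ultimately show "x \<in> (\<lambda>h. \<Sum>\<beta>\<in>R. h \<beta> * pr \<beta> e) ` (R \<rightarrow>\<^sub>E (\<lambda>\<gamma>. pr \<gamma> rho) ` R)" by blast
  qed
  then have fin: "finite (v ` W)"
    by (rule finite_subset) (simp add: finite_PiE finite_roots)
  moreover have "v ` W \<noteq> {}" using W_id by blast
  ultimately have "Max (v ` W) \<in> v ` W" by simp
  then obtain w where w: "w \<in> W" "v w = Max (v ` W)" by auto
  then have max: "v w' \<le> v w" if "w' \<in> W" for w' using fin that by simp
  have "pr \<alpha> e \<ge> 0" if \<alpha>: "\<alpha> \<in> R" "pr \<alpha> (w rho) > 0" for \<alpha>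
  proof (rule ccontr)
    assume "\<not> pr \<alpha> e \<ge> 0"
    have "rfl \<alpha> 0 \<circ> w \<in> W" using \<alpha>(1) w(1) W_comp W_refl by blast
    then have "v (rfl \<alpha> 0 \<circ> w) \<le> v w" by (rule max)
    moreover have "v (rfl \<alpha> 0 \<circ> w) = v w - pr \<alpha> (w rho) * root_form (cr \<alpha>) e"
      by (simp add: v_def root_form_def affine_reflection_def affine_root_def pairing_simps
          sum_distrib_left sum_subtractf[symmetric] algebra_simps)
    ultimately have "pr \<alpha> (w rho) * root_form (cr \<alpha>) e \<ge> 0" by simp
    then have "root_form (cr \<alpha>) e \<ge> 0" using \<alpha>(2) by (simp add: zero_le_mult_iff)
    moreover have "0 < root_form (cr \<alpha>) (cr \<alpha>)"
    proof -
      have "(\<Sum>\<beta>\<in>{\<alpha>}. pr \<beta> (cr \<alpha>) * pr \<beta> (cr \<alpha>)) \<le> root_form (cr \<alpha>) (cr \<alpha>)"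
        unfolding root_form_def using \<alpha>(1) finite_roots by (intro sum_mono2) auto
      then show ?thesis using coroot_two[OF \<alpha>(1)] by simp
    qed
    ultimately show False
      using root_form_coroot[OF \<alpha>(1), of e] \<open>\<not> pr \<alpha> e \<ge> 0\<close>
      by (metis mult_neg_pos mult_nonneg_nonneg not_le zero_le_numeral)
  qed
  then show ?thesis using w(1) by blast
qed

section \<open>Sides with respect to a Weyl chamber\<close>

text \<open>A positive root is a nonnegative integral combination of simple roots with some nonzero
  coefficient, so at depth \<open>\<bar>k\<bar> + 1\<close> the constant \<open>k\<close> cannot
  change its sign.\<close>

lemma deep_chamber_plus:
  assumes "w \<in> W" "\<alpha> \<in> R" "x \<in> deep_chamber D w (\<bar>real_of_int k\<bar> + 1)"
  shows "aroot \<alpha> k x * pr \<alpha> (w rho) > 0"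
proof -
  obtain y where y: "x = w y" "\<And>\<gamma>. \<gamma> \<in> simple_roots D \<Longrightarrow> pr \<gamma> y > \<bar>real_of_int k\<bar> + 1"
    using assms(3) by (auto simp: deep_chamber_def)
  obtain \<beta> where \<beta>: "\<beta> \<in> R" "\<And>x. pr \<alpha> (w x) = pr \<beta> x" using W_pull[OF assms(1,2)] by blast
  have *: "pr \<gamma> y \<ge> \<bar>real_of_int k\<bar> + 1" if \<gamma>: "\<gamma> \<in> positive_roots D" for \<gamma>
  proof -
    obtain c :: "'u \<Rightarrow> nat" where c: "\<And>x. pr \<gamma> x = (\<Sum>\<delta>\<in>simple_roots D. real (c \<delta>) * pr \<delta> x)"
      using positive_combination[OF \<gamma>] by blast
    have "pr \<gamma> y \<ge> (\<Sum>\<delta>\<in>simple_roots D. real (c \<delta>) * (\<bar>real_of_int k\<bar> + 1))"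
      unfolding c using y(2) by (intro sum_mono mult_left_mono) (auto intro: order_less_imp_le)
    moreover have "pr \<gamma> rho = (\<Sum>\<delta>\<in>simple_roots D. real (c \<delta>))" using c[of rho] by (simp add: rho_simple)
    moreover have "pr \<gamma> rho \<ge> 1" using positive_rho[OF \<gamma>] by (auto elim!: Ints_cases)
    ultimately have "pr \<gamma> y \<ge> pr \<gamma> rho * (\<bar>real_of_int k\<bar> + 1)" by (simp only: sum_distrib_right)
    moreover have "pr \<gamma> rho * (\<bar>real_of_int k\<bar> + 1) \<ge> 1 * (\<bar>real_of_int k\<bar> + 1)"
      using \<open>pr \<gamma> rho \<ge> 1\<close> by (intro mult_right_mono) auto
    ultimately show ?thesis by simp
  qed
  have "aroot \<alpha> k x = pr \<beta> y + real_of_int k" by (simp add: affine_root_def y(1) \<beta>(2))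
  moreover have "pr \<beta> y \<ge> \<bar>real_of_int k\<bar> + 1 \<and> pr \<beta> rho > 0 \<or> - pr \<beta> y \<ge> \<bar>real_of_int k\<bar> + 1 \<and> pr \<beta> rho < 0"
    using positive_or_negative[OF \<beta>(1)] *[of \<beta>] *[of "- \<beta>"] positive_rho(2)[of \<beta>] positive_rho(2)[of "- \<beta>"]
    by (auto simp: pairing_simps)
  ultimately show ?thesis
  proof (elim disjE conjE)
    assume "pr \<beta> y \<ge> \<bar>real_of_int k\<bar> + 1" "pr \<beta> rho > 0" "aroot \<alpha> k x = pr \<beta> y + real_of_int k"
    then show ?thesis by (auto simp: \<beta>(2) intro!: mult_pos_pos)
  next
    assume "- pr \<beta> y \<ge> \<bar>real_of_int k\<bar> + 1" "pr \<beta> rho < 0" "aroot \<alpha> k x = pr \<beta> y + real_of_int k"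
    then show ?thesis by (auto simp: \<beta>(2) intro!: mult_neg_neg)
  qed
qed

text \<open>If no alcove lay beyond some depth, the condition in \<open>plus_side\<close> would hold
  vacuously for both sides.\<close>

lemma deep_alcove:
  assumes "w \<in> W"
  shows "\<exists>A\<in>alcoves D. A \<noteq> {} \<and> A \<subseteq> deep_chamber D w N"
proof -
  define n where "n = nat \<lceil>\<bar>N\<bar>\<rceil> + 1"
  define x where "x = w (transl (real n *\<^sub>R rho) base_point)"
  let ?U = "- (\<Union>\<alpha>\<in>R. \<Union>k. hyperplane D \<alpha> k)"
  have "transl (real n *\<^sub>R rho) \<in> symmetries"
    by (intro transl_symmetry) (auto simp: pairing_simps rho_int)
  then have "w \<circ> transl (real n *\<^sub>R rho) \<in> symmetries"
    using symmetries_comp Wa_symmetries W_Wa[OF assms] by blast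
  then have x: "aroot \<alpha> k x \<noteq> 0" if "\<alpha> \<in> R" for \<alpha> k
    using aroot_base_point_sym[of "w \<circ> transl (real n *\<^sub>R rho)" \<alpha> k] that by (simp add: x_def)
  then have xU: "x \<in> ?U" by (auto simp: hyperplane_def)
  let ?A = "connected_component_set ?U x"
  have "?A \<in> alcoves D" unfolding alcoves_def components_def using xU by (rule imageI)
  moreover have "x \<in> ?A" using xU by (simp only: connected_component_refl mem_Collect_eq)
  then have "?A \<noteq> {}" by (metis empty_iff)
  moreover have "?A \<subseteq> deep_chamber D w N"
  proof
    fix y assume y: "y \<in> ?A"
    then obtain T where T: "connected T" "T \<subseteq> ?U" "x \<in> T" "y \<in> T"
      by (auto simp: connected_component_def)
    \<comment> \<open>A connected set that avoids all hyperplanes cannot change the sign of an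
      affine root.\<close>
    have sgn: "aroot \<alpha> k y > 0" if \<alpha>: "\<alpha> \<in> R" "aroot \<alpha> k x > 0" for \<alpha> k
    proof (rule ccontr)
      assume "\<not> aroot \<alpha> k y > 0"
      moreover have "connected (aroot \<alpha> k ` T)"
        using T(1) continuous_aroot continuous_on_subset by (blast intro: connected_continuous_image)
      ultimately have "0 \<in> aroot \<alpha> k ` T"
        using T(3,4) \<alpha>(2) connectedD_interval[of "aroot \<alpha> k ` T" "aroot \<alpha> k y" "aroot \<alpha> k x" 0] by auto
      then show False using T(2) \<alpha>(1) by (auto simp: hyperplane_def)
    qed
    let ?z = "inv_into UNIV w y"
    have bij: "bij w" using Wa_bij W_Wa[OF assms] by blast
    have "pr \<gamma> ?z > N" if \<gamma>: "\<gamma> \<in> simple_roots D" for \<gamma>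
    proof -
      have \<gamma>R: "\<gamma> \<in> R" using \<gamma> simple_roots_sub by blast
      obtain \<alpha> where \<alpha>: "\<alpha> \<in> R" "\<And>x. pr \<gamma> (inv_into UNIV w x) = pr \<alpha> x"
        using W_pull[OF W_inv[OF assms] \<gamma>R] by blast
      have "\<gamma> \<in> positive_roots D" using \<gamma>R \<gamma> rho_simple by (simp add: positive_iff)
      then have "- 1 < pr \<gamma> base_point" using base_point_in by (simp add: base_alcove_def)
      moreover have "pr \<alpha> x = pr \<gamma> (transl (real n *\<^sub>R rho) base_point)"
        using \<alpha>(2)[of x] by (simp add: x_def bij bij_is_inj)
      then have "pr \<alpha> x = real n + pr \<gamma> base_point"
        by (simp add: transl_def pairing_simps rho_simple \<gamma>)
      \<comment> \<open>The base point costs less than one unit of depth. Expressed by an affine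
        root, the depth \<open>n - 1\<close> carries over to the whole component.\<close>
      ultimately have "aroot \<alpha> (1 - int n) x > 0" by (simp add: affine_root_def)
      then have "aroot \<alpha> (1 - int n) y > 0" by (rule sgn[OF \<alpha>(1)])
      then have "pr \<gamma> ?z > real n - 1" by (simp add: \<alpha>(2) affine_root_def)
      moreover have "real n - 1 \<ge> N" unfolding n_def by linarith
      ultimately show ?thesis by linarith
    qed
    moreover have "y = w ?z" using bij by (simp add: bij_is_surj surj_f_inv_f)
    ultimately show "y \<in> deep_chamber D w N"
      unfolding deep_chamber_def by (intro image_eqI[of _ _ ?z]) simp_all
  qed
  ultimately show ?thesis by (intro bexI[of _ ?A] conjI)
qed

lemma plus_side_eq:
  assumes "w \<in> W" "\<alpha> \<in> R"
  shows "plus_side D w \<alpha> k = {x. aroot \<alpha> k x * pr \<alpha> (w rho) > 0}"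
    and "minus_side D w \<alpha> k = {x. aroot \<alpha> k x * pr \<alpha> (w rho) < 0}"
proof -
  let ?P = "{x. aroot \<alpha> k x * pr \<alpha> (w rho) > 0}" and ?M = "{x. aroot \<alpha> k x * pr \<alpha> (w rho) < 0}"
  have sides: "sides D \<alpha> k = {?P, ?M}"
    using W_rho(2)[OF assms]
    by (cases "pr \<alpha> (w rho) > 0")
      (auto simp: sides_def zero_less_mult_iff mult_less_0_iff insert_commute)
  have sides_distinct: "?P \<noteq> ?M"
  proof
    assume "?P = ?M"
    moreover obtain A where "A \<noteq> {}" "A \<subseteq> deep_chamber D w (\<bar>real_of_int k\<bar> + 1)"
      using deep_alcove[OF assms(1)] by blast
    ultimately show False using deep_chamber_plus[OF assms] by fastforce
  qed
  show P: "plus_side D w \<alpha> k = ?P"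
    unfolding plus_side_def
  proof (rule the_equality)
    show "?P \<in> sides D \<alpha> k \<and> (\<exists>N. \<forall>A\<in>alcoves D. A \<subseteq> deep_chamber D w N \<longrightarrow> A \<subseteq> ?P)"
    proof (intro conjI exI ballI impI)
      fix A assume "A \<subseteq> deep_chamber D w (\<bar>real_of_int k\<bar> + 1)"
      then show "A \<subseteq> ?P" using deep_chamber_plus[OF assms] by auto
    qed (simp add: sides)
    fix X assume X: "X \<in> sides D \<alpha> k \<and> (\<exists>N. \<forall>A\<in>alcoves D. A \<subseteq> deep_chamber D w N \<longrightarrow> A \<subseteq> X)"
    then obtain N where N: "\<And>A. A \<in> alcoves D \<Longrightarrow> A \<subseteq> deep_chamber D w N \<Longrightarrow> A \<subseteq> X" by blast
    obtain A where A: "A \<in> alcoves D" "A \<noteq> {}" "A \<subseteq> deep_chamber D w (max N (\<bar>real_of_int k\<bar> + 1))"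
      using deep_alcove[OF assms(1)] by blast
    then have "A \<subseteq> deep_chamber D w N" "A \<subseteq> deep_chamber D w (\<bar>real_of_int k\<bar> + 1)"
      by (auto simp: deep_chamber_def)
    then have "A \<subseteq> X" "A \<subseteq> ?P" using N[OF A(1)] deep_chamber_plus[OF assms] by auto
    moreover have "?P \<inter> ?M = {}" by auto
    ultimately have "X \<noteq> ?M" using A(2) by blast
    then show "X = ?P" using X sides by blast
  qed
  show "minus_side D w \<alpha> k = ?M"
    unfolding minus_side_def P sides using sides_distinct by (intro the_equality) auto
qed

text \<open>A step in the opposite direction descends, so a path that starts at \<open>X\<close> is
  a chain for \<open>below\<close> read from its upper end.\<close>

lemma opposite_reach_eq:
  assumes "w \<in> W"
  shows "opposite_reach D X w = {Y. below (against (w rho)) Y X}"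
proof -
  have "opposite_step D w f g \<longleftrightarrow> step (against (w rho)) g f" for f g
  proof
    assume "opposite_step D w f g"
    then obtain \<alpha> k where \<alpha>: "\<alpha> \<in> R" "g = rfl \<alpha> k ` f" "g \<subseteq> minus_side D w \<alpha> k"
      unfolding opposite_step_def by blast
    then show "step (against (w rho)) g f"
      unfolding step_def against_def plus_side_eq[OF assms \<alpha>(1)]
      by (intro bexI[of _ \<alpha>] exI[of _ k]) auto
  next
    assume "step (against (w rho)) g f"
    then obtain \<alpha> k where \<alpha>: "\<alpha> \<in> R" "f = rfl \<alpha> k ` g" "\<forall>y\<in>g. aroot \<alpha> k y * - pr \<alpha> (w rho) > 0"
      unfolding step_def against_def by blast
    then show "opposite_step D w f g"
      unfolding opposite_step_def
      by (intro bexI[of _ \<alpha>] exI[of _ k])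
        (auto simp: plus_side_eq[OF assms \<alpha>(1)] aroot_refl)
  qed
  then have "opposite_step D w = (step (against (w rho)))\<inverse>\<inverse>" by (intro ext) simp
  then show ?thesis by (simp add: opposite_reach_def rtranclp_conversep)
qed

section \<open>Translations by the orbit of a dominant cocharacter\<close>

lemma alcove_strip:
  assumes "g \<in> symmetries" "\<alpha> \<in> R"
  obtains m :: int where "\<And>y. y \<in> g ` base_alcove D \<Longrightarrow> real_of_int m < pr \<alpha> y \<and> pr \<alpha> y < real_of_int m + 1"
proof -
  obtain \<beta> l where \<beta>: "\<beta> \<in> R" "\<And>x. aroot \<alpha> 0 (g x) = aroot \<beta> l x"
    using pull_root[OF assms] by metis
  then have p: "pr \<alpha> (g x) = pr \<beta> x + real_of_int l" for x by (simp add: affine_root_def)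
  show ?thesis
  proof (cases "pr \<beta> rho > 0")
    case True
    show ?thesis using True \<beta>(1) by (intro that[of "l - 1"]) (auto simp: p base_alcove_iff)
  next
    case False
    then have "- \<beta> \<in> R" "pr (- \<beta>) rho > 0"
      using \<beta>(1) rho_nonzero[of \<beta>] by (auto simp: minus_root pairing_simps)
    then have "0 < pr \<beta> x \<and> pr \<beta> x < 1" if "x \<in> base_alcove D" for x
      using that by (auto simp: base_alcove_iff pairing_simps)
    then show ?thesis by (intro that[of l]) (auto simp: p)
  qed
qed

lemma dominant_pos:
  assumes "\<mu> \<in> closure (dominant_chamber D)" "\<alpha> \<in> R" "pr \<alpha> rho > 0"
  shows "pr \<alpha> \<mu> \<ge> 0"
proof -
  have "dominant_chamber D \<subseteq> {x. aroot \<alpha> 0 x \<ge> 0}"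
  proof
    fix x assume x: "x \<in> dominant_chamber D"
    have "\<alpha> \<in> positive_roots D" using assms(2,3) by (simp add: positive_iff)
    then obtain c :: "'u \<Rightarrow> nat" where "\<And>x. pr \<alpha> x = (\<Sum>\<delta>\<in>simple_roots D. real (c \<delta>) * pr \<delta> x)"
      using positive_combination by blast
    moreover have "(\<Sum>\<delta>\<in>simple_roots D. real (c \<delta>) * pr \<delta> x) \<ge> 0" for c :: "'u \<Rightarrow> nat"
      using x by (intro sum_nonneg mult_nonneg_nonneg) (auto simp: dominant_chamber_def order_less_imp_le)
    ultimately show "x \<in> {x. aroot \<alpha> 0 x \<ge> 0}" by (simp add: affine_root_def)
  qed
  then have "closure (dominant_chamber D) \<subseteq> {x. aroot \<alpha> 0 x \<ge> 0}"
    by (rule closure_minimal) (rule closed_aroot)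
  then show ?thesis using assms(1) by (auto simp: affine_root_def)
qed

lemma transl_transl: "transl x ` transl y ` X = transl (x + y) ` X"
  by (simp add: image_image transl_def add.assoc)

lemma W_transl: "w \<in> W \<Longrightarrow> w ` transl y ` X = transl (w y) ` w ` X"
  by (simp add: image_image transl_def W_add)

lemma adjacent_minus:
  assumes "adjacent b b' \<alpha> k"
  shows "adjacent b b' (- \<alpha>) (- k)"
proof -
  have \<alpha>: "\<alpha> \<in> R" using assms by (simp add: adjacent_def)
  have "\<forall>\<beta>\<in>R. \<forall>l. aroot \<beta> l b * aroot \<beta> l b' \<le> 0 \<longrightarrow> \<beta> = - \<alpha> \<and> l = - k \<or> \<beta> = - (- \<alpha>) \<and> l = - (- k)"
    using assms unfolding adjacent_def minus_minus by blast
  then show ?thesis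
    using assms minus_root[OF \<alpha>] refl_minus[OF \<alpha>] by (simp add: adjacent_def aroot_minus)
qed

text \<open>Induction along a gallery of the finite Weyl group from \<open>v\<close> to the
  identity. Each crossing reflects \<open>v \<mu>\<close>, which by dominance adds a nonnegative
  multiple of the coroot of a positive root. The auxiliary \<open>h\<close> lets
  \<open>orbit_below\<close> carry the result to other chambers.\<close>

lemma orbit_below_dominant:
  assumes "v \<in> W" "h \<in> symmetries" "\<mu> \<in> cocharacters D" "\<mu> \<in> closure (dominant_chamber D)"
  shows "below (against rho) (transl (v \<mu>) ` h ` base_alcove D) (transl \<mu> ` h ` base_alcove D)"
  using assms(1)
proof (induction "separation (v base_point) base_point" arbitrary: v rule: less_induct)
  case less
  show ?case
  proof (cases "v = id")
    case False
    then obtain \<alpha>\<^sub>0 k\<^sub>0 where "\<alpha>\<^sub>0 \<in> R" "aroot \<alpha>\<^sub>0 k\<^sub>0 (v base_point) * aroot \<alpha>\<^sub>0 k\<^sub>0 base_point < 0"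
      using Wa_free[OF W_Wa[OF less.prems]] by (metis mult.commute)
    from separating_adjacent[OF Wa_symmetries[OF W_Wa[OF less.prems]] this]
    obtain s \<alpha> k where s: "adjacent (v base_point) (v (s base_point)) \<alpha> k"
      "aroot \<alpha> k (v base_point) * aroot \<alpha> k base_point < 0" by metis
    have "\<exists>\<alpha> k. \<alpha> \<in> R \<and> pr \<alpha> rho > 0 \<and> adjacent (v base_point) (v (s base_point)) \<alpha> k \<and>
      aroot \<alpha> k (v base_point) * aroot \<alpha> k base_point < 0"
    proof (cases "pr \<alpha> rho > 0")
      case True
      moreover have "\<alpha> \<in> R" using s(1) by (simp add: adjacent_def)
      ultimately show ?thesis using s by blast
    next
      case False
      have \<alpha>: "\<alpha> \<in> R" using s(1) by (simp add: adjacent_def)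
      then have "pr (- \<alpha>) rho > 0" using False rho_nonzero[OF \<alpha>] by (simp add: pairing_simps)
      moreover have "adjacent (v base_point) (v (s base_point)) (- \<alpha>) (- k)"
        using s(1) by (rule adjacent_minus)
      ultimately show ?thesis using s(2) minus_root[OF \<alpha>]
        by (intro exI[of _ "- \<alpha>"] exI[of _ "- k"]) (auto simp: aroot_minus)
    qed
    then obtain \<alpha> k where \<alpha>: "\<alpha> \<in> R" "pr \<alpha> rho > 0" and adj: "adjacent (v base_point) (v (s base_point)) \<alpha> k"
      and sep: "aroot \<alpha> k (v base_point) * aroot \<alpha> k base_point < 0" by blast
    obtain \<beta> where \<beta>: "\<beta> \<in> R" "\<And>x. pr \<alpha> (v x) = pr \<beta> x" using W_pull[OF less.prems \<alpha>(1)] by blast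
    have p: "- 1 < pr \<alpha> base_point" "pr \<alpha> base_point < 0"
      using \<alpha> base_point_in by (auto simp: base_alcove_iff)
    have q: "\<bar>pr \<beta> base_point\<bar> < 1 \<and> (pr \<beta> rho > 0 \<longrightarrow> pr \<beta> base_point < 0)"
    proof (cases "pr \<beta> rho > 0")
      case True
      then show ?thesis using \<beta>(1) base_point_in by (auto simp: base_alcove_iff)
    next
      case False
      then have "pr (- \<beta>) rho > 0" using rho_nonzero[OF \<beta>(1)] by (simp add: pairing_simps)
      then have "- 1 < pr (- \<beta>) base_point \<and> pr (- \<beta>) base_point < 0"
        using minus_root[OF \<beta>(1)] base_point_in by (auto simp: base_alcove_iff)
      then show ?thesis using False by (simp add: pairing_simps)
    qed
    have sep': "(pr \<beta> base_point + real_of_int k) * (pr \<alpha> base_point + real_of_int k) < 0"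
      using sep by (simp add: affine_root_def \<beta>(2))
    \<comment> \<open>Both roots have absolute value less than \<open>1\<close> at the base point,
      so no nonzero integral constant permits opposite signs.\<close>
    have k: "k = 0"
    proof (rule ccontr)
      assume "k \<noteq> 0"
      then have "real_of_int k \<ge> 1 \<or> real_of_int k \<le> - 1" by linarith
      then show False using sep' p q by (auto simp: mult_less_0_iff)
    qed
    have "pr \<beta> base_point > 0" using sep' p k by (simp add: mult_less_0_iff)
    then have "pr (- \<beta>) rho > 0" using q rho_nonzero[OF \<beta>(1)] by (auto simp: pairing_simps)
    then have "pr (- \<beta>) \<mu> \<ge> 0" using dominant_pos[OF assms(4) minus_root[OF \<beta>(1)]] by simp
    moreover obtain j :: int where j: "pr \<beta> \<mu> = real_of_int j"
      using pairing_int[OF roots_characters[OF \<beta>(1)] assms(3)] by (rule Ints_cases)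
    ultimately have jn: "pr \<alpha> (v \<mu>) = - real (nat (- j))" by (simp add: \<beta>(2) pairing_simps)
    let ?X = "transl (v \<mu>) ` h ` base_alcove D"
    have v': "rfl \<alpha> 0 \<circ> v \<in> W" using W_comp[OF W_refl[OF \<alpha>(1)] less.prems] .
    have eq: "transl (real (nat (- j)) *\<^sub>R cr \<alpha>) ` ?X = transl ((rfl \<alpha> 0 \<circ> v) \<mu>) ` h ` base_alcove D"
      unfolding transl_transl by (simp add: affine_reflection_def affine_root_def jn add.commute)
    have "transl (v \<mu>) \<in> symmetries"
      using W_cocharacters[OF less.prems assms(3)] pairing_int roots_characters by (intro transl_symmetry) blast
    then have "transl (v \<mu>) \<circ> h \<in> symmetries" using assms(2) by (rule symmetries_comp)
    then obtain m :: int where "\<And>y. y \<in> (transl (v \<mu>) \<circ> h) ` base_alcove D \<Longrightarrow> real_of_int m < pr \<alpha> y \<and> pr \<alpha> y < real_of_int m + 1"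
      using alcove_strip \<alpha>(1) by metis
    then have "below (against rho) ?X (transl (real (nat (- j)) *\<^sub>R cr \<alpha>) ` ?X)"
      using below_against_translate[OF \<alpha>, of ?X m "nat (- j)"] by (simp add: image_comp)
    moreover have "below (against rho) (transl ((rfl \<alpha> 0 \<circ> v) \<mu>) ` h ` base_alcove D) (transl \<mu> ` h ` base_alcove D)"
    proof (rule less.hyps[OF _ v'])
      show "separation ((rfl \<alpha> 0 \<circ> v) base_point) base_point < separation (v base_point) base_point"
        using separation_adjacent[OF adj sep] adj by (simp add: adjacent_def k)
    qed
    ultimately show ?thesis unfolding eq by (rule rtranclp_trans)
  qed simp
qed

text \<open>\<open>orbit_below_dominant\<close> for the inverse of \<open>w\<close> composed with
  \<open>v\<close>, with the same inverse as \<open>h\<close>, transported by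
  \<open>w\<close>.\<close>

lemma orbit_below:
  assumes "w \<in> W" "v \<in> W" "\<mu> \<in> cocharacters D" "\<mu> \<in> closure (dominant_chamber D)"
  shows "below (against (w rho)) (transl (v \<mu>) ` base_alcove D) (transl (w \<mu>) ` base_alcove D)"
proof -
  let ?i = "inv_into UNIV w"
  have w: "bij w" "w \<in> Wa" using W_Wa[OF assms(1)] Wa_bij by auto
  have ww: "w (?i x) = x" for x using w(1) by (simp add: bij_is_surj surj_f_inv_f)
  have i: "?i \<in> symmetries" using symmetries_inv Wa_symmetries w(2) by blast
  have "below (against rho) (transl ((?i \<circ> v) \<mu>) ` ?i ` base_alcove D) (transl \<mu> ` ?i ` base_alcove D)"
    using orbit_below_dominant[OF W_comp[OF W_inv[OF assms(1)] assms(2)] i assms(3,4)] .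
  then have "below (against (w rho)) (w ` transl ((?i \<circ> v) \<mu>) ` ?i ` base_alcove D)
      (w ` transl \<mu> ` ?i ` base_alcove D)"
    using W_equivariant[OF assms(1)] by (rule below_against_image[rotated])
  then show ?thesis
    unfolding W_transl[OF assms(1)] by (simp add: ww image_image)
qed

section \<open>The Bruhat order\<close>

lemma Wa_unique:
  assumes "g \<in> Wa" "g base_point \<in> base_alcove D"
  shows "g = id"
  using Wa_free[OF assms(1)] assms(2) unfolding base_alcove_iff_sign
  by (metis less_asym mult.commute)

lemma comp_inv: "bij u \<Longrightarrow> u \<circ> inv_into UNIV u = id" "bij u \<Longrightarrow> inv_into UNIV u \<circ> u = id"
  by (simp_all only: bij_is_surj bij_is_inj surj_iff[symmetric] inv_o_cancel)

lemma Wa_inj: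
  assumes "u \<in> Wa" "v \<in> Wa" "u ` base_alcove D = v ` base_alcove D"
  shows "u = v"
proof -
  have bij: "bij u" using Wa_bij assms(1) by blast
  have "v base_point \<in> u ` base_alcove D" using assms(3) base_point_in by blast
  then have "(inv_into UNIV u \<circ> v) base_point \<in> base_alcove D" using bij by (auto simp: bij_is_inj)
  then have "inv_into UNIV u \<circ> v = id" using Wa_unique Wa_comp Wa_inv assms(1,2) by blast
  then show ?thesis using comp_inv(1)[OF bij] by (metis comp_assoc comp_id id_comp)
qed

text \<open>Exchange deletes the letter at which a shortest word for \<open>u\<close> crosses the
  hyperplane.\<close>

lemma length_decreases:
  assumes "u \<in> Wa" "\<alpha> \<in> R" "aroot \<alpha> k base_point * aroot \<alpha> k (u base_point) < 0"
  shows "coxeter_length S (rfl \<alpha> k \<circ> u) < coxeter_length S u"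
proof -
  let ?P = "\<lambda>u n. \<exists>ss. set ss \<subseteq> S \<and> length ss = n \<and> u = foldr (\<circ>) ss id"
  have "\<exists>n. ?P u n" using assms(1) unfolding Wa_generated_simple simple.generated_words by blast
  then have "?P u (coxeter_length S u)" unfolding coxeter_length_def by (rule LeastI_ex)
  then obtain ss where ss: "set ss \<subseteq> S" "length ss = coxeter_length S u" "u = foldr (\<circ>) ss id" by blast
  obtain us t vs where us: "ss = us @ t # vs" "rfl \<alpha> k \<circ> foldr (\<circ>) us id = foldr (\<circ>) us id \<circ> t"
    using word_crosses[OF ss(1) assms(2)] assms(3) ss(3) by metis
  have "t \<circ> t = id" using us(1) ss(1) simple.involution by auto
  moreover have "u = foldr (\<circ>) us id \<circ> (t \<circ> foldr (\<circ>) vs id)"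
    unfolding ss(3) us(1) foldr_comp_append by simp
  ultimately have "rfl \<alpha> k \<circ> u = foldr (\<circ>) us id \<circ> foldr (\<circ>) vs id"
    using us(2) by (metis comp_assoc id_comp)
  then have "rfl \<alpha> k \<circ> u = foldr (\<circ>) (us @ vs) id" by (simp only: foldr_comp_append)
  moreover have "set (us @ vs) \<subseteq> S" using us(1) ss(1) by auto
  ultimately have "?P (rfl \<alpha> k \<circ> u) (length (us @ vs))" by blast
  then have "coxeter_length S (rfl \<alpha> k \<circ> u) \<le> length (us @ vs)"
    unfolding coxeter_length_def by (rule Least_le)
  then show ?thesis using ss(2) us(1) by simp
qed

text \<open>A symmetry conjugates reflections to reflections; conversely, a word for a reflection
  crosses its own hyperplane, which exhibits it as a conjugate of a letter.\<close>

lemma coxeter_reflections_eq: "coxeter_reflections S = {rfl \<alpha> k | \<alpha> k. \<alpha> \<in> R}"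
proof
  show "coxeter_reflections S \<subseteq> {rfl \<alpha> k | \<alpha> k. \<alpha> \<in> R}"
  proof
    fix t assume "t \<in> coxeter_reflections S"
    then obtain g s where t: "t = g \<circ> s \<circ> inv_into UNIV g" "g \<in> generated S" "s \<in> S"
      unfolding coxeter_reflections_def by blast
    obtain \<beta> l where \<beta>: "is_wall \<beta> l" "s = rfl \<beta> l" using t(3) unfolding simple_iff by blast
    then have \<beta>R: "\<beta> \<in> R" using wall_root by blast
    obtain \<alpha> k where \<alpha>: "\<alpha> \<in> R" "rfl \<alpha> k \<circ> g = g \<circ> s"
      using push_root[OF simple_generated_symmetries[OF t(2)] \<beta>R, of l] \<beta>(2) by metis
    have "t = rfl \<alpha> k"
      using t(1) \<alpha>(2) comp_inv(1)[OF simple.generated_bij[OF t(2)]] by (metis comp_assoc comp_id)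
    then show "t \<in> {rfl \<alpha> k | \<alpha> k. \<alpha> \<in> R}" using \<alpha>(1) by blast
  qed
  show "{rfl \<alpha> k | \<alpha> k. \<alpha> \<in> R} \<subseteq> coxeter_reflections S"
  proof clarify
    fix \<alpha> k assume \<alpha>: "\<alpha> \<in> R"
    have "rfl \<alpha> k \<in> generated S" using Wa_refl[OF \<alpha>] Wa_generated_simple by simp
    then obtain ss where ss: "set ss \<subseteq> S" "rfl \<alpha> k = foldr (\<circ>) ss id"
      unfolding simple.generated_words by blast
    have "aroot \<alpha> k base_point * aroot \<alpha> k (foldr (\<circ>) ss id base_point) < 0"
      using aroot_base_point_nonzero[OF \<alpha>, of k] aroot_refl[OF \<alpha>, of k base_point]
      unfolding ss(2)[symmetric] by (auto simp: zero_less_mult_iff)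
    then obtain us t vs where us: "ss = us @ t # vs" "rfl \<alpha> k \<circ> foldr (\<circ>) us id = foldr (\<circ>) us id \<circ> t"
      using word_crosses[OF ss(1) \<alpha>] by blast
    let ?g = "foldr (\<circ>) us id"
    have g: "?g \<in> generated S" using us(1) ss(1) unfolding simple.generated_words by auto
    have "rfl \<alpha> k = ?g \<circ> t \<circ> inv_into UNIV ?g"
      using us(2) comp_inv(1)[OF simple.generated_bij[OF g]] by (metis comp_assoc comp_id)
    moreover have "t \<in> S" using us(1) ss(1) by auto
    ultimately show "rfl \<alpha> k \<in> coxeter_reflections S"
      unfolding coxeter_reflections_def using g by blast
  qed
qed

text \<open>If the reflection moved the alcove towards the base alcove,
  \<open>length_decreases\<close> would contradict the growth of the length.\<close>

lemma bruhat_imp_below: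
  assumes "bruhat_le S u v" "u \<in> Wa"
  shows "v \<in> Wa \<and> below (seen_from base_point) (u ` base_alcove D) (v ` base_alcove D)"
  using assms(1) unfolding bruhat_le_def
proof (induction rule: rtranclp_induct)
  case (step v v')
  then obtain \<alpha> k where \<alpha>: "\<alpha> \<in> R" "v' = rfl \<alpha> k \<circ> v" "coxeter_length S v < coxeter_length S v'"
    unfolding coxeter_reflections_eq by blast
  have v: "v \<in> Wa" using step.IH by blast
  have "\<not> aroot \<alpha> k base_point * aroot \<alpha> k (v base_point) < 0"
    using length_decreases[OF v \<alpha>(1)] \<alpha>(2,3) by force
  then have "aroot \<alpha> k (v base_point) * aroot \<alpha> k base_point > 0"
    using aroot_base_point_nonzero[OF \<alpha>(1), of k] aroot_base_point_sym[OF Wa_symmetries[OF v] \<alpha>(1), of k]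
    by (simp add: not_less order_le_less mult.commute)
  then have "step (seen_from base_point) (v ` base_alcove D) (v' ` base_alcove D)"
    unfolding step_def seen_from_def \<alpha>(2)
    using \<alpha>(1) alcove_side[OF Wa_symmetries[OF v] \<alpha>(1)] mult_pos_trans(1)
    by (intro bexI[of _ \<alpha>] exI[of _ k] conjI ballI) (simp add: image_image, blast)
  moreover have "v' \<in> Wa" using v \<alpha>(1,2) Wa_comp Wa_refl by blast
  ultimately show ?case using step.IH by auto
qed (use assms(2) in simp)

text \<open>Here \<open>length_decreases\<close> is applied to the upper element, whose reflection
  is the lower one.\<close>

lemma below_imp_bruhat:
  assumes "below (seen_from base_point) (u ` base_alcove D) Y" "u \<in> Wa"
  shows "\<exists>v\<in>Wa. Y = v ` base_alcove D \<and> bruhat_le S u v"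
  using assms(1)
proof (induction rule: rtranclp_induct)
  case base
  then show ?case using assms(2) by (auto simp: bruhat_le_def)
next
  case (step Y Z)
  then obtain v where v: "v \<in> Wa" "Y = v ` base_alcove D" "bruhat_le S u v" by blast
  obtain \<alpha> k where \<alpha>: "\<alpha> \<in> R" "Z = rfl \<alpha> k ` Y" "\<forall>y\<in>Y. aroot \<alpha> k y * aroot \<alpha> k base_point > 0"
    using step.hyps(2) unfolding step_def seen_from_def by blast
  let ?v = "rfl \<alpha> k \<circ> v"
  have v': "?v \<in> Wa" using v(1) \<alpha>(1) Wa_comp Wa_refl by blast
  have "aroot \<alpha> k (v base_point) * aroot \<alpha> k base_point > 0"
    using \<alpha>(3) v(2) base_point_in by blast
  then have "aroot \<alpha> k base_point * aroot \<alpha> k (?v base_point) < 0"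
    by (simp add: aroot_refl[OF \<alpha>(1)] mult.commute)
  then have "coxeter_length S (rfl \<alpha> k \<circ> ?v) < coxeter_length S ?v"
    by (rule length_decreases[OF v' \<alpha>(1)])
  moreover have "rfl \<alpha> k \<circ> ?v = v" using refl_involution[OF \<alpha>(1)] by (metis comp_assoc id_comp)
  ultimately have "bruhat_le S u ?v"
    using v(3) \<alpha>(1) unfolding bruhat_le_def coxeter_reflections_eq
    by (elim rtranclp.rtrancl_into_rtrancl) auto
  moreover have "Z = ?v ` base_alcove D" using \<alpha>(2) v(2) by (simp add: image_image)
  ultimately show ?case using v' by blast
qed

section \<open>Cosets of the affine Weyl group\<close>

lemma symmetry_stabilizes:
  assumes "t \<in> symmetries" "t base_point \<in> base_alcove D"
  shows "t ` base_alcove D = base_alcove D"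
proof -
  have sub: "t ` base_alcove D \<subseteq> base_alcove D"
    if t: "t \<in> symmetries" "t base_point \<in> base_alcove D" for t
  proof clarify
    fix x assume x: "x \<in> base_alcove D"
    show "t x \<in> base_alcove D"
      unfolding base_alcove_iff_sign
    proof (intro ballI allI)
      fix \<alpha> k assume \<alpha>: "\<alpha> \<in> R"
      obtain \<beta> l where \<beta>: "\<beta> \<in> R" "\<And>x. aroot \<alpha> k (t x) = aroot \<beta> l x"
        using pull_root[OF t(1) \<alpha>] by metis
      have "aroot \<alpha> k (t x) * aroot \<alpha> k (t base_point) > 0"
        using aroot_same_sign[OF x base_point_in \<beta>(1)] by (simp add: \<beta>(2))
      moreover have "aroot \<alpha> k (t base_point) * aroot \<alpha> k base_point > 0"
        using t(2) \<alpha> by (simp add: base_alcove_iff_sign)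
      ultimately show "aroot \<alpha> k (t x) * aroot \<alpha> k base_point > 0" by (rule mult_pos_trans(1))
    qed
  qed
  let ?i = "inv_into UNIV t"
  have bij: "bij t" using assms(1) by (rule symmetries_bij)
  have i: "?i \<in> symmetries" using assms(1) by (rule symmetries_inv)
  have "?i base_point \<in> base_alcove D"
    unfolding base_alcove_iff_sign
  proof (intro ballI allI)
    fix \<alpha> k assume \<alpha>: "\<alpha> \<in> R"
    obtain \<beta> l where \<beta>: "\<beta> \<in> R" "\<And>x. aroot \<alpha> k (?i x) = aroot \<beta> l x"
      using pull_root[OF i \<alpha>] by metis
    have "aroot \<beta> l (t base_point) = aroot \<alpha> k base_point"
      using \<beta>(2)[of "t base_point"] bij by (simp add: bij_is_inj)
    moreover have "aroot \<beta> l (t base_point) * aroot \<beta> l base_point > 0"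
      using assms(2) \<beta>(1) by (simp add: base_alcove_iff_sign)
    ultimately show "aroot \<alpha> k (?i base_point) * aroot \<alpha> k base_point > 0"
      by (simp add: \<beta>(2) mult.commute)
  qed
  then have "?i ` base_alcove D \<subseteq> base_alcove D" using sub i by blast
  then have "t ` ?i ` base_alcove D \<subseteq> t ` base_alcove D" by (rule image_mono)
  then have "base_alcove D \<subseteq> t ` base_alcove D"
    using bij by (simp add: image_image bij_is_surj surj_f_inv_f)
  then show ?thesis using sub[OF assms] by blast
qed

lemma zero_cocharacters: "0 \<in> cocharacters D"
proof -
  have "full_lattice (cocharacters D)" using based by (simp add: based_reduced_root_datum_def)
  then obtain B where "cocharacters D = {\<Sum>b\<in>B. real_of_int (c b) *\<^sub>R b | c. True}"
    unfolding full_lattice_def by blast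
  then show ?thesis by (simp only:) (intro CollectI exI[of _ "\<lambda>_. 0"], simp)
qed

lemma refl_decompose: "rfl \<alpha> k = transl (- real_of_int k *\<^sub>R cr \<alpha>) \<circ> rfl \<alpha> 0"
  by (rule ext) (simp add: affine_reflection_def affine_root_def transl_def algebra_simps)

lemma refl_transl: "rfl \<alpha> k (transl y x) = transl (rfl \<alpha> 0 y) (rfl \<alpha> k x)"
  by (simp add: affine_reflection_def affine_root_def transl_def pairing_simps algebra_simps)

lemma Wa_decompose: "u \<in> Wa \<Longrightarrow> \<exists>l\<in>cocharacters D. \<exists>w\<in>W. u = transl l \<circ> w"
  unfolding affine_weyl_group_def
proof (induction u rule: affine.generated_induct)
  case id
  have "id = transl 0 \<circ> id" by (rule ext) (simp add: transl_def)
  then show ?case using zero_cocharacters W_id by blast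
next
  case (step s h)
  then obtain \<alpha> k where \<alpha>: "\<alpha> \<in> R" "s = rfl \<alpha> k" by blast
  obtain l w where lw: "l \<in> cocharacters D" "w \<in> W" "h = transl l \<circ> w" using step.IH by blast
  let ?l = "rfl \<alpha> 0 l + real_of_int (- k) *\<^sub>R cr \<alpha>"
  have "s \<circ> h = transl ?l \<circ> (rfl \<alpha> 0 \<circ> w)"
    unfolding \<alpha>(2) lw(3) refl_decompose[of \<alpha> k]
    by (rule ext) (simp add: refl_linear transl_def algebra_simps)
  moreover have "?l \<in> cocharacters D"
    using cocharacters_closed refl_cocharacters lw(1) \<alpha>(1) coroot_cocharacters by blast
  moreover have "rfl \<alpha> 0 \<circ> w \<in> W" using W_comp W_refl \<alpha>(1) lw(2) by blast
  ultimately show ?case by blast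
qed

lemma transl_cocharacter_symmetry: "l \<in> cocharacters D \<Longrightarrow> transl l \<in> symmetries"
  using pairing_int roots_characters by (intro transl_symmetry) blast

lemma stabilizer_symmetries: "t \<in> alcove_stabilizer D \<Longrightarrow> t \<in> symmetries"
  unfolding alcove_stabilizer_def extended_affine_weyl_group_def
  using symmetries_comp transl_cocharacter_symmetry Wa_symmetries W_Wa by blast

lemma stabilizer_image: "t \<in> alcove_stabilizer D \<Longrightarrow> t ` base_alcove D = base_alcove D"
  by (simp add: alcove_stabilizer_def)

text \<open>Transitivity on alcoves leaves a factor that maps the base alcove to itself; freeness of
  the action makes it unique, as the definite description in \<open>tau\<close> requires.\<close>

lemma tau_properties:
  assumes "\<mu> \<in> cocharacters D"
  shows tau_stabilizer: "tau D \<mu> \<in> alcove_stabilizer D"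
    and transl_tau: "\<exists>u\<in>Wa. transl \<mu> = u \<circ> tau D \<mu>"
proof -
  let ?Q = "\<lambda>t. t \<in> alcove_stabilizer D \<and> transl \<mu> \<in> affine_weyl_group D \<cdot>\<^sub>g {t}"
  have T: "transl \<mu> \<in> symmetries" using assms by (rule transl_cocharacter_symmetry)
  obtain u where u: "u \<in> Wa" "\<And>\<alpha> k. \<alpha> \<in> R \<Longrightarrow> \<not> aroot \<alpha> k (u base_point) * aroot \<alpha> k (transl \<mu> base_point) < 0"
    using generated_transitive[OF simple.generated_id] Wa_generated_simple by blast
  define t where "t = inv_into UNIV u \<circ> transl \<mu>"
  have bij: "bij u" using Wa_bij u(1) by blast
  have i: "inv_into UNIV u \<in> symmetries" using symmetries_inv Wa_symmetries u(1) by blast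
  have ts: "t \<in> symmetries" unfolding t_def using i T by (rule symmetries_comp)
  have "t base_point \<in> base_alcove D"
    unfolding base_alcove_iff_sign
  proof (intro ballI allI)
    fix \<alpha> k assume \<alpha>: "\<alpha> \<in> R"
    obtain \<beta> l where \<beta>: "\<beta> \<in> R" "\<And>x. aroot \<alpha> k (inv_into UNIV u x) = aroot \<beta> l x"
      using pull_root[OF i \<alpha>] by metis
    have "aroot \<alpha> k base_point = aroot \<beta> l (u base_point)"
      using \<beta>(2)[of "u base_point"] bij by (simp add: bij_is_inj)
    moreover have "aroot \<alpha> k (t base_point) = aroot \<beta> l (transl \<mu> base_point)"
      by (simp add: t_def \<beta>(2))
    moreover have "aroot \<alpha> k (t base_point) \<noteq> 0" "aroot \<alpha> k base_point \<noteq> 0"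
      using aroot_base_point_sym[OF ts \<alpha>] aroot_base_point_nonzero[OF \<alpha>] by auto
    ultimately show "aroot \<alpha> k (t base_point) * aroot \<alpha> k base_point > 0"
      using u(2)[OF \<beta>(1), of l] by (simp add: mult.commute not_less order_le_less)
  qed
  then have "t ` base_alcove D = base_alcove D" by (rule symmetry_stabilizes[OF ts])
  moreover have "t \<in> extended_affine_weyl_group D"
  proof -
    obtain l w where lw: "l \<in> cocharacters D" "w \<in> W" "inv_into UNIV u = transl l \<circ> w"
      using Wa_decompose[OF Wa_inv[OF u(1)]] by blast
    have "t = transl (l + w \<mu>) \<circ> w"
      unfolding t_def lw(3) by (rule ext) (simp add: transl_def W_add[OF lw(2)] add.assoc)
    moreover have "l + w \<mu> \<in> cocharacters D"
      using cocharacters_closed[OF lw(1) W_cocharacters[OF lw(2) assms], of 1] by simp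
    ultimately show ?thesis unfolding extended_affine_weyl_group_def using lw(2) by blast
  qed
  moreover have "transl \<mu> = u \<circ> t"
    unfolding t_def by (simp only: comp_assoc[symmetric] comp_inv[OF bij] id_comp)
  ultimately have Qt: "?Q t" using u(1) by (auto simp: alcove_stabilizer_def group_prod_def)
  moreover have "t' = t" if Q': "?Q t'" for t'
  proof -
    obtain u' where u': "u' \<in> Wa" "transl \<mu> = u' \<circ> t'" using Q' by (auto simp: group_prod_def)
    have bij': "bij u'" using Wa_bij u'(1) by blast
    define g where "g = inv_into UNIV u' \<circ> u"
    have g: "g \<in> Wa" unfolding g_def using Wa_comp Wa_inv u(1) u'(1) by blast
    have gt: "g \<circ> t = t'"
      using \<open>transl \<mu> = u \<circ> t\<close> u'(2) comp_inv[OF bij'] unfolding g_def by (metis comp_assoc id_comp)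
    have "g ` base_alcove D = base_alcove D"
      using gt Qt Q' stabilizer_image by (metis image_comp)
    then have "g base_point \<in> base_alcove D" using base_point_in by blast
    then have "g = id" using Wa_unique g by blast
    then show ?thesis using gt by simp
  qed
  ultimately have "?Q (tau D \<mu>)" unfolding tau_def by (rule theI)
  then show "tau D \<mu> \<in> alcove_stabilizer D" "\<exists>u\<in>Wa. transl \<mu> = u \<circ> tau D \<mu>"
    by (auto simp: group_prod_def)
qed

lemma Wa_normal:
  assumes "g \<in> symmetries" "u \<in> Wa"
  shows "\<exists>u'\<in>Wa. g \<circ> u = u' \<circ> g"
  using assms(2) unfolding affine_weyl_group_def
proof (induction u rule: affine.generated_induct)
  case id
  then show ?case using affine.generated_id by (intro bexI[of _ id]) simp_all
next
  case (step s h)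
  then obtain \<alpha> k where \<alpha>: "\<alpha> \<in> R" "s = rfl \<alpha> k" by blast
  obtain \<beta> l where \<beta>: "\<beta> \<in> R" "rfl \<beta> l \<circ> g = g \<circ> s"
    using push_root[OF assms(1) \<alpha>(1), of k] \<alpha>(2) by metis
  obtain u' where u': "u' \<in> generated {rfl \<alpha> k | \<alpha> k. \<alpha> \<in> R}" "g \<circ> h = u' \<circ> g"
    using step.IH by blast
  have "g \<circ> (s \<circ> h) = (rfl \<beta> l \<circ> u') \<circ> g" using \<beta>(2) u'(2) by (metis comp_assoc)
  moreover have "rfl \<beta> l \<circ> u' \<in> generated {rfl \<alpha> k | \<alpha> k. \<alpha> \<in> R}"
    using \<beta>(1) u'(1) affine.generated_left by blast
  ultimately show ?case by blast
qed

context
  fixes \<mu>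
  assumes \<mu>: "\<mu> \<in> cocharacters D"
begin

abbreviation "C \<equiv> affine_coset D \<mu>"

lemma coset_iff: "x \<in> C \<longleftrightarrow> (\<exists>u\<in>Wa. x = u \<circ> tau D \<mu>)"
  by (auto simp: affine_coset_def group_prod_def)

lemma coset_symmetries: "x \<in> C \<Longrightarrow> x \<in> symmetries"
  using coset_iff symmetries_comp Wa_symmetries stabilizer_symmetries tau_stabilizer[OF \<mu>] by metis

lemma coset_left: "u \<in> Wa \<Longrightarrow> x \<in> C \<Longrightarrow> u \<circ> x \<in> C"
  unfolding coset_iff using Wa_comp by (metis comp_assoc)

lemma coset_left_diff:
  assumes "x \<in> C" "y \<in> C"
  shows "\<exists>u\<in>Wa. y = u \<circ> x"
proof -
  obtain u v where uv: "u \<in> Wa" "v \<in> Wa" "x = u \<circ> tau D \<mu>" "y = v \<circ> tau D \<mu>"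
    using assms coset_iff by blast
  then have "y = (v \<circ> inv_into UNIV u) \<circ> x"
    using comp_inv(2)[OF Wa_bij] by (metis comp_assoc comp_id)
  then show ?thesis using Wa_comp Wa_inv uv by blast
qed

lemma coset_right: "x \<in> C \<Longrightarrow> u \<in> Wa \<Longrightarrow> x \<circ> u \<in> C"
  using Wa_normal coset_symmetries coset_left by metis

lemma coset_right_diff:
  assumes "x \<in> C" "y \<in> C"
  shows "inv_into UNIV x \<circ> y \<in> Wa"
proof -
  obtain u where u: "u \<in> Wa" "y = u \<circ> x" using coset_left_diff[OF assms] by blast
  have x: "x \<in> symmetries" using assms(1) coset_symmetries by blast
  obtain u' where u': "u' \<in> Wa" "inv_into UNIV x \<circ> u = u' \<circ> inv_into UNIV x"
    using Wa_normal[OF symmetries_inv[OF x] u(1)] by blast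
  have "inv_into UNIV x \<circ> y = u'"
    using u(2) u'(2) comp_inv(2)[OF symmetries_bij[OF x]] by (metis comp_assoc comp_id)
  then show ?thesis using u'(1) by simp
qed

lemma coset_inj:
  assumes "x \<in> C" "y \<in> C" "x ` base_alcove D = y ` base_alcove D"
  shows "x = y"
proof -
  have bij: "bij x" using assms(1) coset_symmetries symmetries_bij by blast
  have "y base_point \<in> x ` base_alcove D" using assms(3) base_point_in by blast
  then have "(inv_into UNIV x \<circ> y) base_point \<in> base_alcove D"
    using bij by (auto simp: bij_is_inj)
  then have "inv_into UNIV x \<circ> y = id" using Wa_unique coset_right_diff[OF assms(1,2)] by blast
  then show ?thesis using comp_inv(1)[OF bij] by (metis comp_assoc comp_id id_comp)
qed

lemma transl_coset: "transl \<mu> \<in> C"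
  using transl_tau[OF \<mu>] coset_iff by blast

lemma transl_orbit_coset:
  assumes "w \<in> W"
  shows "transl (w \<mu>) \<in> C"
proof -
  let ?i = "inv_into UNIV w"
  have w: "w \<in> Wa" "bij w" using W_Wa[OF assms] Wa_bij by auto
  have "transl (w \<mu>) = w \<circ> (transl \<mu> \<circ> ?i)"
    using w(2) by (intro ext) (simp add: transl_def W_add[OF assms] bij_is_surj surj_f_inv_f)
  then show ?thesis using coset_left coset_right transl_coset w(1) Wa_inv by metis
qed

section \<open>From alcoves to faces, and right multiplication\<close>

text \<open>Each alcove of the chain determines an element of the coset by \<open>coset_inj\<close>,
  which marks the corresponding face. A step whose hyperplane contains this face fixes it and is
  dropped.\<close>

lemma alcoves_to_faces:
  assumes "below \<sigma> (x ` base_alcove D) Y" "x \<in> C" "is_face F" "y \<in> C" "Y = y ` base_alcove D"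
  shows "below \<sigma> (x ` F) (y ` F)"
  using assms(1,4,5)
proof (induction arbitrary: y rule: rtranclp_induct)
  case base
  then show ?case using coset_inj assms(2) by blast
next
  case (step Y Z)
  then obtain \<alpha> k where \<alpha>: "\<alpha> \<in> R" "Z = rfl \<alpha> k ` Y" "\<forall>y\<in>Y. aroot \<alpha> k y * \<sigma> \<alpha> k > 0"
    unfolding step_def by blast
  let ?y = "rfl \<alpha> k \<circ> y"
  have y: "?y \<in> C" using coset_left Wa_refl \<alpha>(1) step.prems(1) by blast
  have Y: "Y = ?y ` base_alcove D"
    using \<alpha>(1,2) step.prems(2) by (metis image_comp refl_image_image)
  have ysym: "?y \<in> symmetries" using y coset_symmetries by blast
  have yF: "y ` F = rfl \<alpha> k ` ?y ` F" using \<alpha>(1) by (simp add: image_image)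
  have IH: "below \<sigma> (x ` F) (?y ` F)" using step.IH y Y by blast
  from face_sides[OF assms(3) ysym \<alpha>(1), of k] show ?case
  proof
    assume "\<forall>z\<in>?y ` F. aroot \<alpha> k z = 0"
    then have "rfl \<alpha> k ` ?y ` F = ?y ` F" using refl_fixed by (auto simp: image_iff)
    then show ?thesis using IH yF by simp
  next
    assume *: "\<forall>z\<in>?y ` F. aroot \<alpha> k z * aroot \<alpha> k (?y base_point) > 0"
    have "aroot \<alpha> k (?y base_point) * \<sigma> \<alpha> k > 0"
      using \<alpha>(3) unfolding Y using base_point_in by blast
    then have "step \<sigma> (?y ` F) (y ` F)"
      unfolding step_def yF using * \<alpha>(1) mult_pos_trans(1) by blast
    then show ?thesis using IH by simp
  qed
qed

text \<open>Lifting property on the right. Seen in the frame of \<open>x\<close>, a reflection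
  either is \<open>s\<close>, so that the next element times \<open>s\<close> is \<open>x\<close>
  again, or keeps \<open>x\<close> and \<open>x \<circ> s\<close> on one side, so that it is also a
  step from \<open>x \<circ> s\<close>.\<close>

lemma right_lift_simple:
  assumes "s \<in> S" "below (seen_from b) X ((y \<circ> s) ` base_alcove D)" "y \<in> C"
    "x \<in> C" "X = x ` base_alcove D"
  shows "below (seen_from b) (x ` base_alcove D) (y ` base_alcove D) \<or>
    below (seen_from b) ((x \<circ> s) ` base_alcove D) (y ` base_alcove D)"
  using assms(2,4,5)
proof (induction arbitrary: x rule: converse_rtranclp_induct)
  case base
  have "y \<circ> s \<in> C" using coset_right[OF assms(3) Wa_simple[OF assms(1)]] .
  then have "x = y \<circ> s" using coset_inj base by simp
  then have "x \<circ> s = y" using simple.involution[OF assms(1)] by (metis comp_assoc comp_id)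
  then show ?case by simp
next
  case (step X Z)
  then obtain \<alpha> k where \<alpha>: "\<alpha> \<in> R" "Z = rfl \<alpha> k ` X" "\<forall>y\<in>X. aroot \<alpha> k y * aroot \<alpha> k b > 0"
    unfolding step_def seen_from_def by blast
  let ?x = "rfl \<alpha> k \<circ> x"
  have "?x \<in> C" using coset_left Wa_refl \<alpha>(1) step.prems(1) by blast
  moreover have Z: "Z = ?x ` base_alcove D" using \<alpha>(2) step.prems(2) by (simp add: image_comp)
  ultimately have IH: "below (seen_from b) Z (y ` base_alcove D) \<or>
    below (seen_from b) ((?x \<circ> s) ` base_alcove D) (y ` base_alcove D)"
    using step.IH by blast
  have sx: "below (seen_from b) (x ` base_alcove D) Z" using step.hyps(1) step.prems(2) by blast
  have xs: "x \<circ> s \<in> symmetries" "x \<in> symmetries"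
    using coset_right step.prems(1) Wa_simple assms(1) coset_symmetries by blast+
  have xp: "aroot \<alpha> k (x base_point) * aroot \<alpha> k b > 0"
    using \<alpha>(3) step.prems(2) base_point_in by blast
  obtain \<beta> l where \<beta>: "\<beta> \<in> R" "\<And>z. aroot \<alpha> k (x z) = aroot \<beta> l z" "rfl \<alpha> k \<circ> x = x \<circ> rfl \<beta> l"
    using pull_root[OF xs(2) \<alpha>(1)] by metis
  obtain \<gamma> m where \<gamma>: "is_wall \<gamma> m" "s = rfl \<gamma> m" using assms(1) simple_iff by blast
  show ?case
  proof (cases "aroot \<beta> l base_point * aroot \<beta> l (s base_point) \<le> 0")
    case True
    then have "rfl \<beta> l = s"
      using wall_separates_only[OF \<gamma>(1) \<beta>(1), of l] \<gamma> refl_minus[OF wall_root[OF \<gamma>(1)]] by auto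
    then have "?x \<circ> s = x" using \<beta>(3) simple.involution[OF assms(1)] by (metis comp_assoc comp_id)
    then show ?thesis using IH sx by (metis rtranclp_trans)
  next
    case False
    then have "aroot \<alpha> k ((x \<circ> s) base_point) * aroot \<alpha> k (x base_point) > 0"
      by (simp add: \<beta>(2) mult.commute)
    then have "aroot \<alpha> k ((x \<circ> s) base_point) * aroot \<alpha> k b > 0" using xp by (rule mult_pos_trans(1))
    then have "step (seen_from b) ((x \<circ> s) ` base_alcove D) ((?x \<circ> s) ` base_alcove D)"
      unfolding step_def seen_from_def
      using \<alpha>(1) alcove_side[OF xs(1) \<alpha>(1)] mult_pos_trans(1)
      by (intro bexI[of _ \<alpha>] exI[of _ k] conjI ballI) (simp add: image_image, blast)
    then show ?thesis using IH sx by (metis converse_rtranclp_into_rtranclp rtranclp_trans)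
  qed
qed

lemma right_lift:
  assumes "J \<subseteq> S" "j \<in> generated J"
  shows "y \<in> C \<Longrightarrow> x \<in> C \<Longrightarrow> below (seen_from b) (x ` base_alcove D) ((y \<circ> j) ` base_alcove D) \<Longrightarrow>
    \<exists>j'\<in>generated J. below (seen_from b) ((x \<circ> j') ` base_alcove D) (y ` base_alcove D)"
  using assms(2)
proof (induction j arbitrary: y rule: involutions.generated_induct[OF subset_involutions[OF assms(1)], consumes 1, case_names id step])
  case id
  then show ?case
    using involutions.generated_id[OF subset_involutions[OF assms(1)]]
    by (intro bexI[of _ id]) simp_all
next
  case (step s h)
  have s: "s \<in> S" using step.hyps(1) assms(1) by blast
  have "y \<circ> s \<in> C" using coset_right[OF step.prems(1) Wa_simple[OF s]] .
  moreover have "below (seen_from b) (x ` base_alcove D) ((y \<circ> s \<circ> h) ` base_alcove D)"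
    using step.prems(3) unfolding comp_assoc .
  ultimately have "\<exists>j'\<in>generated J. below (seen_from b) ((x \<circ> j') ` base_alcove D) ((y \<circ> s) ` base_alcove D)"
    using step.IH step.prems(2) by (metis (no_types))
  then obtain j' where j': "j' \<in> generated J"
    "below (seen_from b) ((x \<circ> j') ` base_alcove D) ((y \<circ> s) ` base_alcove D)"
    by (rule bexE)
  have "x \<circ> j' \<in> C"
    using coset_right[OF step.prems(2)] generated_subset[OF assms(1) j'(1)] Wa_generated_simple by simp
  from right_lift_simple[OF s j'(2) step.prems(1) this HOL.refl] show ?case
  proof
    assume "below (seen_from b) ((x \<circ> j' \<circ> s) ` base_alcove D) (y ` base_alcove D)"
    moreover have "j' \<circ> s \<in> generated J"
      using involutions.generated_comp[OF subset_involutions[OF assms(1)] j'(1)]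
        involutions.generated_base[OF subset_involutions[OF assms(1)] step.hyps(1)] by simp
    ultimately show ?thesis unfolding comp_assoc by (rule rev_bexI[rotated])
  next
    assume "below (seen_from b) ((x \<circ> j') ` base_alcove D) (y ` base_alcove D)"
    then show ?thesis using j'(1) by (rule rev_bexI[rotated])
  qed
qed

text \<open>Elements of one coset share the factor \<open>tau D \<mu>\<close>, which preserves the
  base alcove, so the order on the affine Weyl group can be read from alcoves.\<close>

lemma Adm_iff:
  "x \<in> Adm D \<mu> \<longleftrightarrow> x \<in> C \<and> (\<exists>w\<in>W. below (seen_from base_point) (x ` base_alcove D) (transl (w \<mu>) ` base_alcove D))"
proof -
  have "extended_bruhat_le D x y \<longleftrightarrow> below (seen_from base_point) (x ` base_alcove D) (y ` base_alcove D)"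
    if xy: "x \<in> C" "y \<in> C" for x y
  proof
    assume "extended_bruhat_le D x y"
    then obtain u v t where *: "u \<in> Wa" "t \<in> alcove_stabilizer D" "x = u \<circ> t" "y = v \<circ> t" "bruhat_le S u v"
      unfolding extended_bruhat_le_def by blast
    have "x ` base_alcove D = u ` base_alcove D" "y ` base_alcove D = v ` base_alcove D"
      unfolding *(3,4) using stabilizer_image[OF *(2)] by (metis image_comp)+
    then show "below (seen_from base_point) (x ` base_alcove D) (y ` base_alcove D)"
      using bruhat_imp_below[OF *(5,1)] by simp
  next
    assume b: "below (seen_from base_point) (x ` base_alcove D) (y ` base_alcove D)"
    let ?t = "tau D \<mu>"
    obtain u v where uv: "u \<in> Wa" "x = u \<circ> ?t" "v \<in> Wa" "y = v \<circ> ?t" using xy coset_iff by blast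
    have "x ` base_alcove D = u ` base_alcove D" "y ` base_alcove D = v ` base_alcove D"
      unfolding uv(2,4) using stabilizer_image[OF tau_stabilizer[OF \<mu>]] by (metis image_comp)+
    then obtain v' where "v' \<in> Wa" "v ` base_alcove D = v' ` base_alcove D" "bruhat_le S u v'"
      using below_imp_bruhat[OF _ uv(1)] b by metis
    then have "bruhat_le S u v" using Wa_inj uv(3) by metis
    then show "extended_bruhat_le D x y"
      unfolding extended_bruhat_le_def using uv tau_stabilizer[OF \<mu>] by blast
  qed
  then show ?thesis unfolding Adm_def using transl_orbit_coset by blast
qed

end

section \<open>Vertices\<close>

definition facet :: "'v \<Rightarrow> 'v set" where
  "facet x = {y. \<forall>\<alpha>\<in>R. \<forall>k. sgn (aroot \<alpha> k y) = sgn (aroot \<alpha> k x)}"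

lemma facets_iff: "F \<in> facets D \<longleftrightarrow> (\<exists>x. F = facet x)"
  unfolding facets_def facet_def by (simp only: mem_Collect_eq simp_thms)

lemma facet_self: "x \<in> facet x"
  by (simp add: facet_def)

lemma facet_zero: "y \<in> facet x \<Longrightarrow> \<alpha> \<in> R \<Longrightarrow> aroot \<alpha> k y = 0 \<longleftrightarrow> aroot \<alpha> k x = 0"
proof -
  assume "y \<in> facet x" "\<alpha> \<in> R"
  then have "sgn (aroot \<alpha> k y) = sgn (aroot \<alpha> k x)" unfolding facet_def by blast
  then show ?thesis by (metis sgn_0_0)
qed

lemma vertex_face:
  assumes "v \<in> vertices D"
  shows "is_face v" "\<exists>x. v = facet x \<and> x \<in> closed_alcove"
proof -
  obtain x where x: "v = facet x" "facet x \<subseteq> closed_alcove"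
    using assms unfolding vertices_def facets_iff closure_base_alcove by auto
  then show "\<exists>x. v = facet x \<and> x \<in> closed_alcove" using facet_self by blast
  show "is_face v"
    unfolding is_face_def x(1) using x(2) facet_zero by blast
qed

text \<open>A facet in the closure satisfies the weak inequalities of \<open>x\<close>, hence lies
  on all hyperplanes through \<open>x\<close>. If no point of the closed alcove lies on more of
  them, its signs are those of \<open>x\<close>.\<close>

lemma vertexI:
  assumes x: "x \<in> closed_alcove"
    and min: "\<And>g. g \<in> closed_alcove \<Longrightarrow> (\<And>\<alpha> k. \<alpha> \<in> R \<Longrightarrow> aroot \<alpha> k x = 0 \<Longrightarrow> aroot \<alpha> k g = 0) \<Longrightarrow>
      (\<And>\<alpha> k. \<alpha> \<in> R \<Longrightarrow> aroot \<alpha> k g = 0 \<Longrightarrow> aroot \<alpha> k x = 0)"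
  shows "facet x \<in> vertices D"
proof -
  have sub: "facet x \<subseteq> closed_alcove"
    using facet_in_closed_alcove[OF x] by (auto simp: facet_def)
  have "facet g = facet x" if g: "facet g \<subseteq> closure (facet x)" for g
  proof -
    have gx: "g \<in> closure (facet x)" using g facet_self by blast
    have weak: "aroot \<alpha> k g * aroot \<alpha> k x \<ge> 0 \<and> (aroot \<alpha> k x = 0 \<longrightarrow> aroot \<alpha> k g = 0)" if \<alpha>: "\<alpha> \<in> R" for \<alpha> k
    proof -
      have *: "sgn (aroot \<alpha> k y) = sgn (aroot \<alpha> k x)" if "y \<in> facet x" for y
        using that \<alpha> by (simp add: facet_def)
      consider "aroot \<alpha> k x > 0" | "aroot \<alpha> k x < 0" | "aroot \<alpha> k x = 0" by linarith
      then show ?thesis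
      proof cases
        case 1
        then have "facet x \<subseteq> {y. aroot \<alpha> k y \<ge> 0}" using * by (force simp: sgn_if split: if_splits)
        then have "aroot \<alpha> k g \<ge> 0" using closure_minimal[OF _ closed_aroot(1)] gx by blast
        then show ?thesis using 1 by simp
      next
        case 2
        then have "facet x \<subseteq> {y. aroot \<alpha> k y \<le> 0}" using * by (force simp: sgn_if split: if_splits)
        then have "aroot \<alpha> k g \<le> 0" using closure_minimal[OF _ closed_aroot(2)] gx by blast
        then show ?thesis using 2 by (simp add: mult_nonpos_nonpos)
      next
        case 3
        then have "aroot \<alpha> k y = 0" if "y \<in> facet x" for y using facet_zero[OF that \<alpha>] by blast
        then have "facet x \<subseteq> {y. aroot \<alpha> k y \<ge> 0} \<inter> {y. aroot \<alpha> k y \<le> 0}" by auto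
        then have "closure (facet x) \<subseteq> {y. aroot \<alpha> k y \<ge> 0} \<inter> {y. aroot \<alpha> k y \<le> 0}"
          by (intro closure_minimal closed_Int closed_aroot)
        then have "aroot \<alpha> k g \<ge> 0" "aroot \<alpha> k g \<le> 0" using gx by blast+
        then have "aroot \<alpha> k g = 0" by (rule antisym[rotated])
        then show ?thesis by simp
      qed
    qed
    have "closure (facet x) \<subseteq> closed_alcove"
      using sub closure_base_alcove by (metis closed_closure closure_minimal)
    then have "g \<in> closed_alcove" using gx by blast
    then have z: "aroot \<alpha> k g = 0 \<longleftrightarrow> aroot \<alpha> k x = 0" if "\<alpha> \<in> R" for \<alpha> k
      using min[of g \<alpha> k] weak that by blast
    have "sgn (aroot \<alpha> k g) = sgn (aroot \<alpha> k x)" if "\<alpha> \<in> R" for \<alpha> k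
      using weak[OF that, of k] z[OF that, of k]
      by (cases "aroot \<alpha> k x" "0 :: real" rule: linorder_cases) (auto simp: sgn_if zero_le_mult_iff)
    then show ?thesis by (simp add: facet_def)
  qed
  then have "G = facet x" if "G \<in> facets D" "G \<subseteq> closure (facet x)" for G
    using that unfolding facets_iff by blast
  then show ?thesis
    unfolding vertices_def closure_base_alcove using sub facets_iff[of "facet x"] by blast
qed

definition zeros :: "'v \<Rightarrow> ('u \<times> int) set" where
  "zeros x = {(\<alpha>, k). \<alpha> \<in> R \<and> aroot \<alpha> k x = 0}"

text \<open>A root determines the only constant \<open>k\<close> for which
  \<open>\<alpha> + k\<close> can vanish at \<open>x\<close>.\<close>

lemma zeros_bound: "finite (zeros x)" "card (zeros x) \<le> card R"
proof -
  have inj: "inj_on fst (zeros x)" by (auto simp: inj_on_def zeros_def affine_root_def)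
  have sub: "fst ` zeros x \<subseteq> R" by (auto simp: zeros_def)
  show "finite (zeros x)" using inj sub finite_roots by (metis finite_imageD finite_subset)
  show "card (zeros x) \<le> card R" using card_inj_on_le[OF inj sub finite_roots] .
qed

text \<open>The uniform bound on the number of zeros replaces an induction on the dimension in the
  search for vertices.\<close>

lemma zeros_maximal:
  assumes "Q x"
  obtains y where "Q y" "\<And>z. Q z \<Longrightarrow> zeros y \<subseteq> zeros z \<Longrightarrow> zeros z = zeros y"
proof -
  have "\<forall>z. Q z \<longrightarrow> card (zeros z) < Suc (card R)"
    using zeros_bound(2) by (simp add: le_imp_less_Suc)
  from ex_has_greatest_nat[OF assms this]
  obtain y where y: "Q y" "\<And>z. Q z \<Longrightarrow> card (zeros z) \<le> card (zeros y)" by auto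
  have "zeros z = zeros y" if "Q z" "zeros y \<subseteq> zeros z" for z
    using card_subset_eq[OF zeros_bound(1) that(2)] card_mono[OF zeros_bound(1) that(2)] y(2)[OF that(1)]
    by simp
  then show ?thesis using that y(1) by blast
qed

lemma vertex_exists: "\<exists>v. v \<in> vertices D"
proof -
  have "base_point \<in> closed_alcove" using base_point_in base_alcove_sub by blast
  then obtain y where y: "y \<in> closed_alcove"
    "\<And>z. z \<in> closed_alcove \<Longrightarrow> zeros y \<subseteq> zeros z \<Longrightarrow> zeros z = zeros y"
    using zeros_maximal[of "\<lambda>x. x \<in> closed_alcove"] by blast
  have "facet y \<in> vertices D"
  proof (rule vertexI[OF y(1)])
    fix g \<alpha> k
    assume g: "g \<in> closed_alcove" "\<And>\<alpha> k. \<alpha> \<in> R \<Longrightarrow> aroot \<alpha> k y = 0 \<Longrightarrow> aroot \<alpha> k g = 0"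
      and \<alpha>: "\<alpha> \<in> R" "aroot \<alpha> k g = 0"
    have "zeros y \<subseteq> zeros g" using g(2) by (auto simp: zeros_def)
    then have "zeros g = zeros y" using y(2) g(1) by blast
    then show "aroot \<alpha> k y = 0" using \<alpha> by (auto simp: zeros_def)
  qed
  then show ?thesis by blast
qed

text \<open>Walking from \<open>g\<close> through \<open>x\<close> beyond \<open>x\<close>, one leaves the closed alcove because the affine
  root \<open>\<gamma> + m\<close> vanishes at \<open>g\<close> but not at \<open>x\<close>; at the point of exit a new affine root vanishes.\<close>

lemma exit_point:
  assumes x: "x \<in> closed_alcove" and g: "g \<in> closed_alcove"
    and sub: "\<And>\<alpha> k. \<alpha> \<in> R \<Longrightarrow> aroot \<alpha> k x = 0 \<Longrightarrow> aroot \<alpha> k g = 0"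
    and \<gamma>: "\<gamma> \<in> R" "aroot \<gamma> m g = 0" "aroot \<gamma> m x \<noteq> 0"
  obtains y where "y \<in> closed_alcove" "aroot \<gamma> m y \<noteq> 0" "zeros x \<subseteq> zeros y" "zeros y \<noteq> zeros x"
proof -
  define P where "P = {\<alpha>\<in>R. pr \<alpha> rho > 0}"
  \<comment> \<open>The inequalities \<open>\<alpha> + 1 \<ge> 0\<close> and
    \<open>- \<alpha> \<ge> 0\<close> for positive roots bound the closed alcove; \<open>T\<close>
    collects those whose left side decreases on the way from \<open>g\<close> to
    \<open>x\<close>.\<close>
  define T where "T = {(\<alpha>, k). (\<alpha> \<in> P \<and> k = 1 \<or> - \<alpha> \<in> P \<and> k = 0) \<and> aroot \<alpha> k x < aroot \<alpha> k g}"
  have closed_iff: "z \<in> closed_alcove \<longleftrightarrow> (\<forall>\<alpha> k. \<alpha> \<in> P \<and> k = 1 \<or> - \<alpha> \<in> P \<and> k = 0 \<longrightarrow> aroot \<alpha> k z \<ge> 0)" for z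
  proof -
    have "(\<forall>\<alpha> k. \<alpha> \<in> P \<and> k = 1 \<or> - \<alpha> \<in> P \<and> k = 0 \<longrightarrow> aroot \<alpha> k z \<ge> 0) \<longleftrightarrow>
        (\<forall>\<alpha>\<in>P. aroot \<alpha> 1 z \<ge> 0 \<and> aroot (- \<alpha>) 0 z \<ge> 0)"
      by (metis minus_minus)
    also have "\<dots> \<longleftrightarrow> z \<in> closed_alcove"
      unfolding closed_alcove_iff P_def affine_root_def pairing_simps by auto
    finally show ?thesis by simp
  qed
  have TR: "\<alpha> \<in> R" if "(\<alpha>, k) \<in> T" for \<alpha> k
    using that minus_root[of "- \<alpha>"] by (auto simp: T_def P_def)
  have "T \<subseteq> (P \<union> uminus ` P) \<times> {0, 1}"
  proof
    fix i assume "i \<in> T"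
    then obtain \<alpha> k where i: "i = (\<alpha>, k)" "\<alpha> \<in> P \<and> k = 1 \<or> - \<alpha> \<in> P \<and> k = 0" by (auto simp: T_def)
    moreover have "\<alpha> = - (- \<alpha>)" by simp
    ultimately show "i \<in> (P \<union> uminus ` P) \<times> {0, 1}" by blast
  qed
  moreover have "finite ((P \<union> uminus ` P) \<times> {0, 1 :: int})" using finite_roots by (simp add: P_def)
  ultimately have fin: "finite T" by (rule finite_subset)
  have ne: "T \<noteq> {}"
  proof -
    have "\<gamma> \<in> P \<or> - \<gamma> \<in> P"
      using \<gamma>(1) minus_root[OF \<gamma>(1)] rho_nonzero[OF \<gamma>(1)] by (auto simp: P_def pairing_simps)
    moreover have "pr \<gamma> x \<noteq> pr \<gamma> g" using \<gamma>(2,3) by (auto simp: affine_root_def)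
    ultimately have "(\<gamma>, 1) \<in> T \<or> (- \<gamma>, 0) \<in> T \<or> (- \<gamma>, 1) \<in> T \<or> (\<gamma>, 0) \<in> T"
      by (auto simp: T_def affine_root_def pairing_simps)
    then show ?thesis by blast
  qed
  define \<tau> where "\<tau> i = (case i of (\<alpha>, k) \<Rightarrow> aroot \<alpha> k x / (aroot \<alpha> k g - aroot \<alpha> k x))" for i
  have "Min (\<tau> ` T) \<in> \<tau> ` T" using fin ne by simp
  then obtain i where i: "i \<in> T" "\<tau> i = Min (\<tau> ` T)" by auto
  have min: "\<tau> i \<le> \<tau> j" if "j \<in> T" for j using i(2) fin that by simp
  obtain \<alpha> k where ik: "i = (\<alpha>, k)" by fastforce
  define t where "t = \<tau> i"
  \<comment> \<open>The parameter \<open>- t\<close> continues the segment past \<open>x\<close>,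
    and \<open>t\<close> is the largest value that violates no inequality in
    \<open>T\<close>.\<close>
  define y where "y = (1 - (- t)) *\<^sub>R x + (- t) *\<^sub>R g"
  have Fy: "aroot \<beta> l y = aroot \<beta> l x - t * (aroot \<beta> l g - aroot \<beta> l x)" for \<beta> l
    unfolding y_def aroot_affine by (simp add: algebra_simps)
  have x0: "aroot \<beta> l x \<ge> 0" if "(\<beta>, l) \<in> T" for \<beta> l
    using x that unfolding closed_iff T_def by blast
  have t: "t \<ge> 0" using i(1) x0[of \<alpha> k] by (simp add: t_def \<tau>_def ik T_def)
  have "aroot \<beta> l y \<ge> 0" if \<beta>: "\<beta> \<in> P \<and> l = 1 \<or> - \<beta> \<in> P \<and> l = 0" for \<beta> l
  proof (cases "(\<beta>, l) \<in> T")
    case True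
    then have "t \<le> aroot \<beta> l x / (aroot \<beta> l g - aroot \<beta> l x)" "aroot \<beta> l x < aroot \<beta> l g"
      using min[OF True] by (auto simp: t_def \<tau>_def T_def)
    then show ?thesis by (simp add: Fy pos_le_divide_eq)
  next
    case False
    then have "aroot \<beta> l g - aroot \<beta> l x \<le> 0" using \<beta> by (auto simp: T_def)
    then have "t * (aroot \<beta> l g - aroot \<beta> l x) \<le> 0" using t by (simp add: mult_le_0_iff)
    moreover have "aroot \<beta> l x \<ge> 0" using x \<beta> unfolding closed_iff by blast
    ultimately show ?thesis by (simp add: Fy)
  qed
  then have "y \<in> closed_alcove" unfolding closed_iff by blast
  moreover have "aroot \<gamma> m y \<noteq> 0"
  proof -
    have "aroot \<gamma> m y = (1 + t) * aroot \<gamma> m x" by (simp add: Fy \<gamma>(2) algebra_simps)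
    then show ?thesis using \<gamma>(3) t by simp
  qed
  moreover have "zeros x \<subseteq> zeros y" using sub by (auto simp: zeros_def Fy)
  moreover have "(\<alpha>, k) \<in> zeros y - zeros x"
  proof -
    have \<alpha>R: "\<alpha> \<in> R" using TR i(1) ik by blast
    have lt: "aroot \<alpha> k x < aroot \<alpha> k g" using i(1) by (simp add: ik T_def)
    then have "aroot \<alpha> k y = 0" by (simp add: Fy t_def \<tau>_def ik)
    moreover have "aroot \<alpha> k x \<noteq> 0" using sub[OF \<alpha>R] lt by force
    ultimately show ?thesis using \<alpha>R by (simp add: zeros_def)
  qed
  then have "zeros y \<noteq> zeros x" by blast
  ultimately show ?thesis by (rule that)
qed

text \<open>A face off the wall lies strictly on one side, and the reflection exchanges the
  sides.\<close>

lemma fixed_face_zero: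
  assumes "is_face F" "is_wall \<alpha> k" "rfl \<alpha> k ` F = F" "y \<in> F"
  shows "aroot \<alpha> k y = 0"
proof (rule ccontr)
  assume "aroot \<alpha> k y \<noteq> 0"
  have \<alpha>: "\<alpha> \<in> R" using assms(2) by (rule wall_root)
  have *: "\<forall>y\<in>F. aroot \<alpha> k y * aroot \<alpha> k base_point > 0"
    using face_sides[OF assms(1) id_symmetry \<alpha>, of k] assms(4) \<open>aroot \<alpha> k y \<noteq> 0\<close> by auto
  have "rfl \<alpha> k y \<in> F" using assms(3,4) by blast
  then have "aroot \<alpha> k (rfl \<alpha> k y) * aroot \<alpha> k base_point > 0" "aroot \<alpha> k y * aroot \<alpha> k base_point > 0"
    using * assms(4) by blast+
  then show False by (simp add: aroot_refl[OF \<alpha>])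
qed

lemma zero_face_fixed: "(\<And>y. y \<in> F \<Longrightarrow> aroot \<alpha> k y = 0) \<Longrightarrow> rfl \<alpha> k ` F = F"
  using refl_fixed by (auto simp: image_iff)

lemma generated_fixes:
  assumes "J \<subseteq> S" "j \<in> generated J" "\<And>s. s \<in> J \<Longrightarrow> s ` F = F"
  shows "j ` F = F"
  using assms(2)
proof (induction j rule: involutions.generated_induct[OF subset_involutions[OF assms(1)], consumes 1, case_names id step])
  case (step s h)
  then show ?case using assms(3) by (metis image_comp)
qed simp

text \<open>The barycentre of the orbit of an interior point under the finite group generated by \<open>J\<close>
  lies on the walls of \<open>J\<close> and on no other wall.\<close>

lemma generic_fixed_point:
  assumes J: "J \<subseteq> S" and a: "a \<in> vertices D" "type_not_in a J"
  obtains q where "q \<in> closed_alcove"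
    "\<And>\<alpha> k. is_wall \<alpha> k \<Longrightarrow> rfl \<alpha> k \<in> J \<Longrightarrow> aroot \<alpha> k q = 0"
    "\<And>\<alpha> k. is_wall \<alpha> k \<Longrightarrow> rfl \<alpha> k \<notin> J \<Longrightarrow> aroot \<alpha> k q \<noteq> 0"
proof -
  interpret J: involutions J using J by (rule subset_involutions)
  let ?G = "generated J"
  have GWa: "g \<in> Wa" if "g \<in> ?G" for g
    using generated_subset[OF J that] Wa_generated_simple by simp
  have Gsym: "g \<in> symmetries" if "g \<in> ?G" for g using GWa[OF that] by (rule Wa_symmetries)
  obtain x\<^sub>0 where x\<^sub>0: "a = facet x\<^sub>0" using vertex_face(2)[OF a(1)] by blast
  have fix0: "g x\<^sub>0 = x\<^sub>0" if "g \<in> ?G" for g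
    using that
  proof (induction g rule: J.generated_induct)
    case (step s h)
    obtain \<alpha> k where s: "is_wall \<alpha> k" "s = rfl \<alpha> k" using step.hyps(1) J unfolding simple_iff[symmetric]
      by (metis simple_iff subsetD)
    have "rfl \<alpha> k ` a = a" using a(2) step.hyps(1) s(2) unfolding type_not_in_def by blast
    then have "aroot \<alpha> k x\<^sub>0 = 0"
      using fixed_face_zero[OF vertex_face(1)[OF a(1)] s(1)] facet_self[of x\<^sub>0] x\<^sub>0 by simp
    then show ?case using step.IH s(2) refl_fixed by simp
  qed simp
  \<comment> \<open>Every \<open>g\<close> fixes \<open>x\<^sub>0\<close>, so the value of a root at
    the image of the base point is determined by a pair of roots; by freeness these values determine
    \<open>g\<close>.\<close>
  have fin: "finite ?G"
  proof (rule inj_on_finite)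
    let ?f = "\<lambda>g. \<lambda>\<alpha>\<in>R. pr \<alpha> (g base_point)"
    let ?V = "(\<lambda>(\<alpha>, \<beta>). pr \<beta> base_point - pr \<beta> x\<^sub>0 + pr \<alpha> x\<^sub>0) ` (R \<times> R)"
    show "inj_on ?f ?G"
    proof (rule inj_onI)
      fix g h assume gh: "g \<in> ?G" "h \<in> ?G" "?f g = ?f h"
      have eq: "aroot \<alpha> k (g base_point) = aroot \<alpha> k (h base_point)" if "\<alpha> \<in> R" for \<alpha> k
        using fun_cong[OF gh(3), of \<alpha>] that by (simp add: affine_root_def)
      let ?i = "inv_into UNIV h"
      have i: "?i \<in> Wa" "bij h" using Wa_inv Wa_bij GWa gh(2) by auto
      have "?i \<circ> g = id"
      proof (rule Wa_free)
        show "?i \<circ> g \<in> Wa" using Wa_comp i(1) GWa gh(1) by blast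
        fix \<alpha> k assume \<alpha>: "\<alpha> \<in> R"
        obtain \<beta> l where \<beta>: "\<beta> \<in> R" "\<And>x. aroot \<alpha> k (?i x) = aroot \<beta> l x"
          using pull_root[OF Wa_symmetries[OF i(1)] \<alpha>] by metis
        have "aroot \<alpha> k base_point = aroot \<beta> l (h base_point)"
          using \<beta>(2)[of "h base_point"] i(2) by (simp add: bij_is_inj)
        then show "\<not> aroot \<alpha> k base_point * aroot \<alpha> k ((?i \<circ> g) base_point) < 0"
          using eq[OF \<beta>(1)] by (simp add: \<beta>(2) not_less)
      qed
      then show "g = h" using comp_inv(1)[OF i(2)] by (metis comp_assoc comp_id id_comp)
    qed
    show "?f ` ?G \<subseteq> R \<rightarrow>\<^sub>E ?V"
    proof clarify
      fix g assume g: "g \<in> ?G"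
      show "?f g \<in> R \<rightarrow>\<^sub>E ?V"
      proof (rule restrict_PiE_iff[THEN iffD2], rule ballI)
        fix \<alpha> assume \<alpha>: "\<alpha> \<in> R"
        obtain \<beta> l where \<beta>: "\<beta> \<in> R" "\<And>x. aroot \<alpha> 0 (g x) = aroot \<beta> l x"
          using pull_root[OF Gsym[OF g] \<alpha>] by metis
        have "pr \<alpha> (g base_point) = pr \<beta> base_point - pr \<beta> x\<^sub>0 + pr \<alpha> x\<^sub>0"
          using \<beta>(2)[of base_point] \<beta>(2)[of x\<^sub>0] fix0[OF g] by (simp add: affine_root_def)
        then show "pr \<alpha> (g base_point) \<in> ?V" using \<alpha> \<beta>(1) by (intro image_eqI[of _ _ "(\<alpha>, \<beta>)"]) auto
      qed
    qed
    show "finite (R \<rightarrow>\<^sub>E ?V)" using finite_roots by (intro finite_PiE) auto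
  qed
  define n where "n = real (card ?G)"
  have n: "n > 0" using fin J.generated_id by (auto simp: n_def card_gt_0_iff)
  define q where "q = (1 / n) *\<^sub>R (\<Sum>g\<in>?G. g base_point)"
  have Fq: "n * aroot \<alpha> k q = (\<Sum>g\<in>?G. aroot \<alpha> k (g base_point))" for \<alpha> k
    using n by (simp add: q_def affine_root_def pairing_simps linear_sum[OF linear_pairing(1)]
        sum.distrib n_def[symmetric] field_simps)
  have in_J: "aroot \<alpha> k q = 0" if w: "is_wall \<alpha> k" "rfl \<alpha> k \<in> J" for \<alpha> k
  proof -
    have \<alpha>: "\<alpha> \<in> R" using w(1) by (rule wall_root)
    have inv: "rfl \<alpha> k \<circ> (rfl \<alpha> k \<circ> g) = g" for g
      using refl_involution[OF \<alpha>] by (metis comp_assoc id_comp)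
    have "(\<Sum>g\<in>?G. aroot \<alpha> k (g base_point)) = (\<Sum>g\<in>?G. aroot \<alpha> k ((rfl \<alpha> k \<circ> g) base_point))"
      by (rule sum.reindex_bij_witness[of _ "\<lambda>g. rfl \<alpha> k \<circ> g" "\<lambda>g. rfl \<alpha> k \<circ> g"])
        (simp_all only: inv J.generated_left[OF w(2)])
    also have "\<dots> = - (\<Sum>g\<in>?G. aroot \<alpha> k (g base_point))" by (simp add: aroot_refl[OF \<alpha>] sum_negf)
    finally show ?thesis using Fq[of \<alpha> k] n by simp
  qed
  \<comment> \<open>If an element of the group crossed a wall outside \<open>J\<close>, the
    reflection in it would lie in the group, and its descent in \<open>J\<close> could only be that
    wall.\<close>
  have not_J: "aroot \<alpha> k (g base_point) * aroot \<alpha> k base_point > 0"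
    if w: "is_wall \<alpha> k" "rfl \<alpha> k \<notin> J" and g: "g \<in> ?G" for \<alpha> k g
  proof (rule ccontr)
    assume neg: "\<not> ?thesis"
    have \<alpha>: "\<alpha> \<in> R" using w(1) by (rule wall_root)
    obtain ss where ss: "set ss \<subseteq> J" "g = foldr (\<circ>) ss id" using g J.generated_words by auto
    have "aroot \<alpha> k base_point * aroot \<alpha> k (foldr (\<circ>) ss id base_point) < 0"
      using neg ss(2) aroot_base_point_nonzero[OF \<alpha>, of k] aroot_base_point_sym[OF Gsym[OF g] \<alpha>, of k]
      by (simp add: not_less order_le_less mult.commute)
    moreover have "set ss \<subseteq> S" using ss(1) J by blast
    ultimately obtain us t vs where us: "ss = us @ t # vs" "rfl \<alpha> k \<circ> foldr (\<circ>) us id = foldr (\<circ>) us id \<circ> t"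
      using word_crosses[OF _ \<alpha>] by blast
    let ?u = "foldr (\<circ>) us id"
    have u: "?u \<in> ?G" using us(1) ss(1) unfolding J.generated_words by auto
    have tJ: "t \<in> J" using us(1) ss(1) by auto
    have "rfl \<alpha> k = ?u \<circ> t \<circ> inv_into UNIV ?u"
      using us(2) comp_inv(1)[OF J.generated_bij[OF u]] by (metis comp_assoc comp_id)
    then have "rfl \<alpha> k \<in> ?G"
      using J.generated_comp[OF J.generated_comp[OF u J.generated_base[OF tJ]] J.generated_inv[OF u]] by simp
    moreover have "rfl \<alpha> k \<noteq> id"
    proof
      assume "rfl \<alpha> k = id"
      then have "rfl \<alpha> k base_point = base_point" by simp
      then show False
        using aroot_refl[OF \<alpha>, of k base_point] aroot_base_point_nonzero[OF \<alpha>, of k] by simp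
    qed
    ultimately obtain \<beta> l where \<beta>: "is_wall \<beta> l" "rfl \<beta> l \<in> J"
      "aroot \<beta> l base_point * aroot \<beta> l (rfl \<alpha> k base_point) < 0"
      using generated_descent[OF J] by blast
    then have "\<beta> = \<alpha> \<and> l = k \<or> \<beta> = - \<alpha> \<and> l = - k"
      using wall_separates_only[OF w(1) wall_root[OF \<beta>(1)], of l] by simp
    then show False using \<beta>(2) w(2) refl_minus[OF \<alpha>] by auto
  qed
  have pos: "aroot \<alpha> k q * aroot \<alpha> k base_point > 0" if w: "is_wall \<alpha> k" "rfl \<alpha> k \<notin> J" for \<alpha> k
  proof -
    have "(\<Sum>g\<in>?G. aroot \<alpha> k (g base_point) * aroot \<alpha> k base_point) > 0"
      using fin J.generated_id not_J[OF w] by (intro sum_pos) blast+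
    then have "n * (aroot \<alpha> k q * aroot \<alpha> k base_point) > 0"
      unfolding sum_distrib_right[symmetric] Fq[symmetric] by (simp add: mult.assoc)
    then show ?thesis using n by (simp add: zero_less_mult_iff)
  qed
  have "q \<in> closed_alcove"
  proof (rule ccontr)
    assume "q \<notin> closed_alcove"
    then obtain \<alpha> k where "\<alpha> \<in> R" "aroot \<alpha> k base_point * aroot \<alpha> k q < 0"
      by (auto simp: closed_alcove_def not_le mult.commute)
    then obtain \<beta> l where \<beta>: "is_wall \<beta> l" "aroot \<beta> l base_point * aroot \<beta> l q < 0"
      using separating_wall by metis
    then show False using in_J[OF \<beta>(1)] pos[OF \<beta>(1)] by (cases "rfl \<beta> l \<in> J") (auto simp: mult.commute)
  qed
  moreover have "aroot \<alpha> k q \<noteq> 0" if "is_wall \<alpha> k" "rfl \<alpha> k \<notin> J" for \<alpha> k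
    using pos[OF that] by auto
  ultimately show ?thesis using that in_J by blast
qed

text \<open>Among the points on all walls of \<open>J\<close> but off the wall of \<open>s\<close>,
  one with a maximal set of zeros is a vertex: a point with more zeros would have to lie on the wall
  of \<open>s\<close>, and then \<open>exit_point\<close> contradicts maximality.\<close>

lemma separating_vertex:
  assumes J: "J \<subseteq> S" "a \<in> vertices D" "type_not_in a J" and s: "s \<in> S" "s \<notin> J"
  shows "\<exists>v\<in>vertices D. type_not_in v J \<and> s ` v \<noteq> v"
proof -
  obtain \<gamma> m where \<gamma>: "is_wall \<gamma> m" "s = rfl \<gamma> m" using s(1) simple_iff by blast
  obtain q where q: "q \<in> closed_alcove"
    "\<And>\<alpha> k. is_wall \<alpha> k \<Longrightarrow> rfl \<alpha> k \<in> J \<Longrightarrow> aroot \<alpha> k q = 0"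
    "\<And>\<alpha> k. is_wall \<alpha> k \<Longrightarrow> rfl \<alpha> k \<notin> J \<Longrightarrow> aroot \<alpha> k q \<noteq> 0"
    using generic_fixed_point[OF J] by metis
  let ?Q = "\<lambda>x. x \<in> closed_alcove \<and> (\<forall>\<alpha> k. is_wall \<alpha> k \<longrightarrow> rfl \<alpha> k \<in> J \<longrightarrow> aroot \<alpha> k x = 0) \<and> aroot \<gamma> m x \<noteq> 0"
  have "?Q q" using q \<gamma> s(2) by blast
  then obtain x where x: "?Q x" "\<And>z. ?Q z \<Longrightarrow> zeros x \<subseteq> zeros z \<Longrightarrow> zeros z = zeros x"
    using zeros_maximal[of ?Q q] by (metis (no_types, lifting))
  have Q: "?Q z" if "z \<in> closed_alcove" "aroot \<gamma> m z \<noteq> 0" "zeros x \<subseteq> zeros z" for z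
    using that x(1) wall_root unfolding zeros_def by blast
  have "facet x \<in> vertices D"
  proof (rule vertexI)
    show "x \<in> closed_alcove" using x(1) by blast
    fix g \<alpha> k
    assume g: "g \<in> closed_alcove" "\<And>\<alpha> k. \<alpha> \<in> R \<Longrightarrow> aroot \<alpha> k x = 0 \<Longrightarrow> aroot \<alpha> k g = 0"
      and \<alpha>: "\<alpha> \<in> R" "aroot \<alpha> k g = 0"
    have sub: "zeros x \<subseteq> zeros g" using g(2) by (auto simp: zeros_def)
    show "aroot \<alpha> k x = 0"
    proof (cases "aroot \<gamma> m g = 0")
      case True
      then obtain y where "y \<in> closed_alcove" "aroot \<gamma> m y \<noteq> 0" "zeros x \<subseteq> zeros y" "zeros y \<noteq> zeros x"
        using exit_point[OF _ g(1) g(2) wall_root[OF \<gamma>(1)] True] x(1) by blast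
      then show ?thesis using x(2) Q by blast
    next
      case False
      then have "zeros g = zeros x" using x(2)[OF Q[OF g(1) False sub] sub] by blast
      then show ?thesis using \<alpha> by (auto simp: zeros_def)
    qed
  qed
  moreover have "type_not_in (facet x) J"
    unfolding type_not_in_def
  proof
    fix t assume t: "t \<in> J"
    then obtain \<alpha> k where \<alpha>: "is_wall \<alpha> k" "t = rfl \<alpha> k" using J(1) simple_iff by blast
    then have "aroot \<alpha> k x = 0" using x(1) t by blast
    then have "\<And>y. y \<in> facet x \<Longrightarrow> aroot \<alpha> k y = 0" using facet_zero wall_root[OF \<alpha>(1)] by blast
    then show "t ` facet x = facet x" unfolding \<alpha>(2) by (rule zero_face_fixed)
  qed
  moreover have "s ` facet x \<noteq> facet x"
  proof
    assume "s ` facet x = facet x"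
    then have "aroot \<gamma> m x = 0"
      using fixed_face_zero[OF vertex_face(1)[OF \<open>facet x \<in> vertices D\<close>] \<gamma>(1)] \<gamma>(2) facet_self by blast
    then show False using x(1) by blast
  qed
  ultimately show ?thesis by blast
qed

text \<open>A hyperplane that separates the alcove of \<open>g\<close> from the base alcove contains
  every face common to both, so each simple reflection met on the way back fixes these
  faces.\<close>

lemma stabilizer_of_faces:
  assumes "\<And>v. v \<in> V \<Longrightarrow> is_face v" "g \<in> Wa" "\<And>v. v \<in> V \<Longrightarrow> g ` v = v"
  shows "g \<in> generated {s\<in>S. \<forall>v\<in>V. s ` v = v}"
proof -
  let ?T = "{s\<in>S. \<forall>v\<in>V. s ` v = v}"
  interpret T: involutions ?T by (rule subset_involutions) blast
  show ?thesis
    using assms(2,3)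
  proof (induction "separation (g base_point) base_point" arbitrary: g rule: less_induct)
    case less
    show ?case
    proof (cases "g = id")
      case True
      then show ?thesis using T.generated_id by simp
    next
      case False
      then obtain \<alpha>\<^sub>0 k\<^sub>0 where "\<alpha>\<^sub>0 \<in> R" "aroot \<alpha>\<^sub>0 k\<^sub>0 (g base_point) * aroot \<alpha>\<^sub>0 k\<^sub>0 base_point < 0"
        using Wa_free[OF less.prems(1)] by (metis mult.commute)
      from separating_adjacent[OF Wa_symmetries[OF less.prems(1)] this]
      obtain s \<alpha> k where s: "s \<in> S" "adjacent (g base_point) (g (s base_point)) \<alpha> k" "rfl \<alpha> k \<circ> g = g \<circ> s"
        "aroot \<alpha> k (g base_point) * aroot \<alpha> k base_point < 0" by metis
      have \<alpha>: "\<alpha> \<in> R" using s(2) by (simp add: adjacent_def)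
      have sv: "s ` v = v" if v: "v \<in> V" for v
      proof -
        have "aroot \<alpha> k y = 0" if y: "y \<in> v" for y
        proof (rule ccontr)
          assume nz: "aroot \<alpha> k y \<noteq> 0"
          have "y \<in> g ` v" using y less.prems(2)[OF v] by simp
          then have "aroot \<alpha> k y * aroot \<alpha> k (g base_point) > 0"
            using face_sides[OF assms(1)[OF v] Wa_symmetries[OF less.prems(1)] \<alpha>, of k] nz by blast
          moreover have "aroot \<alpha> k y * aroot \<alpha> k base_point > 0"
            using face_sides[OF assms(1)[OF v] id_symmetry \<alpha>, of k] nz y by auto
          ultimately show False using s(4) by (auto simp: zero_less_mult_iff mult_less_0_iff)
        qed
        then have "rfl \<alpha> k ` v = v" by (rule zero_face_fixed)
        then have "g ` s ` v = g ` v" using s(3) less.prems(2)[OF v] by (metis image_comp)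
        then show ?thesis using Wa_bij[OF less.prems(1)] by (simp add: bij_is_inj inj_image_eq_iff)
      qed
      have sT: "s \<in> ?T" using s(1) sv by blast
      have "(g \<circ> s) ` v = v" if "v \<in> V" for v
        using sv[OF that] less.prems(2)[OF that] by (metis image_comp)
      moreover have "g \<circ> s \<in> Wa" using Wa_comp[OF less.prems(1) Wa_simple[OF s(1)]] .
      ultimately have "g \<circ> s \<in> generated ?T"
        using less.hyps[of "g \<circ> s"] separation_adjacent[OF s(2,4)] by simp
      then have "(g \<circ> s) \<circ> s \<in> generated ?T" using T.generated_comp T.generated_base[OF sT] by blast
      then show ?thesis using simple.involution[OF s(1)] by (simp only: comp_assoc comp_id)
    qed
  qed
qed

section \<open>Comparison at vertices\<close>

context
  fixes \<mu> and J :: "('v \<Rightarrow> 'v) set"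
  assumes \<mu>: "\<mu> \<in> cocharacters D" and J: "J \<subseteq> S"
begin

text \<open>Deodhar's lemma: comparability modulo \<open>J\<close> can be tested modulo the maximal parabolic
  subgroups that contain \<open>J\<close>, here the stabilizers of the vertices of type not in \<open>J\<close>.\<close>

lemma vertexwise_comparison:
  assumes a: "a \<in> vertices D" "type_not_in a J"
  shows "u \<in> Wa \<Longrightarrow> x \<in> affine_coset D \<mu> \<Longrightarrow> y \<in> affine_coset D \<mu> \<Longrightarrow>
    (\<And>v. v \<in> vertices D \<Longrightarrow> type_not_in v J \<Longrightarrow> below (seen_from (u base_point)) (x ` v) (y ` v)) \<Longrightarrow>
    \<exists>j\<in>generated J. below (seen_from (u base_point)) ((x \<circ> j) ` base_alcove D) (y ` base_alcove D)"
proof (induction "separation (u base_point) (y base_point)" arbitrary: u x rule: less_induct)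
  case less
  let ?b = "u base_point"
  have xsym: "x \<in> symmetries" and ysym: "y \<in> symmetries"
    using less.prems coset_symmetries[OF \<mu>] by auto
  show ?case
  proof (cases "\<exists>\<alpha>\<in>R. \<exists>k. aroot \<alpha> k ?b * aroot \<alpha> k (y base_point) < 0")
    case False
    define V where "V = {v\<in>vertices D. type_not_in v J}"
    have face: "is_face v" if "v \<in> V" for v using that vertex_face(1) by (simp add: V_def)
    \<comment> \<open>No hyperplane separates \<open>?b\<close> from \<open>y\<close>, whereas the
      end of a step lies across a hyperplane from \<open>?b\<close>. So no step ends at a vertex of
      the alcove of \<open>y\<close>, and the chain is empty.\<close>
    have eq: "x ` v = y ` v" if v: "v \<in> V" for v
    proof (rule ccontr)
      assume "x ` v \<noteq> y ` v"
      moreover have "below (seen_from ?b) (x ` v) (y ` v)" using less.prems(4) v by (simp add: V_def)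
      ultimately obtain Z where "step (seen_from ?b) Z (y ` v)" by (metis rtranclp.cases)
      then obtain \<alpha> k where \<alpha>: "\<alpha> \<in> R" "y ` v = rfl \<alpha> k ` Z" "\<forall>z\<in>Z. aroot \<alpha> k z * aroot \<alpha> k ?b > 0"
        unfolding step_def seen_from_def by blast
      obtain z where z: "z \<in> v" using v vertex_face(2) facet_self unfolding V_def by blast
      then obtain z' where z': "z' \<in> Z" "y z = rfl \<alpha> k z'" using \<alpha>(2) by blast
      then have "aroot \<alpha> k z' * aroot \<alpha> k ?b > 0" "aroot \<alpha> k (y z) = - aroot \<alpha> k z'"
        using \<alpha>(3) aroot_refl[OF \<alpha>(1)] by auto
      moreover have "aroot \<alpha> k (y z) * aroot \<alpha> k (y base_point) > 0"
        using face_sides[OF face[OF v] ysym \<alpha>(1), of k] z calculation by auto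
      ultimately have "aroot \<alpha> k ?b * aroot \<alpha> k (y base_point) < 0"
        by (auto simp: zero_less_mult_iff mult_less_0_iff)
      then show False using False \<alpha>(1) by blast
    qed
    let ?g = "inv_into UNIV x \<circ> y"
    have bij: "bij x" using xsym by (rule symmetries_bij)
    have gv: "?g ` v = v" if "v \<in> V" for v
    proof -
      have "?g ` v = inv_into UNIV x ` x ` v" unfolding eq[OF that] by (rule image_comp[symmetric])
      then show ?thesis using bij by (simp add: bij_is_inj)
    qed
    have mem: "?g \<in> generated {s\<in>S. \<forall>v\<in>V. s ` v = v}"
      by (rule stabilizer_of_faces[OF face coset_right_diff[OF \<mu> less.prems(2,3)] gv])
    have sub: "{s\<in>S. \<forall>v\<in>V. s ` v = v} \<subseteq> J"
    proof clarify
      fix s assume s: "s \<in> S" "\<forall>v\<in>V. s ` v = v"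
      show "s \<in> J"
      proof (rule ccontr)
        assume "s \<notin> J"
        then obtain v where "v \<in> V" "s ` v \<noteq> v"
          using separating_vertex[OF J a s(1)] unfolding V_def by auto
        then show False using s(2) by blast
      qed
    qed
    have "?g \<in> generated J"
      unfolding generated_def
      by (rule subsetD[OF group.mono_generate[OF group_BijGroup sub] mem[unfolded generated_def]])
    moreover have "x \<circ> ?g = y" using comp_inv(1)[OF bij] by (metis comp_assoc id_comp)
    ultimately show ?thesis by (intro bexI[of _ ?g]) (simp_all only: rtranclp.rtrancl_refl)
  next
    case True
    then obtain \<alpha>\<^sub>0 k\<^sub>0 where "\<alpha>\<^sub>0 \<in> R" "aroot \<alpha>\<^sub>0 k\<^sub>0 ?b * aroot \<alpha>\<^sub>0 k\<^sub>0 (y base_point) < 0" by blast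
    from separating_adjacent[OF Wa_symmetries[OF less.prems(1)] this]
    obtain s \<alpha> k where s: "s \<in> S" "adjacent ?b (u (s base_point)) \<alpha> k"
      "aroot \<alpha> k ?b * aroot \<alpha> k (y base_point) < 0" by metis
    let ?b' = "u (s base_point)" and ?s = "rfl \<alpha> k"
    have \<alpha>: "\<alpha> \<in> R" "?b' = ?s ?b" using s(2) by (auto simp: adjacent_def)
    have us: "u \<circ> s \<in> Wa" using Wa_comp[OF less.prems(1) Wa_simple[OF s(1)]] .
    have closer: "separation ((u \<circ> s) base_point) (y base_point) < separation ?b (y base_point)"
      using separation_adjacent[OF s(2,3)] by simp
    have b': "aroot \<alpha> k ?b' = - aroot \<alpha> k ?b" using aroot_refl[OF \<alpha>(1)] \<alpha>(2) by simp
    have "aroot \<alpha> k (y base_point) * aroot \<alpha> k ?b' > 0" using s(3) by (simp add: b' mult.commute)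
    then have "below (seen_from ?b) (?s ` y ` base_alcove D) (y ` base_alcove D)"
    proof -
      assume yb': "aroot \<alpha> k (y base_point) * aroot \<alpha> k ?b' > 0"
      have "aroot \<alpha> k z * aroot \<alpha> k ?b > 0" if z: "z \<in> ?s ` y ` base_alcove D" for z
      proof -
        obtain z' where z': "z = ?s z'" "z' \<in> y ` base_alcove D" using z by blast
        have "aroot \<alpha> k z' * aroot \<alpha> k ?b' > 0"
          using alcove_side[OF ysym \<alpha>(1) z'(2)] yb' by (rule mult_pos_trans(1))
        then show ?thesis using z'(1) b' aroot_refl[OF \<alpha>(1)] by simp
      qed
      then have "step (seen_from ?b) (?s ` y ` base_alcove D) (y ` base_alcove D)"
        unfolding step_def seen_from_def using \<alpha>(1) refl_image_image[OF \<alpha>(1)] by metis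
      then show ?thesis by blast
    qed
    \<comment> \<open>For the way back from the new base point: \<open>y\<close> lies above its
      mirror image as seen from \<open>?b\<close>, so comparisons with \<open>y\<close> return
      together with their mirror images.\<close>
    note down = base_change_down[OF adjacent_sym[OF s(2)] _ rtranclp.rtrancl_refl this]
    show ?thesis
    \<comment> \<open>As seen from the new base point, the lower one of \<open>x\<close> and its
      mirror image is compared with \<open>y\<close>; the way back recovers \<open>x\<close> in
      either case.\<close>
    proof (cases "aroot \<alpha> k (x base_point) * aroot \<alpha> k ?b' > 0")
      case True
      have "below (seen_from ?b') (x ` v) (y ` v)" if v: "v \<in> vertices D" "type_not_in v J" for v
        using base_change_up[OF s(2) less.prems(4)[OF v] rtranclp.rtrancl_refl
            face_near_side[OF vertex_face(1)[OF v(1)] xsym adjacent_sym[OF s(2)] True]] by blast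
      then obtain j where j: "j \<in> generated J"
        "below (seen_from ?b') ((x \<circ> j) ` base_alcove D) (y ` base_alcove D)"
        using less.hyps[OF closer us less.prems(2,3)] by auto
      then show ?thesis using down by blast
    next
      case False
      let ?x = "?s \<circ> x"
      have xC: "?x \<in> affine_coset D \<mu>" using coset_left[OF \<mu> Wa_refl[OF \<alpha>(1)] less.prems(2)] .
      then have x'sym: "?x \<in> symmetries" by (rule coset_symmetries[OF \<mu>])
      have "aroot \<alpha> k (?x base_point) * aroot \<alpha> k ?b' > 0"
        using False aroot_base_point_sym[OF xsym \<alpha>(1), of k] aroot_base_point_sym[OF Wa_symmetries[OF us] \<alpha>(1), of k]
        by (simp add: aroot_refl[OF \<alpha>(1)] not_less order_le_less)
      then have "below (seen_from ?b') (?x ` v) (y ` v)" if v: "v \<in> vertices D" "type_not_in v J" for v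
      proof -
        assume *: "aroot \<alpha> k (?x base_point) * aroot \<alpha> k ?b' > 0"
        have "?s ` ?x ` v = x ` v" using \<alpha>(1) by (simp add: image_image)
        then have "below (seen_from ?b') (?x ` v) (x ` v)"
          using face_near_side[OF vertex_face(1)[OF v(1)] x'sym adjacent_sym[OF s(2)] *] by simp
        moreover have "?s ` x ` v = ?x ` v" by (simp add: image_image)
        ultimately show ?thesis
          using base_change_up[OF s(2) less.prems(4)[OF v], of "?x ` v"] by simp
      qed
      then obtain j where j: "j \<in> generated J"
        "below (seen_from ?b') ((?x \<circ> j) ` base_alcove D) (y ` base_alcove D)"
        using less.hyps[OF closer us xC less.prems(3)] by auto
      have "?s ` (?x \<circ> j) ` base_alcove D = (x \<circ> j) ` base_alcove D"
        using \<alpha>(1) by (simp add: image_image)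
      then show ?thesis using down[OF j(2)] j(1) by metis
    qed
  qed
qed

end

section \<open>Admissible and permissible sets\<close>

context
  fixes \<mu>
  assumes \<mu>: "\<mu> \<in> cocharacters D" and dom: "\<mu> \<in> closure (dominant_chamber D)"
begin

abbreviation "A \<equiv> base_alcove D"
abbreviation "coset \<equiv> affine_coset D \<mu>"

lemma Adm_st_iff:
  "x \<in> Adm_st D \<mu> \<longleftrightarrow> x \<in> coset \<and> (\<forall>w\<in>W. below (against (w rho)) (x ` A) (transl (w \<mu>) ` A))"
  using W_id by (auto simp: Adm_st_def alcove_cone_def opposite_reach_eq)

lemma Perm_st_J_iff:
  "x \<in> Perm_st_J D J \<mu> \<longleftrightarrow> x \<in> coset \<and> (\<forall>v\<in>vertices D. type_not_in v J \<longrightarrow>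
    (\<forall>w\<in>W. below (against (w rho)) (x ` v) (transl (w \<mu>) ` v)))"
  by (auto simp: Perm_st_J_def opposite_reach_eq)

text \<open>If a reflection moves a set away from the base alcove but not in the direction of the
  chamber of \<open>w\<close>, then one uses the reflected chamber and reflects the whole chain.\<close>

lemma admissible_closed:
  assumes "below (seen_from base_point) X Y"
    and "\<forall>w\<in>W. below (against (w rho)) Y (transl (w \<mu>) ` A)"
  shows "\<forall>w\<in>W. below (against (w rho)) X (transl (w \<mu>) ` A)"
  using assms
proof (induction rule: converse_rtranclp_induct)
  case (step X Z)
  obtain \<alpha> k where \<alpha>: "\<alpha> \<in> R" "Z = rfl \<alpha> k ` X" "\<forall>x\<in>X. aroot \<alpha> k x * aroot \<alpha> k base_point > 0"
    using step.hyps(1) unfolding step_def seen_from_def by blast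
  have IH: "\<forall>w\<in>W. below (against (w rho)) Z (transl (w \<mu>) ` A)" using step.IH step.prems by blast
  have p: "aroot \<alpha> k base_point \<noteq> 0" using aroot_base_point_nonzero[OF \<alpha>(1)] .
  show ?case
  proof
    fix w assume w: "w \<in> W"
    have c: "pr \<alpha> (w rho) \<noteq> 0" using W_rho(2)[OF w \<alpha>(1)] .
    show "below (against (w rho)) X (transl (w \<mu>) ` A)"
    proof (cases "aroot \<alpha> k base_point * - pr \<alpha> (w rho) > 0")
      case True
      then have "step (against (w rho)) X Z"
        unfolding step_def against_def using \<alpha> mult_pos_trans(1) by blast
      then show ?thesis using IH w by (meson converse_rtranclp_into_rtranclp)
    next
      case False
      let ?w = "rfl \<alpha> 0 \<circ> w"
      have w': "?w \<in> W" using W_comp[OF W_refl[OF \<alpha>(1)] w] .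
      have w'w: "rfl \<alpha> 0 (?w x) = w x" for x using \<alpha>(1) by simp
      have "below (against (rfl \<alpha> 0 (?w rho))) (rfl \<alpha> k ` Z) (rfl \<alpha> k ` transl (?w \<mu>) ` A)"
        using IH w' by (intro below_against_image[OF equivariant_refl[OF \<alpha>(1)]]) blast
      then have "below (against (w rho)) X (transl (w \<mu>) ` rfl \<alpha> k ` A)"
        unfolding w'w using \<alpha>(1,2) by (simp add: image_image refl_transl w'w[unfolded comp_apply])
      \<comment> \<open>The reflected chain ends at the translate of the mirror image of the base
        alcove. In this case the base alcove lies on the plus side for \<open>w\<close>, so its
        mirror image is one step below it.\<close>
      moreover have "below (against (w rho)) (transl (w \<mu>) ` rfl \<alpha> k ` A) (transl (w \<mu>) ` A)"
      proof (rule below_against_image[OF equivariant_transl])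
        show "pr \<beta> (w \<mu>) \<in> \<int>" if "\<beta> \<in> R" for \<beta>
          using pairing_int[OF roots_characters[OF that] W_cocharacters[OF w \<mu>]] .
        have "aroot \<alpha> k (rfl \<alpha> k x) * - pr \<alpha> (w rho) > 0" if "x \<in> A" for x
        proof -
          have "aroot \<alpha> k x * aroot \<alpha> k base_point > 0"
            using aroot_same_sign[OF that base_point_in \<alpha>(1)] .
          moreover have "aroot \<alpha> k base_point * pr \<alpha> (w rho) > 0"
            using False p c by (simp add: not_less order_le_less)
          ultimately have "aroot \<alpha> k x * pr \<alpha> (w rho) > 0" by (rule mult_pos_trans(1))
          then show ?thesis by (simp add: aroot_refl[OF \<alpha>(1)])
        qed
        then have "step (against (w rho)) (rfl \<alpha> k ` A) A"
          unfolding step_def against_def using \<alpha>(1)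
          by (intro bexI[of _ \<alpha>] exI[of _ k]) auto
        then show "below (against (w rho)) (rfl \<alpha> k ` A) A" by blast
      qed
      ultimately show ?thesis by (rule rtranclp_trans)
    qed
  qed
qed blast

lemma Adm_imp_Adm_st: "x \<in> Adm D \<mu> \<Longrightarrow> x \<in> Adm_st D \<mu>"
  unfolding Adm_iff[OF \<mu>] Adm_st_iff using admissible_closed orbit_below[OF _ _ \<mu> dom] by blast

text \<open>The chamber is chosen such that it contains the displacement of the base point by \<open>x\<close>.
  Then no hyperplane crossed on the way to the depth of the opposite chamber separates the base
  alcove from its image under \<open>x\<close>.\<close>

lemma acute_chamber:
  obtains w where "w \<in> W"
    "\<And>F Y. is_face F \<Longrightarrow> x \<in> coset \<Longrightarrow> below (against (w rho)) (x ` F) Y \<Longrightarrow>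
      below (seen_from base_point) (x ` F) Y"
proof -
  obtain w where w: "w \<in> W" "\<forall>\<alpha>\<in>R. pr \<alpha> (w rho) > 0 \<longrightarrow> pr \<alpha> (x base_point - base_point) \<ge> 0"
    using chamber_exists by blast
  show ?thesis
  proof (rule that[OF w(1)])
    fix F Y assume F: "is_face F" "x \<in> coset" "below (against (w rho)) (x ` F) Y"
    show "below (seen_from base_point) (x ` F) Y"
      using against_imp_bruhat[OF F(3,1) coset_symmetries[OF \<mu> F(2)] W_rho(1)[OF w(1)]] w(2) by blast
  qed
qed

lemma transl_Adm: "transl \<mu> \<in> Adm D \<mu>"
  unfolding Adm_iff[OF \<mu>] using transl_coset[OF \<mu>] W_id
  by (intro conjI bexI[of _ id]) simp_all

section \<open>Multiplication by the group generated by \<open>J\<close>\<close>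

context
  fixes J assumes J: "J \<subseteq> S"
begin

interpretation J: involutions J
  using J by (rule subset_involutions)

lemma generated_J_Wa: "j \<in> generated J \<Longrightarrow> j \<in> Wa"
  using generated_subset[OF J] Wa_generated_simple by simp

text \<open>The factor \<open>j\<close> may depend on \<open>w\<close>; this weakening of
  \<open>Adm_st\<close> is stable under left multiplication, and a single well chosen
  \<open>w\<close> leads back to \<open>Adm\<close> in \<open>coset_Adm_imp_Adm\<close>.\<close>

definition coset_Adm :: "('v \<Rightarrow> 'v) set" where
  "coset_Adm = {x\<in>coset. \<forall>w\<in>W. \<exists>j\<in>generated J.
     below (against (w rho)) (x ` A) (transl (w \<mu>) ` j ` A)}"

lemma Adm_sub_coset_Adm: "Adm D \<mu> \<subseteq> coset_Adm"
proof
  fix x assume "x \<in> Adm D \<mu>"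
  then have "x \<in> coset \<and> (\<forall>w\<in>W. below (against (w rho)) (x ` A) (transl (w \<mu>) ` id ` A))"
    using Adm_imp_Adm_st Adm_st_iff by simp
  then show "x \<in> coset_Adm" unfolding coset_Adm_def using J.generated_id by blast
qed

text \<open>Applying \<open>s\<close> turns the chain given for the reflected chamber into one for
  \<open>w\<close>, and the \<open>s\<close> that remains behind the translation is absorbed by
  \<open>j\<close>.\<close>

lemma coset_Adm_left:
  assumes "g \<in> generated J" "x \<in> coset_Adm"
  shows "g \<circ> x \<in> coset_Adm"
  using assms(1)
proof (induction g rule: J.generated_induct)
  case id
  then show ?case using assms(2) by (simp only: id_comp)
next
  case (step s h)
  let ?x = "h \<circ> x"
  obtain \<alpha> k where \<alpha>: "is_wall \<alpha> k" "s = rfl \<alpha> k"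
    using step.hyps(1) J simple_iff by (metis subsetD)
  have \<alpha>R: "\<alpha> \<in> R" using wall_root[OF \<alpha>(1)] .
  have x: "?x \<in> coset" using step.IH unfolding coset_Adm_def by blast
  have "\<exists>j\<in>generated J. below (against (w rho)) ((s \<circ> ?x) ` A) (transl (w \<mu>) ` j ` A)"
    if w: "w \<in> W" for w
  proof -
    let ?w = "rfl \<alpha> 0 \<circ> w"
    have w': "?w \<in> W" using W_comp[OF W_refl[OF \<alpha>R] w] .
    have w'w: "rfl \<alpha> 0 (?w x) = w x" for x using \<alpha>R by simp
    obtain j where j: "j \<in> generated J" "below (against (?w rho)) (?x ` A) (transl (?w \<mu>) ` j ` A)"
      using step.IH w' unfolding coset_Adm_def by blast
    have "below (against (rfl \<alpha> 0 (?w rho))) (s ` ?x ` A) (s ` transl (?w \<mu>) ` j ` A)"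
      unfolding \<alpha>(2) using j(2) by (rule below_against_image[OF equivariant_refl[OF \<alpha>R]])
    moreover have "s ` transl (?w \<mu>) ` j ` A = transl (w \<mu>) ` (s \<circ> j) ` A"
      unfolding \<alpha>(2) by (simp add: image_image refl_transl w'w[unfolded comp_apply])
    moreover have "s ` ?x ` A = (s \<circ> ?x) ` A" by (rule image_comp)
    ultimately have "below (against (w rho)) ((s \<circ> ?x) ` A) (transl (w \<mu>) ` (s \<circ> j) ` A)"
      unfolding w'w by simp
    then show ?thesis using J.generated_left[OF step.hyps(1) j(1)] by blast
  qed
  moreover have "s \<circ> ?x \<in> coset" unfolding \<alpha>(2) using coset_left[OF \<mu> Wa_refl[OF \<alpha>R] x] .
  ultimately show ?case unfolding coset_Adm_def comp_assoc by blast
qed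

text \<open>\<open>right_lift\<close> moves the factor \<open>j\<close> from the upper element to
  the lower one.\<close>

lemma Adm_right:
  assumes "x \<in> coset" "w \<in> W" "j \<in> generated J"
    "below (seen_from base_point) (x ` A) ((transl (w \<mu>) \<circ> j) ` A)"
  shows "x \<in> Adm D \<mu> \<cdot>\<^sub>g generated J"
proof -
  obtain j' where j': "j' \<in> generated J"
    "below (seen_from base_point) ((x \<circ> j') ` A) (transl (w \<mu>) ` A)"
    using right_lift[OF \<mu> J assms(3) transl_orbit_coset[OF \<mu> assms(2)] assms(1,4)] by blast
  have "x \<circ> j' \<in> Adm D \<mu>"
    unfolding Adm_iff[OF \<mu>] using coset_right[OF \<mu> assms(1) generated_J_Wa[OF j'(1)]] assms(2) j'(2) by blast
  moreover have "x = (x \<circ> j') \<circ> inv_into UNIV j'"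
    using comp_inv(1)[OF J.generated_bij[OF j'(1)]] by (simp only: comp_assoc comp_id)
  ultimately show ?thesis unfolding group_prod_iff using J.generated_inv[OF j'(1)] by blast
qed

lemma coset_Adm_imp_Adm:
  assumes "x \<in> coset_Adm"
  shows "x \<in> Adm D \<mu> \<cdot>\<^sub>g generated J"
proof -
  have x: "x \<in> coset" using assms by (simp add: coset_Adm_def)
  obtain w where w: "w \<in> W" "\<And>F Y. is_face F \<Longrightarrow> below (against (w rho)) (x ` F) Y \<Longrightarrow>
      below (seen_from base_point) (x ` F) Y"
    using acute_chamber[of x] x by metis
  obtain j where j: "j \<in> generated J" "below (against (w rho)) (x ` A) (transl (w \<mu>) ` j ` A)"
    using assms w(1) unfolding coset_Adm_def by blast
  then have "below (seen_from base_point) (x ` A) ((transl (w \<mu>) \<circ> j) ` A)"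
    using w(2)[OF base_alcove_face j(2)] by (simp only: image_comp)
  then show ?thesis by (rule Adm_right[OF x w(1) j(1)])
qed

text \<open>Left factors pass into \<open>coset_Adm\<close>, and from there they reappear on the
  right.\<close>

lemma Adm_J_eq: "Adm_J D J \<mu> = Adm D \<mu> \<cdot>\<^sub>g generated J"
proof
  show "Adm_J D J \<mu> \<subseteq> Adm D \<mu> \<cdot>\<^sub>g generated J"
  proof
    fix x assume "x \<in> Adm_J D J \<mu>"
    then obtain z j where z: "z \<in> generated J \<cdot>\<^sub>g Adm D \<mu>" "j \<in> generated J" "x = z \<circ> j"
      unfolding Adm_J_def group_prod_iff[of x] by blast
    then obtain g y where x: "g \<in> generated J" "y \<in> Adm D \<mu>" "j \<in> generated J" "x = g \<circ> y \<circ> j"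
      unfolding group_prod_iff by blast
    have "g \<circ> y \<in> coset_Adm" using coset_Adm_left[OF x(1)] Adm_sub_coset_Adm x(2) by blast
    then obtain z j' where z: "z \<in> Adm D \<mu>" "j' \<in> generated J" "g \<circ> y = z \<circ> j'"
      using coset_Adm_imp_Adm unfolding group_prod_iff by blast
    have "x = z \<circ> (j' \<circ> j)" unfolding x(4) z(3) by (rule comp_assoc)
    then show "x \<in> Adm D \<mu> \<cdot>\<^sub>g generated J"
      unfolding group_prod_iff using z(1) J.generated_comp[OF z(2) x(3)] by blast
  qed
  show "Adm D \<mu> \<cdot>\<^sub>g generated J \<subseteq> Adm_J D J \<mu>"
  proof
    fix x assume "x \<in> Adm D \<mu> \<cdot>\<^sub>g generated J"
    then obtain y j where x: "y \<in> Adm D \<mu>" "j \<in> generated J" "x = y \<circ> j"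
      unfolding group_prod_iff by blast
    have "y = id \<circ> y" by (simp only: id_comp)
    then have "y \<in> generated J \<cdot>\<^sub>g Adm D \<mu>"
      unfolding group_prod_iff using J.generated_id x(1) by blast
    then show "x \<in> Adm_J D J \<mu>" unfolding Adm_J_def group_prod_iff[of x] using x(2,3) by blast
  qed
qed

text \<open>Right multiplication by the group generated by \<open>J\<close> does not move vertices
  of type not in \<open>J\<close>, and chains of alcoves restrict to chains of vertices.\<close>

lemma Adm_generated_sub_Perm: "Adm D \<mu> \<cdot>\<^sub>g generated J \<subseteq> Perm_st_J D J \<mu>"
proof
  fix x assume "x \<in> Adm D \<mu> \<cdot>\<^sub>g generated J"
  then obtain y j where x: "y \<in> Adm D \<mu>" "j \<in> generated J" "x = y \<circ> j"
    unfolding group_prod_iff by blast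
  have y: "y \<in> coset" "\<And>w. w \<in> W \<Longrightarrow> below (against (w rho)) (y ` A) (transl (w \<mu>) ` A)"
    using Adm_imp_Adm_st[OF x(1)] unfolding Adm_st_iff by blast+
  have "below (against (w rho)) (x ` v) (transl (w \<mu>) ` v)"
    if v: "v \<in> vertices D" "type_not_in v J" and w: "w \<in> W" for v w
  proof -
    have "j ` v = v" using v(2) by (intro generated_fixes[OF J x(2)]) (simp add: type_not_in_def)
    then have "x ` v = y ` v" unfolding x(3) by (metis image_comp)
    then show ?thesis
      using alcoves_to_faces[OF \<mu> y(2)[OF w] y(1) vertex_face(1)[OF v(1)] transl_orbit_coset[OF \<mu> w]]
      by simp
  qed
  moreover have "x \<in> coset" unfolding x(3) using coset_right[OF \<mu> y(1) generated_J_Wa[OF x(2)]] .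
  ultimately show "x \<in> Perm_st_J D J \<mu>" unfolding Perm_st_J_iff by blast
qed

text \<open>The chamber is chosen from \<open>x\<close> alone, so all vertices are compared with one
  and the same translation, as \<open>vertexwise_comparison\<close> requires.\<close>

lemma Perm_sub_Adm_generated:
  assumes a: "a \<in> vertices D" "type_not_in a J"
  shows "Perm_st_J D J \<mu> \<subseteq> Adm D \<mu> \<cdot>\<^sub>g generated J"
proof
  fix x assume "x \<in> Perm_st_J D J \<mu>"
  then have x: "x \<in> coset" "\<And>v w. v \<in> vertices D \<Longrightarrow> type_not_in v J \<Longrightarrow> w \<in> W \<Longrightarrow>
      below (against (w rho)) (x ` v) (transl (w \<mu>) ` v)"
    unfolding Perm_st_J_iff by blast+
  obtain w where w: "w \<in> W" "\<And>F Y. is_face F \<Longrightarrow> below (against (w rho)) (x ` F) Y \<Longrightarrow>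
      below (seen_from base_point) (x ` F) Y"
    using acute_chamber[of x] x(1) by metis
  have "below (seen_from (id base_point)) (x ` v) (transl (w \<mu>) ` v)"
    if v: "v \<in> vertices D" "type_not_in v J" for v
    using w(2)[OF vertex_face(1)[OF v(1)] x(2)[OF v w(1)]] by (simp only: id_apply)
  then obtain j where j: "j \<in> generated J"
    "below (seen_from (id base_point)) ((x \<circ> j) ` A) (transl (w \<mu>) ` A)"
    using vertexwise_comparison[OF \<mu> J a Wa_id x(1) transl_orbit_coset[OF \<mu> w(1)]] by blast
  have xj: "x \<circ> j \<in> coset" using coset_right[OF \<mu> x(1) generated_J_Wa[OF j(1)]] .
  have "x \<circ> j \<in> Adm D \<mu>"
    unfolding Adm_iff[OF \<mu>] using xj w(1) j(2)[unfolded id_apply] by blast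
  moreover have "x = (x \<circ> j) \<circ> inv_into UNIV j"
    using comp_inv(1)[OF J.generated_bij[OF j(1)]] by (simp only: comp_assoc comp_id)
  ultimately show "x \<in> Adm D \<mu> \<cdot>\<^sub>g generated J"
    unfolding group_prod_iff using J.generated_inv[OF j(1)] by blast
qed

end

text \<open>\<open>transl \<mu>\<close> is admissible, and the affine Weyl group acts transitively
  on the coset from the right.\<close>

lemma Adm_generated_all: "Adm D \<mu> \<cdot>\<^sub>g generated S = coset"
proof
  show "Adm D \<mu> \<cdot>\<^sub>g generated S \<subseteq> coset"
  proof
    fix x assume "x \<in> Adm D \<mu> \<cdot>\<^sub>g generated S"
    then obtain y j where x: "y \<in> Adm D \<mu>" "j \<in> generated S" "x = y \<circ> j"
      unfolding group_prod_iff by blast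
    then have "y \<in> coset" unfolding Adm_iff[OF \<mu>] by blast
    then show "x \<in> coset" unfolding x(3) using coset_right[OF \<mu>] x(2) Wa_generated_simple by simp
  qed
  show "coset \<subseteq> Adm D \<mu> \<cdot>\<^sub>g generated S"
  proof
    fix x assume x: "x \<in> coset"
    have "x = transl \<mu> \<circ> (inv_into UNIV (transl \<mu>) \<circ> x)"
      using comp_inv(1)[OF transl_bij] by (metis comp_assoc id_comp)
    moreover have "inv_into UNIV (transl \<mu>) \<circ> x \<in> generated S"
      using coset_right_diff[OF \<mu> transl_coset[OF \<mu>] x] Wa_generated_simple by simp
    ultimately show "x \<in> Adm D \<mu> \<cdot>\<^sub>g generated S" unfolding group_prod_iff using transl_Adm by blast
  qed
qed

lemma group_prod_trivial: "X \<cdot>\<^sub>g generated {} = (X :: ('v \<Rightarrow> 'v) set)"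
proof -
  have "generated {} = {id :: 'v \<Rightarrow> 'v}"
    using involutions.generated_words[of "{} :: ('v \<Rightarrow> 'v) set"] by (simp add: involutions_def)
  then show ?thesis by (simp add: group_prod_def)
qed

lemma Perm_eq:
  assumes "J \<subseteq> S" "vertexwise D J"
  shows "Perm_st_J D J \<mu> = Adm D \<mu> \<cdot>\<^sub>g generated J"
proof (cases "\<exists>a\<in>vertices D. type_not_in a J")
  case True
  then show ?thesis
    using Perm_sub_Adm_generated[OF assms(1)] Adm_generated_sub_Perm[OF assms(1)] by blast
next
  case False
  \<comment> \<open>Without a vertex of type not in \<open>J\<close> the vertex condition is empty,
    and both sides are the whole coset.\<close>
  then have "J = S" using assms(2) by (auto simp: vertexwise_def)
  moreover have "Perm_st_J D J \<mu> = coset" unfolding Perm_st_J_def using False by blast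
  ultimately show ?thesis using Adm_generated_all by simp
qed

lemma vertexwise_empty: "vertexwise D {}"
  using vertex_exists by (auto simp: vertexwise_def type_not_in_def)

lemma Perm_st_eq: "Perm_st D \<mu> = Adm D \<mu>"
  unfolding Perm_st_def using Perm_eq[OF empty_subsetI vertexwise_empty] group_prod_trivial by simp

lemma Adm_st_eq: "Adm_st D \<mu> = Adm D \<mu>"
proof
  show "Adm D \<mu> \<subseteq> Adm_st D \<mu>" using Adm_imp_Adm_st by blast
  show "Adm_st D \<mu> \<subseteq> Adm D \<mu>"
  proof
    fix x assume "x \<in> Adm_st D \<mu>"
    then have x: "x \<in> coset" "\<And>w. w \<in> W \<Longrightarrow> below (against (w rho)) (x ` A) (transl (w \<mu>) ` A)"
      unfolding Adm_st_iff by blast+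
    obtain w where w: "w \<in> W" "\<And>F Y. is_face F \<Longrightarrow> below (against (w rho)) (x ` F) Y \<Longrightarrow>
        below (seen_from base_point) (x ` F) Y"
      using acute_chamber[of x] x(1) by metis
    then show "x \<in> Adm D \<mu>"
      unfolding Adm_iff[OF \<mu>] using w(2)[OF base_alcove_face x(2)[OF w(1)]] x(1) by blast
  qed
qed

end

end

theorem theorem1p3:
  fixes D :: "('u::real_vector, 'v::real_normed_vector) root_datum"
    and \<mu> :: 'v and J :: "('v \<Rightarrow> 'v) set"
  assumes "based_reduced_root_datum D"
    and "\<mu> \<in> cocharacters D \<inter> closure (dominant_chamber D)"
    and "J \<subseteq> simple_affine_reflections D"
  shows "Adm_st D \<mu> \<cdot>\<^sub>g generated J = Adm_J D J \<mu>
    \<and> (vertexwise D J \<longrightarrow>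
        Adm_st D \<mu> \<cdot>\<^sub>g generated J = Perm_st_J D J \<mu> \<and> Perm_st_J D J \<mu> = Adm_J D J \<mu>)
    \<and> Adm_st D \<mu> = Perm_st D \<mu> \<and> Perm_st D \<mu> = Adm D \<mu>"
proof -
  interpret based_root_datum D by unfold_locales (rule assms(1))
  have \<mu>: "\<mu> \<in> cocharacters D" "\<mu> \<in> closure (dominant_chamber D)" using assms(2) by auto
  show ?thesis
    using Adm_J_eq[OF \<mu> assms(3)] Perm_eq[OF \<mu> assms(3)] Perm_st_eq[OF \<mu>] Adm_st_eq[OF \<mu>] by simp
qed

end
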